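(* For every integer $n \ge 1$, $$\operatorname{depth} R/(I+J)^n \ \ge\ \min_{i \in [1,n-1],\ j \in [1,n]} \big\{\operatorname{depth} A/I^{n-i} + \operatorname{depth} B/J^i + 1,\ \operatorname{depth} A/I^{n-j+1} + \operatorname{depth} B/J^j\big\},$$ $$\operatorname{reg} R/(I+J)^n \ \le\ \max_{i \in [1,n-1],\ j \in [1,n]} \big\{\operatorname{reg} A/I^{n-i} + \operatorname{reg} B/J^i + 1,\ \operatorname{reg} A/I^{n-j+1} + \operatorname{reg} B/J^j\big\}.$$ (For $n=1$ the range $i\in[1,n-1]$ is empty and only the second terms occur.)
   Context: Let $k$ be a field, $A = k[x_1,\dots,x_r]$, $B = k[y_1,\dots,y_s]$, $R = k[x_1,\dots,x_r,y_1,\dots,y_s]$, all standard graded. Let $I \subset A$ and $J \subset B$ be nonzero proper homogeneous ideals; $I$ and $J$ also denote their extensions to $R$. For a finitely generated graded module $M$ over a standard graded polynomial ring with maximal homogeneous ideal $\mathfrak m$, $\operatorname{depth} M = \min\{i : H^i_{\mathfrak m}(M)\neq 0\}$, $a^i(M)=\max\{t : H^i_{\mathfrak m}(M)_t \ne 0\}$ ($-\infty$ if $H^i_{\mathfrak m}(M)=0$), and $\operatorname{reg} M = \max_i\{a^i(M)+i\}$ (Castelnuovo–Mumford regularity). *)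

theory Defs
  imports "HOL-Library.Poly_Mapping"
begin

text \<open>Polynomials in variables indexed by natural numbers, represented (as in the AFP
  entry Polynomials) by finitely supported maps from monomials (finitely supported
  exponent vectors) to coefficients.  The polynomial ring in the variables of a set V
  is the subring of polynomials all of whose monomials only involve variables in V.\<close>

type_synonym 'k mpoly = "(nat \<Rightarrow>\<^sub>0 nat) \<Rightarrow>\<^sub>0 'k"

definition Var :: "nat \<Rightarrow> 'k::comm_ring_1 mpoly" where
  "Var i = Poly_Mapping.single (Poly_Mapping.single i 1) 1"

definition mon_deg :: "(nat \<Rightarrow>\<^sub>0 nat) \<Rightarrow> nat" where
  "mon_deg m = (\<Sum>i\<in>Poly_Mapping.keys m. Poly_Mapping.lookup m i)"

definition poly_ring :: "nat set \<Rightarrow> 'k::comm_ring_1 mpoly set" where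
  "poly_ring V = {p. \<forall>m\<in>Poly_Mapping.keys p. Poly_Mapping.keys m \<subseteq> V}"

text \<open>Homogeneous of (integer) degree d in the standard grading (the zero polynomial is
  homogeneous of every degree).\<close>
definition homog :: "int \<Rightarrow> 'k::comm_ring_1 mpoly \<Rightarrow> bool" where
  "homog d p \<longleftrightarrow> (\<forall>m\<in>Poly_Mapping.keys p. int (mon_deg m) = d)"

definition ideal_in :: "nat set \<Rightarrow> 'k::comm_ring_1 mpoly set \<Rightarrow> bool" where
  "ideal_in V I \<longleftrightarrow> I \<subseteq> poly_ring V \<and> 0 \<in> I \<and> (\<forall>a\<in>I. \<forall>b\<in>I. a + b \<in> I)
     \<and> (\<forall>p\<in>poly_ring V. \<forall>a\<in>I. p * a \<in> I)"

definition gen_ideal :: "nat set \<Rightarrow> 'k::comm_ring_1 mpoly set \<Rightarrow> 'k mpoly set" where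
  "gen_ideal V G = \<Inter>{I. ideal_in V I \<and> G \<subseteq> I}"

definition homog_ideal :: "nat set \<Rightarrow> 'k::comm_ring_1 mpoly set \<Rightarrow> bool" where
  "homog_ideal V I \<longleftrightarrow> ideal_in V I \<and>
     (\<exists>G. G \<subseteq> poly_ring V \<and> (\<forall>g\<in>G. \<exists>d. homog d g) \<and> I = gen_ideal V G)"

definition ideal_pow :: "nat set \<Rightarrow> 'k::comm_ring_1 mpoly set \<Rightarrow> nat \<Rightarrow> 'k mpoly set" where
  "ideal_pow V I n = gen_ideal V {prod_list xs | xs. length xs = n \<and> set xs \<subseteq> I}"

text \<open>Let S be the polynomial ring in the finitely many variables V, m its maximal homogeneous
  ideal (generated by the variables) and M = S/J for a homogeneous ideal J.
  H^i_m(M) is the i-th cohomology of the Cech complex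
  0 \<rightarrow> M \<rightarrow> \<Oplus>_{|F|=1} M_{x_F} \<rightarrow> \<Oplus>_{|F|=2} M_{x_F} \<rightarrow> ...
  (F ranging over subsets of V, x_F the product of the variables in F), with the usual
  alternating-sign differential.  An element of degree t of M_{x_F} is a fraction f / x_F^N with
  f homogeneous of degree t + N |F|; a cochain is represented by a family of numerators c F
  over a common exponent N.\<close>

definition xprod :: "nat set \<Rightarrow> 'k::comm_ring_1 mpoly" where
  "xprod F = (\<Prod>v\<in>F. Var v)"

text \<open>f / x_F^N = 0 in (S/J)_{x_F}\<close>
definition loc_zero :: "'k::comm_ring_1 mpoly set \<Rightarrow> nat set \<Rightarrow> 'k mpoly \<Rightarrow> bool" where
  "loc_zero J F f \<longleftrightarrow> (\<exists>K. xprod F ^ K * f \<in> J)"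

text \<open>f / x_F^N = g / x_F^M in (S/J)_{x_F}\<close>
definition loc_eq :: "'k::comm_ring_1 mpoly set \<Rightarrow> nat set \<Rightarrow> 'k mpoly \<Rightarrow> nat \<Rightarrow> 'k mpoly \<Rightarrow> nat \<Rightarrow> bool" where
  "loc_eq J F f N g M \<longleftrightarrow> loc_zero J F (xprod F ^ M * f - xprod F ^ N * g)"

definition cech_cochain :: "nat set \<Rightarrow> nat \<Rightarrow> int \<Rightarrow> (nat set \<Rightarrow> 'k::comm_ring_1 mpoly) \<Rightarrow> nat \<Rightarrow> bool" where
  "cech_cochain V i t c N \<longleftrightarrow>
     (\<forall>F. F \<subseteq> V \<and> card F = i \<longrightarrow> c F \<in> poly_ring V \<and> homog (t + int (N * card F)) (c F))"

text \<open>Cech differential: (dc)_G = sum over j in G of (-1)^(position of j in G) c_{G-j},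
  the fraction c_{G-j}/x_{G-j}^N being rewritten as c_{G-j} x_j^N / x_G^N.\<close>
definition cech_d :: "(nat set \<Rightarrow> 'k::comm_ring_1 mpoly) \<Rightarrow> nat \<Rightarrow> nat set \<Rightarrow> 'k mpoly" where
  "cech_d c N G = (\<Sum>j\<in>G. (- 1) ^ card {v\<in>G. v < j} * c (G - {j}) * Var j ^ N)"

definition cech_cocycle :: "'k::comm_ring_1 mpoly set \<Rightarrow> nat set \<Rightarrow> nat \<Rightarrow> (nat set \<Rightarrow> 'k mpoly) \<Rightarrow> nat \<Rightarrow> bool" where
  "cech_cocycle J V i c N \<longleftrightarrow> (\<forall>G. G \<subseteq> V \<and> card G = Suc i \<longrightarrow> loc_zero J G (cech_d c N G))"

definition cech_coboundary :: "'k::comm_ring_1 mpoly set \<Rightarrow> nat set \<Rightarrow> nat \<Rightarrow> int \<Rightarrow> (nat set \<Rightarrow> 'k mpoly) \<Rightarrow> nat \<Rightarrow> bool" where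
  "cech_coboundary J V i t c N \<longleftrightarrow>
     (\<exists>b N'. (0 < i \<longrightarrow> cech_cochain V (i - 1) t b N') \<and>
        (\<forall>F. F \<subseteq> V \<and> card F = i \<longrightarrow> loc_eq J F (c F) N (cech_d b N' F) N'))"

definition loc_coh_nonzero :: "nat set \<Rightarrow> 'k::comm_ring_1 mpoly set \<Rightarrow> nat \<Rightarrow> int \<Rightarrow> bool" where
  "loc_coh_nonzero V J i t \<longleftrightarrow>
     (\<exists>c N. cech_cochain V i t c N \<and> cech_cocycle J V i c N \<and> \<not> cech_coboundary J V i t c N)"

text \<open>depth S/J = min {i. H^i_m(S/J) \<noteq> 0}  (used for proper J, where S/J \<noteq> 0)\<close>
definition depth_quot :: "nat set \<Rightarrow> 'k::comm_ring_1 mpoly set \<Rightarrow> nat" where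
  "depth_quot V J = (LEAST i. \<exists>t. loc_coh_nonzero V J i t)"

text \<open>reg S/J = max_i (a^i(S/J) + i) = max {t + i. H^i_m(S/J)_t \<noteq> 0}\<close>
definition reg_quot :: "nat set \<Rightarrow> 'k::comm_ring_1 mpoly set \<Rightarrow> int" where
  "reg_quot V J = Sup {t + int i | i t. loc_coh_nonzero V J i t}"

end

theory Submission
  imports Defs "HOL-Library.Function_Algebras" HOL.Vector_Spaces HOL.Topological_Spaces
begin

text \<open>Write A, B, R for the three polynomial rings. The ideals I^i R + (I + J)^n, for i = 0, ..., n,
  filter R down to (I + J)^n, and the i-th quotient is I^i/I^(i+1) \<otimes> B/J^(n-i) (tensor product over k).
  By the Kuenneth formula a nonzero class in H^k(R/(I + J)^n)_t yields an i and nonzero classes in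
  H^p(I^i/I^(i+1))_a and H^q(B/J^(n-i))_b with p + q = k and a + b = t, and the long exact sequence
  of 0 \<rightarrow> I^i/I^(i+1) \<rightarrow> A/I^(i+1) \<rightarrow> A/I^i \<rightarrow> 0 moves the first of them to
  H^p(A/I^(i+1))_a or H^(p-1)(A/I^i)_a. Both bounds follow by comparing k and t + k.

  For this the invariants must be given by nonempty (and, for the regularity, bounded) sets:
  the Cech complex of a nonzero S/J is not exact, and it is exact in large degrees.\<close>

section \<open>Sums over monomials and homogeneous components\<close>

text \<open>Depth and regularity are given through numerators over a common exponent, while the
  argument needs subquotients P/Q, tensor products and long exact sequences. No quotient is ever
  formed: vanishing of the cohomology of P/Q becomes a statement about cochains of P whose
  differential lies in Q. Cohomological and internal degrees are integers, so k - 1 needs no case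
  distinction. Of the Kuenneth formula only the vanishing half is used: a product is exact in
  bidegree (k, t) if for every splitting of k and t one factor is exact. Which factor it is changes
  with the splitting, so homotopies are built in all bidegrees by choosing bases over the field, and
  they contract only where exactness holds. Nonempty and bounded sets are required because
  \<open>LEAST\<close> and \<open>Sup\<close> say nothing otherwise. Nonvanishing is found in some
  bidegree (k, -k), the one of the fractions 1/x_G with |G| = k. Vanishing in large degrees is a
  Noetherian induction on J, by adjoining a variable to J and dividing J by it.\<close>

abbreviation keys :: "('a \<Rightarrow>\<^sub>0 'b::zero) \<Rightarrow> 'a set" where "keys \<equiv> Poly_Mapping.keys"
abbreviation lookup :: "('a \<Rightarrow>\<^sub>0 'b::zero) \<Rightarrow> 'a \<Rightarrow> 'b" where "lookup \<equiv> Poly_Mapping.lookup"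
abbreviation single :: "'a \<Rightarrow> 'b \<Rightarrow> 'a \<Rightarrow>\<^sub>0 'b::zero" where "single \<equiv> Poly_Mapping.single"

text \<open>The maps determined by their values on single terms are instances: \<open>restr\<close>,
  \<open>deg\<close>, \<open>toint\<close>, \<open>emb\<close> and \<open>lmap\<close>. The
  coefficient is an argument of \<phi>, so the target needs no module structure.\<close>

definition lext :: "('a \<Rightarrow> 'b \<Rightarrow> 'c) \<Rightarrow> ('a \<Rightarrow>\<^sub>0 'b::zero) \<Rightarrow> 'c::comm_monoid_add" where
  "lext \<phi> p = (\<Sum>m\<in>keys p. \<phi> m (lookup p m))"

lemma lext_0 [simp]: "lext \<phi> 0 = 0"
  by (simp add: lext_def)

lemma lext_superset:
  assumes "\<And>m. \<phi> m 0 = 0" "finite M" "keys p \<subseteq> M"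
  shows "lext \<phi> p = (\<Sum>m\<in>M. \<phi> m (lookup p m))"
  unfolding lext_def
  by (rule sum.mono_neutral_left) (use assms in \<open>auto simp: in_keys_iff\<close>)

lemma lext_single:
  assumes "\<And>m. \<phi> m 0 = 0"
  shows "lext \<phi> (single m u) = \<phi> m u"
  using lext_superset[of \<phi> "{m}" "single m u"] assms by simp

lemma lext_add:
  fixes p q :: "'a \<Rightarrow>\<^sub>0 'b::monoid_add"
  assumes "\<And>m. \<phi> m 0 = 0" "\<And>m u w. \<phi> m (u + w) = \<phi> m u + \<phi> m w"
  shows "lext \<phi> (p + q) = lext \<phi> p + lext \<phi> q"
proof -
  let ?M = "keys p \<union> keys q"
  have "keys (p + q) \<subseteq> ?M" by (rule keys_add)
  then show ?thesis
    by (simp add: lext_superset[where M = ?M and \<phi> = \<phi>] assms lookup_add sum.distrib)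
qed

lemma poly_mapping_sum_single:
  "p = (\<Sum>m\<in>keys p. single m (lookup p m))"
proof (rule poly_mapping_eqI)
  fix k
  show "lookup p k = lookup (\<Sum>m\<in>keys p. single m (lookup p m)) k"
    by (auto simp: lookup_sum lookup_single when_def sum.delta' in_keys_iff if_distrib cong: if_cong)
qed

text \<open>The \<open>single\<close> case concerns only monomials of the given p, so facts about
  the support of p stay available; its coefficient is arbitrary.\<close>

lemma poly_mapping_single_induct [case_names zero single add]:
  fixes p :: "'a \<Rightarrow>\<^sub>0 'b::comm_monoid_add"
  assumes "P 0" "\<And>m u. m \<in> keys p \<Longrightarrow> P (single m u)"
    "\<And>p q. P p \<Longrightarrow> P q \<Longrightarrow> P (p + q)"
  shows "P p"
proof -
  have "P (\<Sum>m\<in>M. single m (lookup p m))"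
    if "M \<subseteq> keys p" "finite M" for M
    using that(2,1) by (induction M) (use assms in auto)
  then show ?thesis using poly_mapping_sum_single[of p] by (metis finite_keys subset_refl)
qed

section \<open>Additive maps, additive subgroups and additive spans\<close>

definition additive_fun :: "('a::comm_monoid_add \<Rightarrow> 'b::comm_monoid_add) \<Rightarrow> bool" where
  "additive_fun f \<longleftrightarrow> f 0 = 0 \<and> (\<forall>x y. f (x + y) = f x + f y)"

lemma additive_funI: "f 0 = 0 \<Longrightarrow> (\<And>x y. f (x + y) = f x + f y) \<Longrightarrow> additive_fun f"
  by (auto simp: additive_fun_def)

lemma additive_fun_0: "additive_fun f \<Longrightarrow> f 0 = 0"
  and additive_fun_add: "additive_fun f \<Longrightarrow> f (x + y) = f x + f y"
  by (auto simp: additive_fun_def)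

lemma additive_fun_minus:
  fixes f :: "'a::ab_group_add \<Rightarrow> 'b::ab_group_add"
  assumes "additive_fun f"
  shows "f (- x) = - f x" "f (x - y) = f x - f y"
proof -
  have *: "f (- x) = - f x" for x
    using additive_fun_add[OF assms, of x "- x"] additive_fun_0[OF assms]
    by (simp add: eq_neg_iff_add_eq_0 add.commute)
  then show "f (- x) = - f x" .
  show "f (x - y) = f x - f y"
    using additive_fun_add[OF assms, of x "- y"] * by simp
qed

lemma additive_fun_sum: "additive_fun f \<Longrightarrow> f (sum g A) = (\<Sum>x\<in>A. f (g x))"
  by (induction A rule: infinite_finite_induct) (auto simp: additive_fun_0 additive_fun_add)

lemma additive_lext:
  fixes \<phi> :: "'a \<Rightarrow> 'b::comm_monoid_add \<Rightarrow> 'c::comm_monoid_add"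
  assumes "\<And>m. additive_fun (\<phi> m)"
  shows "additive_fun (lext \<phi>)"
  by (intro additive_funI) (simp_all add: lext_add additive_fun_0[OF assms] additive_fun_add[OF assms])

definition add_closed :: "'a::ab_group_add set \<Rightarrow> bool" where
  "add_closed S \<longleftrightarrow> 0 \<in> S \<and> (\<forall>x\<in>S. \<forall>y\<in>S. x + y \<in> S) \<and> (\<forall>x\<in>S. - x \<in> S)"

lemma add_closedD:
  assumes "add_closed S"
  shows "0 \<in> S" "x \<in> S \<Longrightarrow> y \<in> S \<Longrightarrow> x + y \<in> S" "x \<in> S \<Longrightarrow> - x \<in> S" "x \<in> S \<Longrightarrow> y \<in> S \<Longrightarrow> x - y \<in> S"
proof -
  show "0 \<in> S" "x \<in> S \<Longrightarrow> y \<in> S \<Longrightarrow> x + y \<in> S" "x \<in> S \<Longrightarrow> - x \<in> S"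
    using assms by (auto simp: add_closed_def)
  show "x \<in> S \<Longrightarrow> y \<in> S \<Longrightarrow> x - y \<in> S"
    using assms unfolding add_closed_def by (metis diff_conv_add_uminus)
qed

lemma add_closed_sum: "add_closed S \<Longrightarrow> (\<And>x. x \<in> A \<Longrightarrow> f x \<in> S) \<Longrightarrow> sum f A \<in> S"
  by (induction A rule: infinite_finite_induct) (auto simp: add_closedD)

lemma add_closed_neg_power: "add_closed S \<Longrightarrow> (x::'a::comm_ring_1) \<in> S \<Longrightarrow> (- 1) ^ k * x \<in> S"
  by (cases "even k") (auto simp: add_closedD)

text \<open>Negatives are not put in: sets of products already absorb a sign (see
  \<open>add_closed_aspan\<close>), and inductions then have one step, which adds a
  generator.\<close>

inductive_set aspan :: "'a::ab_group_add set \<Rightarrow> 'a set" for G where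
  aspan_0: "0 \<in> aspan G"
| aspan_step: "g \<in> G \<Longrightarrow> x \<in> aspan G \<Longrightarrow> g + x \<in> aspan G"

lemma aspan_base: "g \<in> G \<Longrightarrow> g \<in> aspan G"
  using aspan_step[OF _ aspan_0] by fastforce

lemma aspan_add: "x \<in> aspan G \<Longrightarrow> y \<in> aspan G \<Longrightarrow> x + y \<in> aspan G"
  by (induction rule: aspan.induct) (auto simp: add.assoc intro: aspan_step)

lemma aspan_sum: "(\<And>x. x \<in> A \<Longrightarrow> f x \<in> aspan G) \<Longrightarrow> sum f A \<in> aspan G"
  by (induction A rule: infinite_finite_induct) (auto intro: aspan_0 aspan_add)

lemma aspan_image:
  assumes "additive_fun f" "\<And>g. g \<in> G \<Longrightarrow> f g \<in> aspan H" "x \<in> aspan G"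
  shows "f x \<in> aspan H"
  using assms(3)
  by induction (auto simp: additive_fun_0[OF assms(1)] additive_fun_add[OF assms(1)] intro: aspan_0 aspan_add assms(2))

lemma aspan_least: "add_closed S \<Longrightarrow> G \<subseteq> S \<Longrightarrow> aspan G \<subseteq> S"
proof
  fix x assume "x \<in> aspan G" "add_closed S" "G \<subseteq> S"
  then show "x \<in> S" by induction (auto simp: add_closedD)
qed

lemma aspan_mono: "G \<subseteq> H \<Longrightarrow> aspan G \<subseteq> aspan H"
proof
  fix x assume "x \<in> aspan G" "G \<subseteq> H"
  then show "x \<in> aspan H" by induction (auto intro: aspan_0 aspan_step)
qed

lemma add_closed_aspan:
  assumes "\<And>g. g \<in> G \<Longrightarrow> - g \<in> G"
  shows "add_closed (aspan G)"
proof -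
  have "- x \<in> aspan G" if "x \<in> aspan G" for x
    by (rule aspan_image[OF _ _ that]) (auto intro: additive_funI aspan_base assms)
  then show ?thesis unfolding add_closed_def by (auto intro: aspan_0 aspan_add)
qed

section \<open>Restriction to monomials, degrees and homogeneous components\<close>

definition restr :: "('a \<Rightarrow> bool) \<Rightarrow> ('a \<Rightarrow>\<^sub>0 'b::comm_monoid_add) \<Rightarrow> ('a \<Rightarrow>\<^sub>0 'b)" where
  "restr R = lext (\<lambda>k u. if R k then single k u else 0)"

lemma additive_restr: "additive_fun (restr R)"
  unfolding restr_def by (rule additive_lext) (auto intro!: additive_funI simp: single_add)

lemma restr_0 [simp]: "restr R 0 = 0" by (simp add: restr_def)

lemma restr_add: "restr R (p + q) = restr R p + restr R q"
  by (rule additive_fun_add[OF additive_restr])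

lemma restr_diff: "restr R (p - q) = restr R p - restr R (q :: _ \<Rightarrow>\<^sub>0 _::ab_group_add)"
  by (rule additive_fun_minus[OF additive_restr])

lemma restr_single: "restr R (single k u) = (if R k then single k u else 0)"
  unfolding restr_def by (rule lext_single) simp

lemma lookup_restr: "lookup (restr R p) k = (if R k then lookup p k else 0)"
  by (induction p rule: poly_mapping_single_induct)
    (auto simp: restr_add restr_single lookup_add lookup_single when_def)

lemma keys_restr: "keys (restr R p) = {k\<in>keys p. R k}"
  by (auto simp: in_keys_iff lookup_restr split: if_splits)

lemma restr_id: "(\<And>k. k \<in> keys p \<Longrightarrow> R k) \<Longrightarrow> restr R p = p"
  by (rule poly_mapping_eqI) (auto simp: lookup_restr in_keys_iff)

lemma restr_none: "(\<And>k. k \<in> keys p \<Longrightarrow> \<not> R k) \<Longrightarrow> restr R p = 0"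
  by (rule poly_mapping_eqI) (auto simp: lookup_restr in_keys_iff)

definition res :: "nat set \<Rightarrow> (nat \<Rightarrow>\<^sub>0 'e::comm_monoid_add) \<Rightarrow> (nat \<Rightarrow>\<^sub>0 'e)" where
  "res U = restr (\<lambda>v. v \<in> U)"

lemma res_add: "res U (\<alpha> + \<beta>) = res U \<alpha> + res U \<beta>"
  by (simp add: res_def restr_add)

lemma keys_res: "keys (res U \<alpha>) = keys \<alpha> \<inter> U"
  by (auto simp: res_def keys_restr)

lemma res_id: "keys \<alpha> \<subseteq> U \<Longrightarrow> res U \<alpha> = \<alpha>"
  unfolding res_def by (rule restr_id) auto

lemma res_none: "keys \<alpha> \<inter> U = {} \<Longrightarrow> res U \<alpha> = 0"
  unfolding res_def by (rule restr_none) auto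

lemma res_compl: "res U \<alpha> + res (- U) \<alpha> = \<alpha>"
  by (rule poly_mapping_eqI) (auto simp: res_def lookup_restr lookup_add)

definition deg :: "('a \<Rightarrow>\<^sub>0 'e::comm_monoid_add) \<Rightarrow> 'e" where
  "deg = lext (\<lambda>_ e. e)"

lemma deg_add: "deg (\<alpha> + \<beta>) = deg \<alpha> + deg \<beta>"
  unfolding deg_def by (rule lext_add) auto

lemma deg_0 [simp]: "deg 0 = 0" by (simp add: deg_def)

lemma deg_single [simp]: "deg (single v e) = e"
  unfolding deg_def by (rule lext_single) auto

lemma mon_deg_eq_deg: "mon_deg m = deg m"
  by (simp add: mon_deg_def deg_def lext_def)

text \<open>Generic in the exponents, unlike \<open>homog\<close>: natural exponents give
  polynomials, integer exponents Laurent polynomials, and both occur side by side.\<close>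

definition homogen :: "'e::comm_monoid_add \<Rightarrow> (('a \<Rightarrow>\<^sub>0 'e) \<Rightarrow>\<^sub>0 'k::comm_ring_1) \<Rightarrow> bool" where
  "homogen t f \<longleftrightarrow> (\<forall>m\<in>keys f. deg m = t)"

definition hcomp :: "'e::comm_monoid_add \<Rightarrow> (('a \<Rightarrow>\<^sub>0 'e) \<Rightarrow>\<^sub>0 'k::comm_ring_1) \<Rightarrow> (('a \<Rightarrow>\<^sub>0 'e) \<Rightarrow>\<^sub>0 'k)" where
  "hcomp t = restr (\<lambda>m. deg m = t)"

lemma hcomp_0 [simp]: "hcomp t 0 = 0" and hcomp_add: "hcomp t (f + g) = hcomp t f + hcomp t g"
  and hcomp_diff: "hcomp t (f - g) = hcomp t f - hcomp t g"
  and additive_hcomp: "additive_fun (hcomp t)"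
  by (simp_all add: hcomp_def restr_add restr_diff additive_restr)

lemma hcomp_single: "hcomp t (single k u) = (if deg k = t then single k u else 0)"
  by (simp add: hcomp_def restr_single)

lemma homogen_hcomp [simp]: "homogen t (hcomp t f)"
  by (auto simp: homogen_def hcomp_def keys_restr)

lemma hcomp_homogen: "homogen t f \<Longrightarrow> hcomp d f = (if d = t then f else 0)"
  by (auto simp: hcomp_def homogen_def intro!: restr_id restr_none)

lemma homogen_0 [simp]: "homogen t 0" by (simp add: homogen_def)

lemma homogen_iff_hcomp: "homogen t f \<longleftrightarrow> hcomp t f = f"
  using hcomp_homogen homogen_hcomp by metis

lemma homogen_add: "homogen t f \<Longrightarrow> homogen t g \<Longrightarrow> homogen t (f + g)"
  by (simp add: homogen_iff_hcomp hcomp_add)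

lemma homogen_diff: "homogen t f \<Longrightarrow> homogen t g \<Longrightarrow> homogen t (f - g)"
  by (simp add: homogen_iff_hcomp hcomp_diff)

lemma homogen_uminus: "homogen t f \<Longrightarrow> homogen t (- f)"
  using homogen_diff[of t 0 f] by simp

lemma homogen_single: "homogen t (single k u) \<longleftrightarrow> u = 0 \<or> deg k = t"
  by (auto simp: homogen_def)

lemma homogen_mult:
  assumes "homogen s f" "homogen t g"
  shows "homogen (s + t) (f * g)"
  using assms keys_mult[of f g] by (fastforce simp: homogen_def deg_add)

lemma hcomp_mult_homogen:
  fixes f g :: "('a \<Rightarrow>\<^sub>0 'e::cancel_comm_monoid_add) \<Rightarrow>\<^sub>0 'k::comm_ring_1"
  assumes "homogen s f"
  shows "hcomp (s + t) (f * g) = f * hcomp t g"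
proof (induction g rule: poly_mapping_single_induct)
  case (single m u)
  have "homogen (s + deg m) (f * single m u)"
    by (rule homogen_mult[OF assms]) (simp add: homogen_single)
  then show ?case by (auto simp: hcomp_homogen hcomp_single)
qed (simp_all add: hcomp_add distrib_left)

lemma sum_hcomp:
  assumes "finite D" "deg ` keys f \<subseteq> D"
  shows "(\<Sum>d\<in>D. hcomp d f) = f"
proof (rule poly_mapping_eqI)
  fix k
  have "(\<Sum>d\<in>D. lookup (hcomp d f) k) = (\<Sum>d\<in>D. if d = deg k then lookup f k else 0)"
    by (rule sum.cong) (auto simp: hcomp_def lookup_restr)
  also have "\<dots> = lookup f k"
    using assms by (auto simp: sum.delta' in_keys_iff image_subset_iff)
  finally show "lookup (\<Sum>d\<in>D. hcomp d f) k = lookup f k"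
    by (simp add: lookup_sum)
qed

section \<open>The Cech complex inside Laurent polynomials\<close>

type_synonym 'k lpoly = "(nat \<Rightarrow>\<^sub>0 int) \<Rightarrow>\<^sub>0 'k"

definition toint :: "(nat \<Rightarrow>\<^sub>0 nat) \<Rightarrow> (nat \<Rightarrow>\<^sub>0 int)" where
  "toint = lext (\<lambda>v e. single v (int e))"

lemma toint_add: "toint (m + m') = toint m + toint m'"
  unfolding toint_def by (rule lext_add) (auto simp: single_add)

lemma toint_0 [simp]: "toint 0 = 0" by (simp add: toint_def)

lemma toint_single [simp]: "toint (single v e) = single v (int e)"
  unfolding toint_def by (rule lext_single) simp

lemma lookup_toint: "lookup (toint m) v = int (lookup m v)"
  by (induction m rule: poly_mapping_single_induct)
    (auto simp: toint_add lookup_add lookup_single when_def)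

lemma toint_inject: "toint m = toint m' \<longleftrightarrow> m = m'"
  by (metis lookup_toint of_nat_eq_iff poly_mapping_eqI)

lemma deg_toint: "deg (toint m) = int (deg m)"
  by (induction m rule: poly_mapping_single_induct) (auto simp: toint_add deg_add)

lemma keys_toint: "keys (toint m) = keys m"
  by (auto simp: in_keys_iff lookup_toint)

definition emb :: "'k::comm_ring_1 mpoly \<Rightarrow> 'k lpoly" where
  "emb = lext (\<lambda>m u. single (toint m) u)"

lemma additive_emb: "additive_fun emb"
  unfolding emb_def by (rule additive_lext) (auto intro!: additive_funI simp: single_add)

lemma emb_0 [simp]: "emb (0 :: 'k::comm_ring_1 mpoly) = 0" and emb_add: "emb (p + q :: 'k mpoly) = emb p + emb q"
  and emb_uminus: "emb (- p :: 'k mpoly) = - emb p" and emb_diff: "emb (p - q :: 'k mpoly) = emb p - emb q"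
  by (rule additive_fun_0[OF additive_emb] additive_fun_add[OF additive_emb]
        additive_fun_minus[OF additive_emb])+

lemma emb_single [simp]: "emb (single m u) = single (toint m) u"
  unfolding emb_def by (rule lext_single) simp

lemma emb_1 [simp]: "emb 1 = 1"
  by (simp flip: single_one)

lemma emb_mult: "emb (p * q) = emb p * emb q"
proof (induction p rule: poly_mapping_single_induct)
  case (single m u)
  show ?case
    by (induction q rule: poly_mapping_single_induct) 
      (simp_all add: mult_single toint_add emb_add distrib_left)
qed (simp_all add: emb_add distrib_right)

lemma emb_power: "emb (p ^ n) = emb p ^ n"
  by (induction n) (simp_all add: emb_mult)

lemma lookup_emb: "lookup (emb p) (toint m) = lookup p m"
  by (induction p rule: poly_mapping_single_induct)
    (auto simp: emb_add lookup_add lookup_single when_def toint_inject)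

lemma emb_inject: "emb p = emb q \<longleftrightarrow> p = q"
  by (metis lookup_emb poly_mapping_eqI)

lemma keys_emb: "keys (emb p) = toint ` keys p"
proof
  show "keys (emb p) \<subseteq> toint ` keys p"
    unfolding emb_def lext_def
    by (rule order_trans[OF keys_sum]) (auto split: if_splits)
  show "toint ` keys p \<subseteq> keys (emb p)"
    by (auto simp: in_keys_iff lookup_emb)
qed

lemma homogen_emb: "homogen t (emb p) \<longleftrightarrow> homog t p"
  by (auto simp: homogen_def homog_def keys_emb deg_toint mon_deg_eq_deg)

lemma hcomp_emb: "hcomp (int d) (emb p) = emb (hcomp d p)"
  by (induction p rule: poly_mapping_single_induct) (auto simp: emb_add hcomp_add hcomp_single deg_toint)

text \<open>The Laurent monomial x_F^K. Since K may be negative, a fraction f / x_F^N is an ordinary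
  product.\<close>

definition Xpow :: "nat set \<Rightarrow> int \<Rightarrow> 'k::comm_ring_1 lpoly" where
  "Xpow F K = single (\<Sum>v\<in>F. single v K) 1"

lemma Xpow_0 [simp]: "Xpow F 0 = 1" by (simp add: Xpow_def)

lemma Xpow_empty [simp]: "Xpow {} K = 1" by (simp add: Xpow_def)

lemma Xpow_mult: "Xpow F K * Xpow F L = Xpow F (K + L)"
  by (simp add: Xpow_def mult_single single_add sum.distrib)

lemma Xpow_cancel [simp]: "Xpow F (- K) * (Xpow F K * f) = f" "Xpow F K * (Xpow F (- K) * f) = f"
  by (simp_all add: Xpow_mult flip: mult.assoc)

lemma Xpow_Un: "finite F \<Longrightarrow> finite G \<Longrightarrow> F \<inter> G = {} \<Longrightarrow> Xpow (F \<union> G) K = Xpow F K * Xpow G K"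
  by (simp add: Xpow_def mult_single sum.union_disjoint)

lemma Xpow_insert: "finite F \<Longrightarrow> v \<notin> F \<Longrightarrow> Xpow (insert v F) K = Xpow {v} K * Xpow F K"
  using Xpow_Un[of "{v}" F] by simp

lemma Xpow_Diff: "finite G \<Longrightarrow> F \<subseteq> G \<Longrightarrow> Xpow G K = Xpow (G - F) K * Xpow F K"
  using Xpow_Un[of "G - F" F] by (metis Diff_disjoint Diff_partition finite_Diff finite_subset inf_commute sup_commute)

lemma deg_sum: "deg (sum f A) = (\<Sum>x\<in>A. deg (f x))"
  by (induction A rule: infinite_finite_induct) (auto simp: deg_add)

lemma homogen_Xpow: "homogen (K * int (card F)) (Xpow F K)"
  by (simp add: Xpow_def homogen_single deg_sum mult.commute)

lemma emb_Var: "emb (Var v) = Xpow {v} 1"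
  by (simp add: Var_def Xpow_def)

lemma Xpow_power: "Xpow F K ^ n = Xpow F (int n * K)"
  by (induction n) (simp_all add: Xpow_mult algebra_simps)

lemma emb_xprod: "finite F \<Longrightarrow> emb (xprod F) = Xpow F 1"
proof (induction F rule: finite_induct)
  case (insert v F)
  then show ?case
    by (subst Xpow_insert) (simp_all add: xprod_def emb_mult emb_Var)
qed (simp add: xprod_def)

lemma emb_xprod_power: "finite F \<Longrightarrow> emb (xprod F ^ n) = Xpow F (int n)"
  by (simp add: emb_power emb_xprod Xpow_power)

section \<open>Polynomial subrings and homogeneous ideals\<close>

lemma add_closed_poly_ring: "add_closed (poly_ring V)"
  using keys_add unfolding add_closed_def poly_ring_def by fastforce

lemma poly_ring_mult:
  assumes "p \<in> poly_ring V" "q \<in> poly_ring V" shows "p * q \<in> poly_ring V"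
  unfolding poly_ring_def
proof safe
  fix m v assume "m \<in> keys (p * q)" and v: "v \<in> keys m"
  then obtain a b where "a \<in> keys p" "b \<in> keys q" "m = a + b"
    using keys_mult by blast
  then show "v \<in> V" using v assms keys_add[of a b] unfolding poly_ring_def by blast
qed

lemma one_poly_ring [simp]: "1 \<in> poly_ring V"
  by (auto simp: poly_ring_def)

lemma Var_poly_ring: "v \<in> V \<Longrightarrow> Var v \<in> poly_ring V"
  by (auto simp: poly_ring_def Var_def)

lemma poly_ring_power: "p \<in> poly_ring V \<Longrightarrow> p ^ n \<in> poly_ring V"
  by (induction n) (auto intro: poly_ring_mult)

lemma xprod_poly_ring: "F \<subseteq> V \<Longrightarrow> xprod F \<in> poly_ring V"
  unfolding xprod_def by (induction F rule: infinite_finite_induct) (auto intro!: poly_ring_mult Var_poly_ring)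

lemma hcomp_poly_ring: "p \<in> poly_ring V \<Longrightarrow> hcomp d p \<in> poly_ring V"
  by (auto simp: poly_ring_def hcomp_def keys_restr)

lemma poly_ring_mono: "V \<subseteq> W \<Longrightarrow> poly_ring V \<subseteq> poly_ring W"
  by (auto simp: poly_ring_def)

text \<open>Homogeneity in the form that the proofs use, as closure under components;
  \<open>hideal_homog_ideal\<close> obtains it from homogeneous generators.\<close>

definition hideal :: "nat set \<Rightarrow> 'k::comm_ring_1 mpoly set \<Rightarrow> bool" where
  "hideal V P \<longleftrightarrow> ideal_in V P \<and> (\<forall>p\<in>P. \<forall>d. hcomp d p \<in> P)"

lemma hidealD:
  assumes "hideal V P"
  shows "P \<subseteq> poly_ring V" "add_closed P" "q \<in> poly_ring V \<Longrightarrow> p \<in> P \<Longrightarrow> q * p \<in> P"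
    "p \<in> P \<Longrightarrow> hcomp d p \<in> P"
proof -
  show "P \<subseteq> poly_ring V" "q \<in> poly_ring V \<Longrightarrow> p \<in> P \<Longrightarrow> q * p \<in> P"  "p \<in> P \<Longrightarrow> hcomp d p \<in> P"
    using assms by (auto simp: hideal_def ideal_in_def)
  have "- p \<in> P" if "p \<in> P" for p
  proof -
    have "(- 1) * p \<in> P"
      using assms that add_closedD(3)[OF add_closed_poly_ring one_poly_ring] unfolding hideal_def ideal_in_def by blast
    then show ?thesis by simp
  qed
  then show "add_closed P"
    using assms by (auto simp: hideal_def ideal_in_def add_closed_def)
qed

lemma hidealI:
  assumes "P \<subseteq> poly_ring V" "add_closed P" "\<And>p q. q \<in> poly_ring V \<Longrightarrow> p \<in> P \<Longrightarrow> q * p \<in> P"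
    "\<And>p d. p \<in> P \<Longrightarrow> hcomp d p \<in> P"
  shows "hideal V P"
  using assms by (auto simp: hideal_def ideal_in_def add_closedD)

lemma hideal_poly_ring: "hideal V (poly_ring V)"
  by (rule hidealI) (auto simp: add_closed_poly_ring poly_ring_mult hcomp_poly_ring)

text \<open>Localisations are realised inside Laurent polynomials: for an ideal P, this is the degree t
  part of P_{x_F}. All of them lie in one space, so that the maps of the Cech complex of a
  subquotient P/Q are inclusions up to sign.\<close>
definition loc :: "'k::comm_ring_1 mpoly set \<Rightarrow> nat set \<Rightarrow> int \<Rightarrow> 'k lpoly set" where
  "loc P F t = {f. homogen t f \<and> (\<exists>K. Xpow F (int K) * f \<in> emb ` P)}"

lemma locI: "homogen t f \<Longrightarrow> Xpow F (int K) * f = emb p \<Longrightarrow> p \<in> P \<Longrightarrow> f \<in> loc P F t"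
  by (auto simp: loc_def)

lemma loc_homogen: "f \<in> loc P F t \<Longrightarrow> homogen t f"
  by (simp add: loc_def)

text \<open>Further powers of \<open>xprod F\<close> keep the numerator in the ideal, so every large
  exponent works. This gives finitely many fractions a common exponent.\<close>

lemma loc_obtain:
  assumes "f \<in> loc P F t" "hideal V P" "F \<subseteq> V" "finite V"
  obtains K0 where "\<And>K. K \<ge> K0 \<Longrightarrow> \<exists>p\<in>P. Xpow F (int K) * f = emb p"
proof -
  obtain K0 p where p: "p \<in> P" "Xpow F (int K0) * f = emb p" using assms(1) by (auto simp: loc_def)
  show ?thesis
  proof (rule that[of K0])
    fix K assume "K \<ge> K0"
    have "Xpow F (int K) * f = Xpow F (int (K - K0)) * (Xpow F (int K0) * f)"
      using \<open>K \<ge> K0\<close> by (simp add: Xpow_mult of_nat_diff flip: mult.assoc)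
    also have "\<dots> = emb (xprod F ^ (K - K0) * p)"
      using assms p(2) finite_subset by (metis emb_mult emb_xprod_power)
    finally show "\<exists>p\<in>P. Xpow F (int K) * f = emb p"
      using p(1) hidealD(3)[OF assms(2)] poly_ring_power xprod_poly_ring[OF assms(3)] by blast
  qed
qed

lemma homogen_Xpow_mult: "homogen t f \<Longrightarrow> homogen (t + K * int (card F)) (Xpow F K * f)"
  using homogen_mult[OF homogen_Xpow, of t f K F] by (simp add: add.commute)

lemma loc_obtain_homog:
  assumes "f \<in> loc P F t" "hideal V P" "F \<subseteq> V" "finite V"
  obtains K0 where "\<And>K. K \<ge> K0 \<Longrightarrow> \<exists>p\<in>P. homog (t + int (K * card F)) p \<and> Xpow F (int K) * f = emb p"
  using loc_obtain[OF assms] homogen_Xpow_mult[OF loc_homogen[OF assms(1)]] 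
  by (metis homogen_emb of_nat_mult)

lemma loc_obtain2:
  assumes V: "finite V" "finite W" and P: "hideal V P" "F \<subseteq> V" "f \<in> loc P F t"
    and Q: "hideal W Q" "G \<subseteq> W" "g \<in> loc Q G u"
  obtains K p q where "p \<in> P" "q \<in> Q" "Xpow F (int K) * f = emb p" "Xpow G (int K) * g = emb q"
proof -
  obtain K1 where K1: "\<And>K. K \<ge> K1 \<Longrightarrow> \<exists>p\<in>P. Xpow F (int K) * f = emb p"
    by (rule loc_obtain[OF P(3,1,2) V(1)]) blast
  obtain K2 where K2: "\<And>K. K \<ge> K2 \<Longrightarrow> \<exists>q\<in>Q. Xpow G (int K) * g = emb q"
    by (rule loc_obtain[OF Q(3,1,2) V(2)]) blast
  show ?thesis using that K1[of "max K1 K2"] K2[of "max K1 K2"] by auto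
qed

lemma emb_in_loc:
  assumes "p \<in> P" "homogen (t + K * int (card F)) (emb p)" "0 \<le> K"
  shows "Xpow F (- K) * emb p \<in> loc P F t"
proof (rule locI[OF _ _ assms(1)])
  show "homogen t (Xpow F (- K) * emb p)" using homogen_Xpow_mult[OF assms(2), of "- K" F] by simp
  show "Xpow F (int (nat K)) * (Xpow F (- K) * emb p) = emb p" using assms(3) by simp
qed

lemma add_closed_loc:
  assumes "hideal V P" "F \<subseteq> V" "finite V"
  shows "add_closed (loc P F t)"
  unfolding add_closed_def
proof (intro conjI ballI)
  note ac = add_closedD[OF hidealD(2)[OF assms(1)]]
  show "0 \<in> loc P F t" by (rule locI[where K=0 and p=0]) (auto simp: ac)
  fix x assume x: "x \<in> loc P F t"
  then obtain K p where "p \<in> P" "Xpow F (int K) * x = emb p" by (auto simp: loc_def)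
  then show "- x \<in> loc P F t"
    using x by (intro locI[where p = "-p" and K=K]) (auto simp: loc_homogen homogen_uminus ac emb_uminus)
  fix y assume y: "y \<in> loc P F t"
  obtain K p q where "p \<in> P" "q \<in> P" "Xpow F (int K) * x = emb p" "Xpow F (int K) * y = emb q"
    by (rule loc_obtain2[OF assms(3,3,1,2) x assms(1,2) y])
  then show "x + y \<in> loc P F t"
    using x y by (intro locI[where p = "p + q" and K = K])
      (auto simp: loc_homogen homogen_add ac emb_add distrib_left)
qed

lemma loc_mono: "P \<subseteq> Q \<Longrightarrow> loc P F t \<subseteq> loc Q F t"
  by (auto simp: loc_def)

text \<open>The localisation map P_{x_F} \<rightarrow> P_{x_G} is an inclusion here: the numerator
  is multiplied by \<open>xprod (G - F) ^ K\<close>.\<close>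

lemma loc_mono_set:
  assumes "hideal V P" "F \<subseteq> G" "G \<subseteq> V" "finite V"
  shows "loc P F t \<subseteq> loc P G t"
proof
  fix f assume f: "f \<in> loc P F t"
  then obtain K p where p: "p \<in> P" "Xpow F (int K) * f = emb p" by (auto simp: loc_def)
  have "finite G" using assms finite_subset by blast
  have "Xpow G (int K) * f = Xpow (G - F) (int K) * (Xpow F (int K) * f)"
    by (subst Xpow_Diff[OF \<open>finite G\<close> assms(2)]) (simp add: mult.assoc)
  also have "\<dots> = emb (xprod (G - F) ^ K * p)"
    using p(2) \<open>finite G\<close> by (simp add: emb_mult emb_xprod_power)
  finally show "f \<in> loc P G t"
    using p(1) f assms by (intro locI[where p = "xprod (G - F) ^ K * p" and K = K])
     (auto intro!: hidealD(3)[OF assms(1)] poly_ring_power xprod_poly_ring loc_homogen)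
qed

section \<open>Signs, cochains and the Cech differential\<close>

definition pos_sign :: "nat \<Rightarrow> nat set \<Rightarrow> 'k::comm_ring_1" where
  "pos_sign j G = (- 1) ^ card {v\<in>G. v < j}"

lemma pos_sign_insert:
  assumes "finite G" "i \<notin> G"
  shows "pos_sign j (insert i G) = (if i < j then - pos_sign j G else pos_sign j G)"
proof -
  have "{v\<in>insert i G. v < j} = (if i < j then insert i {v\<in>G. v < j} else {v\<in>G. v < j})" by auto
  then show ?thesis using assms by (simp add: pos_sign_def)
qed

lemma pos_sign_remove:
  assumes "finite G" "i \<in> G"
  shows "(pos_sign j (G - {i}) :: 'k::comm_ring_1) = (if i < j then - pos_sign j G else pos_sign j G)"
proof -
  have "insert i (G - {i}) = G" using assms by auto
  then have "(pos_sign j G :: 'k) = (if i < j then - pos_sign j (G - {i}) else pos_sign j (G - {i}))"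
    using pos_sign_insert[of "G - {i}" i j] assms by (metis Diff_iff finite_Diff singletonI)
  then show ?thesis by auto
qed

lemma pos_sign_square [simp]: "pos_sign j G * pos_sign j G = 1" "pos_sign j G * (pos_sign j G * f) = f"
  by (simp_all add: pos_sign_def flip: mult.assoc power_add mult_2)

lemma add_closed_pos_sign: "add_closed S \<Longrightarrow> x \<in> S \<Longrightarrow> pos_sign j G * x \<in> S"
  unfolding pos_sign_def by (rule add_closed_neg_power)

text \<open>Exchanging the sums pairs (u, v) with (v, u). Both d d = 0 and the vanishing of the
  iterated Koszul map are instances.\<close>

lemma sum_antisym:
  fixes T :: "nat \<Rightarrow> nat \<Rightarrow> 'a::ab_group_add"
  assumes "finite A" "\<And>u v. u \<in> A \<Longrightarrow> v \<in> A \<Longrightarrow> u < v \<Longrightarrow> T v u = - T u v"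
  shows "(\<Sum>u\<in>A. \<Sum>v\<in>A - {u}. T u v) = 0"
proof -
  have split: "(\<Sum>v\<in>A - {u}. T u v) = (\<Sum>v | v \<in> A \<and> u < v. T u v) + (\<Sum>v | v \<in> A \<and> v < u. T u v)" for u
    by (subst sum.union_disjoint[symmetric]) (use assms(1) in \<open>auto intro!: sum.cong\<close>)
  have "(\<Sum>u\<in>A. \<Sum>v | v \<in> A \<and> v < u. T u v) = (\<Sum>v\<in>A. \<Sum>u | u \<in> A \<and> v < u. T u v)"
    by (rule sum.swap_restrict[OF assms(1) assms(1)])
  also have "\<dots> = (\<Sum>v\<in>A. \<Sum>u | u \<in> A \<and> v < u. - T v u)"
    by (intro sum.cong refl) (auto intro: assms(2))
  finally show ?thesis by (simp add: split sum.distrib sum_negf)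
qed

type_synonym 'k cochain = "nat set \<Rightarrow> 'k lpoly"

text \<open>One operator serves all cohomological degrees, since cochains of every degree live in
  the same function space and are zero off their own faces.\<close>

definition diff :: "nat set \<Rightarrow> 'k::comm_ring_1 cochain \<Rightarrow> 'k cochain" where
  "diff V c G = (if G \<subseteq> V then \<Sum>j\<in>G. pos_sign j G * c (G - {j}) else 0)"

lemma additive_diff: "additive_fun (diff V)"
  by (intro additive_funI) (auto simp: diff_def fun_eq_iff sum.distrib distrib_left)

lemma diff_diff: "finite V \<Longrightarrow> diff V (diff V c) = 0"
proof
  fix G assume fV: "finite V"
  show "diff V (diff V c) G = 0 G"
  proof (cases "G \<subseteq> V")
    case True
    with fV have fG: "finite G" using finite_subset by blast
    have "diff V (diff V c) G = (\<Sum>j\<in>G. \<Sum>i\<in>G - {j}. pos_sign j G * (pos_sign i (G - {j}) * c (G - {j} - {i})))"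
      using True by (auto simp: diff_def sum_distrib_left intro!: sum.cong)
    also have "\<dots> = 0"
    proof (rule sum_antisym[OF fG])
      fix u v assume "u \<in> G" "v \<in> G" "u < v"
      moreover have "G - {u} - {v} = G - {v} - {u}" by auto
      ultimately show "pos_sign v G * (pos_sign u (G - {v}) * c (G - {v} - {u})) = - (pos_sign u G * (pos_sign v (G - {u}) * c (G - {u} - {v})))"
        using fG by (simp add: pos_sign_remove mult.left_commute)
    qed
    finally show ?thesis by simp
  qed (simp add: diff_def)
qed

text \<open>The degree k is an integer so that k - 1 is meaningful at the bottom: for negative k
  only the zero cochain is left.\<close>

definition Cech :: "nat set \<Rightarrow> 'k::comm_ring_1 mpoly set \<Rightarrow> int \<Rightarrow> int \<Rightarrow> 'k cochain set" where
  "Cech V P t k = {c. \<forall>F. if F \<subseteq> V \<and> int (card F) = k then c F \<in> loc P F t else c F = 0}"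

lemma Cech_in: "c \<in> Cech V P t k \<Longrightarrow> F \<subseteq> V \<Longrightarrow> int (card F) = k \<Longrightarrow> c F \<in> loc P F t"
  and Cech_out: "c \<in> Cech V P t k \<Longrightarrow> \<not> (F \<subseteq> V \<and> int (card F) = k) \<Longrightarrow> c F = 0"
  unfolding Cech_def by (auto split: if_splits)

lemma ccI: "(\<And>F. F \<subseteq> V \<Longrightarrow> int (card F) = k \<Longrightarrow> c F \<in> loc P F t) \<Longrightarrow>
   (\<And>F. \<not> (F \<subseteq> V \<and> int (card F) = k) \<Longrightarrow> c F = 0) \<Longrightarrow> c \<in> Cech V P t k"
  by (auto simp: Cech_def)

lemma add_closed_Cech:
  assumes "hideal V P" "finite V"
  shows "add_closed (Cech V P t k)"
proof -
  have ac: "add_closed (loc P F t)" if "F \<subseteq> V" for F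
    by (rule add_closed_loc[OF assms(1) that assms(2)])
  show ?thesis
    unfolding add_closed_def Cech_def by (auto simp: add_closedD[OF ac])
qed

lemma Cech_mono:
  assumes "P \<subseteq> Q"
  shows "Cech V P t k \<subseteq> Cech V Q t k"
proof
  fix c assume c: "c \<in> Cech V P t k"
  show "c \<in> Cech V Q t k"
  proof (rule ccI)
    fix F assume "F \<subseteq> V" "int (card F) = k"
    then show "c F \<in> loc Q F t" by (rule loc_mono[OF assms, THEN subsetD, OF Cech_in[OF c]])
  qed (rule Cech_out[OF c])
qed

lemma Cech_neg: "k < 0 \<Longrightarrow> c \<in> Cech V P t k \<Longrightarrow> c = 0"
  by (rule ext) (auto simp: Cech_out)

lemma diff_Cech:
  assumes "hideal V P" "finite V" "c \<in> Cech V P t k"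
  shows "diff V c \<in> Cech V P t (k + 1)"
proof (rule ccI)
  fix G assume G: "G \<subseteq> V" "int (card G) = k + 1"
  then have fG: "finite G" using assms finite_subset by blast
  note ac = add_closed_loc[OF assms(1) G(1) assms(2)]
  have "pos_sign j G * c (G - {j}) \<in> loc P G t" if "j \<in> G" for j
  proof -
    have "int (card (G - {j})) = k" using card.remove[OF fG that] G(2) by linarith
    then have "c (G - {j}) \<in> loc P (G - {j}) t" using G by (intro Cech_in[OF assms(3)]) auto
    then have "c (G - {j}) \<in> loc P G t" using loc_mono_set[OF assms(1) _ G(1) assms(2), of "G - {j}"] by auto
    then show ?thesis by (rule add_closed_pos_sign[OF ac])
  qed
  then show "diff V c G \<in> loc P G t" using G unfolding diff_def by (auto intro: add_closed_sum[OF ac])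
next
  fix G assume G: "\<not> (G \<subseteq> V \<and> int (card G) = k + 1)"
  show "diff V c G = 0"
  proof (cases "G \<subseteq> V")
    case True
    then have fG: "finite G" using assms finite_subset by blast
    have "c (G - {j}) = 0" if "j \<in> G" for j
    proof (rule Cech_out[OF assms(3)])
      have "card G = Suc (card (G - {j}))" by (rule card.remove[OF fG that])
      then show "\<not> (G - {j} \<subseteq> V \<and> int (card (G - {j})) = k)" using G True by linarith
    qed
    then show ?thesis by (simp add: diff_def)
  qed (simp add: diff_def)
qed

text \<open>Vanishing of the i-th cohomology of the quotient complex P/Q, in terms of
  representatives: a cycle modulo Q is a boundary modulo Q.\<close>

definition exact_at :: "('g::ab_group_add \<Rightarrow> 'g) \<Rightarrow> (int \<Rightarrow> 'g set) \<Rightarrow> (int \<Rightarrow> 'g set) \<Rightarrow> int \<Rightarrow> bool" where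
  "exact_at d P Q i \<longleftrightarrow> (\<forall>c\<in>P i. d c \<in> Q (i + 1) \<longrightarrow> (\<exists>b\<in>P (i - 1). c - d b \<in> Q i))"

text \<open>The middle term of 0 \<rightarrow> P/Q \<rightarrow> T/Q \<rightarrow> T/P \<rightarrow>
  0: exactness of T/P moves a cycle into P by a boundary, and exactness of P/Q then moves it into
  Q.\<close>

lemma exact_at_extension:
  assumes d: "additive_fun d" "\<And>c. d (d c) = 0"
    and ac: "\<And>i. add_closed (P i)" "\<And>i. add_closed (T i)"
    and sub: "\<And>i. Q i \<subseteq> P i" "\<And>i. P i \<subseteq> T i"
    and ex: "exact_at d P Q i" "exact_at d T P i"
  shows "exact_at d T Q i"
  unfolding exact_at_def
proof (intro ballI impI)
  fix c assume c: "c \<in> T i" "d c \<in> Q (i + 1)"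
  then obtain b where b: "b \<in> T (i - 1)" "c - d b \<in> P i"
    using ex(2) sub unfolding exact_at_def by blast
  have "d (c - d b) \<in> Q (i + 1)"
    using c by (simp add: additive_fun_minus[OF d(1)] d(2))
  then obtain b' where b': "b' \<in> P (i - 1)" "c - d b - d b' \<in> Q i"
    using ex(1) b unfolding exact_at_def by blast
  have "b + b' \<in> T (i - 1)" using b b' sub add_closedD(2)[OF ac(2)] by blast
  moreover have "c - d (b + b') \<in> Q i" using b' by (simp add: additive_fun_add[OF d(1)] algebra_simps)
  ultimately show "\<exists>b\<in>T (i - 1). c - d b \<in> Q i" by blast
qed

text \<open>The stretch H^(i-1)(T/P) \<rightarrow> H^i(P/Q) \<rightarrow> H^i(T/Q) of the long exact
  sequence. The drop to i - 1, due to the connecting map, is the origin of the summand 1 in the two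
  bounds.\<close>

lemma exact_at_sub:
  assumes d: "additive_fun d" "\<And>c. d (d c) = 0"
    and ac: "\<And>i. add_closed (P i)" "\<And>i. add_closed (T i)"
    and sub: "\<And>i. Q i \<subseteq> P i" "\<And>i. P i \<subseteq> T i"
    and ex: "exact_at d T Q i" "exact_at d T P (i - 1)"
  shows "exact_at d P Q i"
  unfolding exact_at_def
proof (intro ballI impI)
  fix c assume c: "c \<in> P i" "d c \<in> Q (i + 1)"
  then obtain b where b: "b \<in> T (i - 1)" "c - d b \<in> Q i"
    using ex(1) sub unfolding exact_at_def by blast
  have "c - (c - d b) \<in> P i" using b c sub add_closedD(4)[OF ac(1)] by blast
  then have "d b \<in> P (i - 1 + 1)" by simp
  then obtain b' where b': "b' \<in> T (i - 1 - 1)" "b - d b' \<in> P (i - 1)"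
    using ex(2) b unfolding exact_at_def by blast
  have "c - d (b - d b') \<in> Q i" using b by (simp add: additive_fun_minus[OF d(1)] d(2))
  then show "\<exists>b\<in>P (i - 1). c - d b \<in> Q i" using b' by blast
qed

text \<open>This says H^k(P/Q)_t = 0, for ideals Q \<subseteq> P.\<close>
definition exact :: "nat set \<Rightarrow> 'k::comm_ring_1 mpoly set \<Rightarrow> 'k mpoly set \<Rightarrow> int \<Rightarrow> int \<Rightarrow> bool" where
  "exact V P Q k t \<longleftrightarrow> exact_at (diff V) (Cech V P t) (Cech V Q t) k"

lemma exact_extension:
  assumes "finite V" "hideal V P" "hideal V T" "Q \<subseteq> P" "P \<subseteq> T" "exact V P Q k t" "exact V T P k t"
  shows "exact V T Q k t"
  unfolding exact_def
  by (rule exact_at_extension[OF additive_diff diff_diff[OF assms(1)] add_closed_Cech[OF assms(2,1)]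
        add_closed_Cech[OF assms(3,1)] Cech_mono[OF assms(4)] Cech_mono[OF assms(5)]
        assms(6,7)[unfolded exact_def]])

lemma exact_sub:
  assumes "finite V" "hideal V P" "hideal V T" "Q \<subseteq> P" "P \<subseteq> T" "exact V T Q k t" "exact V T P (k - 1) t"
  shows "exact V P Q k t"
  unfolding exact_def
  by (rule exact_at_sub[OF additive_diff diff_diff[OF assms(1)] add_closed_Cech[OF assms(2,1)]
        add_closed_Cech[OF assms(3,1)] Cech_mono[OF assms(4)] Cech_mono[OF assms(5)]
        assms(6,7)[unfolded exact_def]])

lemma exact_refl:
  assumes "finite V" "hideal V P"
  shows "exact V P P k t"
proof -
  have "0 \<in> Cech V P t (k - 1)" using add_closedD(1)[OF add_closed_Cech[OF assms(2,1)]] .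
  then show ?thesis unfolding exact_def exact_at_def using additive_fun_0[OF additive_diff]
    by (metis diff_zero)
qed

section \<open>Contracting homotopies and extension of linear maps\<close>

text \<open>A basis C of Q is extended by vectors of d P. Sending C to 0 and every new basis vector
  to a chosen preimage in P gives a linear map that inverts d modulo Q on d P, and its values stay
  in P on the whole space.\<close>

lemma (in vector_space) relative_section:
  assumes d: "Vector_Spaces.linear scale scale d" and P: "subspace P" and Q: "subspace Q"
  shows "\<exists>g. Vector_Spaces.linear scale scale g \<and> (\<forall>y. g y \<in> P) \<and> (\<forall>q\<in>Q. g q = 0) \<and> (\<forall>x\<in>P. d (g (d x)) - d x \<in> Q)"
proof -
  interpret vector_space_pair scale scale by unfold_locales
  obtain C where C: "C \<subseteq> Q" "independent C" "Q \<subseteq> span C"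
    using maximal_independent_subset by blast
  obtain E where E: "C \<subseteq> E" "E \<subseteq> C \<union> d ` P" "independent E" "C \<union> d ` P \<subseteq> span E"
    using maximal_independent_subset_extend[of C "C \<union> d ` P"] C by auto
  define f where "f e = (if e \<in> C then 0 else SOME x. x \<in> P \<and> d x = e)" for e
  have f: "f e \<in> P \<and> d (f e) = e" if "e \<in> E" "e \<notin> C" for e
  proof -
    have "\<exists>x. x \<in> P \<and> d x = e" using that E(2) by auto
    from someI_ex[OF this] show ?thesis using that by (simp add: f_def)
  qed
  define g where "g = construct E f"
  have g: "Vector_Spaces.linear scale scale g" unfolding g_def by (rule linear_construct[OF E(3)])
  have gE: "g e = f e" if "e \<in> E" for e unfolding g_def by (rule construct_basis[OF E(3) that])
  have fP: "f ` E \<subseteq> P" using f subspace_0[OF P] by (auto simp: f_def)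
  have "range g = span (f ` E)" unfolding g_def by (rule range_construct_eq_span[OF E(3)])
  then have gP: "g y \<in> P" for y using span_minimal[OF fP P] by auto
  interpret dl: Vector_Spaces.linear scale scale d by (rule d)
  interpret gl: Vector_Spaces.linear scale scale g by (rule g)
  have gQ: "g q = 0" if "q \<in> Q" for q
  proof -
    have "q \<in> span C" using that C by auto
    then show ?thesis
      by (induction rule: span_induct_alt) (use E(1) gE in \<open>auto simp: gl.zero gl.add gl.scale f_def subset_iff\<close>)
  qed
  have "d (g y) - y \<in> Q" if "y \<in> span E" for y
    using that
  proof (induction rule: span_induct_alt)
    case (step c x y)
    have "d (g x) - x \<in> Q"
      using gE[OF step(1)] f[OF step(1)] subspace_0[OF Q] subspace_neg[OF Q] C(1)
      by (cases "x \<in> C") (auto simp: f_def dl.zero)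
    then have "scale c (d (g x) - x) + (d (g y) - y) \<in> Q"
      using step by (intro subspace_add[OF Q] subspace_scale[OF Q])
    then show ?case by (simp add: gl.add gl.scale dl.add dl.scale algebra_simps)
  qed (simp add: gl.zero dl.zero subspace_0[OF Q])
  then show ?thesis using g gP gQ E(4) by blast
qed

definition smul :: "'k::comm_ring_1 \<Rightarrow> ('a::comm_monoid_add \<Rightarrow>\<^sub>0 'k) \<Rightarrow> ('a \<Rightarrow>\<^sub>0 'k)" where
  "smul c f = single 0 c * f"

lemma smul_add: "smul c (f + g) = smul c f + smul c g" "smul (c + c') f = smul c f + smul c' f"
  and smul_smul: "smul c (smul c' f) = smul (c * c') f"
  and smul_1: "smul 1 f = f"
  by (simp_all add: smul_def distrib_left distrib_right single_add mult_single flip: mult.assoc)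

lemma smul_single: "smul c (single m u) = single m (c * u)"
  by (simp add: smul_def mult_single)

lemma mult_smul: "f * smul c g = smul c (f * g)" "smul c f * g = smul c (f * g)"
  by (simp_all add: smul_def mult.left_commute mult.assoc)

definition smulc :: "'k::comm_ring_1 \<Rightarrow> 'k cochain \<Rightarrow> 'k cochain" where
  "smulc c z = (\<lambda>F. smul c (z F))"

lemma vector_space_smul: "vector_space (smul :: 'k::field \<Rightarrow> ('a::comm_monoid_add \<Rightarrow>\<^sub>0 'k) \<Rightarrow> _)"
  by unfold_locales (simp_all add: smul_add smul_smul smul_1)

lemma vector_space_smulc: "vector_space (smulc :: 'k::field \<Rightarrow> _)"
  by unfold_locales (auto simp: smulc_def fun_eq_iff smul_add smul_smul smul_1)

lemma hideal_smul: "hideal V P \<Longrightarrow> p \<in> P \<Longrightarrow> smul c p \<in> P"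
  unfolding smul_def by (rule hidealD(3)) (auto simp: poly_ring_def)

lemma emb_smul: "emb (smul c p) = smul c (emb p)"
  by (simp add: smul_def emb_mult)

lemma homogen_smul: "homogen t f \<Longrightarrow> homogen t (smul c f)"
  using homogen_mult[of 0 "single 0 c" t f] by (simp add: smul_def homogen_single)

lemma loc_smul:
  assumes "hideal V P" "f \<in> loc P F t"
  shows "smul c f \<in> loc P F t"
proof -
  obtain K p where p: "p \<in> P" "Xpow F (int K) * f = emb p" using assms(2) by (auto simp: loc_def)
  then show ?thesis using assms
    by (intro locI[where p = "smul c p" and K = K]) (auto simp: mult_smul emb_smul loc_homogen homogen_smul hideal_smul)
qed

lemma Cech_smulc:
  assumes "hideal V P" "z \<in> Cech V P t k"
  shows "smulc c z \<in> Cech V P t k"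
proof (rule ccI)
  fix F assume "F \<subseteq> V" "int (card F) = k"
  then show "smulc c z F \<in> loc P F t"
    unfolding smulc_def by (rule loc_smul[OF assms(1) Cech_in[OF assms(2)]])
next
  fix F assume "\<not> (F \<subseteq> V \<and> int (card F) = k)"
  then have "z F = 0" by (rule Cech_out[OF assms(2)])
  then show "smulc c z F = 0" by (simp add: smulc_def smul_def)
qed

lemma diff_smulc: "diff V (smulc c z) = smulc c (diff V z)"
  by (rule ext) (simp add: diff_def smulc_def mult_smul, simp add: smul_def sum_distrib_left)

lemma linear_smulc_diff: "Vector_Spaces.linear smulc smulc (diff V :: 'k::field cochain \<Rightarrow> _)"
proof -
  interpret vector_space "smulc :: 'k \<Rightarrow> _" by (rule vector_space_smulc)
  show ?thesis
    by unfold_locales (rule additive_fun_add[OF additive_diff] diff_smulc)+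
qed

lemma subspace_Cech:
  assumes "hideal V P" "finite V"
  shows "module.subspace (smulc :: 'k::field \<Rightarrow> _) (Cech V P t k)"
proof -
  interpret vector_space "smulc :: 'k \<Rightarrow> _" by (rule vector_space_smulc)
  show ?thesis unfolding subspace_def
    by (intro conjI ballI allI add_closedD[OF add_closed_Cech[OF assms]] Cech_smulc[OF assms(1)])
qed

text \<open>The homotopy exists in all bidegrees, takes values in P and kills Q; only the
  contraction identity is tied to exactness in the bidegree (i, a). \<open>exact_tens\<close> needs
  this uniformity, because there the exact factor varies with the bidegree.\<close>

lemma exact_homotopy:
  fixes P Q :: "'k::field mpoly set"
  assumes V: "finite V" and P: "hideal V P" and Q: "hideal V Q"
  obtains h :: "int \<Rightarrow> int \<Rightarrow> 'k cochain \<Rightarrow> 'k cochain" where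
    "\<And>i a. additive_fun (h i a)"
    "\<And>i a u c. h i a (smulc u c) = smulc u (h i a c)"
    "\<And>i a c. h i a c \<in> Cech V P a (i - 1)"
    "\<And>i a c. c \<in> Cech V Q a i \<Longrightarrow> h i a c = 0"
    "\<And>i a c. exact V P Q i a \<Longrightarrow> c \<in> Cech V P a i \<Longrightarrow> c - diff V (h i a c) - h (i + 1) a (diff V c) \<in> Cech V Q a i"
proof -
  interpret vector_space "smulc :: 'k \<Rightarrow> _" by (rule vector_space_smulc)
  define ok where "ok i a g \<longleftrightarrow> Vector_Spaces.linear smulc smulc g \<and> (\<forall>y. g y \<in> Cech V P a (i - 1)) \<and>
      (\<forall>q\<in>Cech V Q a i. g q = 0) \<and> (\<forall>x\<in>Cech V P a (i - 1). diff V (g (diff V x)) - diff V x \<in> Cech V Q a i)" for i a g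
  have "\<exists>g. ok i a g" for i a
    unfolding ok_def by (rule relative_section[OF linear_smulc_diff subspace_Cech[OF P V] subspace_Cech[OF Q V]])
  then obtain g where "\<And>i a. ok i a (g i a)" by metis
  then have g: "\<And>i a. Vector_Spaces.linear smulc smulc (g i a)" "\<And>i a y. g i a y \<in> Cech V P a (i - 1)"
    "\<And>i a q. q \<in> Cech V Q a i \<Longrightarrow> g i a q = 0"
    "\<And>i a x. x \<in> Cech V P a (i - 1) \<Longrightarrow> diff V (g i a (diff V x)) - diff V x \<in> Cech V Q a i"
    unfolding ok_def by simp_all
  have add: "g i a (x + y) = g i a x + g i a y" and scale: "g i a (smulc u x) = smulc u (g i a x)" for i a x y u
    using g(1)[of i a] by (auto simp: Vector_Spaces.linear_iff)
  have zero: "g i a 0 = 0" for i a using scale[of i a 0 0] by (simp add: smulc_def smul_def flip: zero_fun_def)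
  have gadd: "additive_fun (g i a)" for i a by (rule additive_funI) (simp_all add: add zero)
  note gdiff = additive_fun_minus(2)[OF gadd]
  note ddadd = additive_fun_add[OF additive_diff] and dddiff = additive_fun_minus(2)[OF additive_diff]
    and dd0 = additive_fun_0[OF additive_diff]
  \<comment> \<open>This is g applied to c - g (d c). Where P/Q is exact, c - g (d c) is a cycle and
    hence a boundary modulo Q, which d g reproduces. Since d d = 0, also h (d c) = g (d c), and the
    two parts add up to c modulo Q.\<close>
  define h where "h i a c = g i a c - g i a (g (i + 1) a (diff V c))" for i a c
  show ?thesis
  proof (rule that[of h])
    fix i a
    show "additive_fun (h i a)"
      by (rule additive_funI) (simp_all add: h_def add zero ddadd dd0)
    fix u c
    show "h i a (smulc u c) = smulc u (h i a c)"
      by (simp add: h_def diff_smulc scale scale_right_diff_distrib)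
    show "h i a c \<in> Cech V P a (i - 1)"
      unfolding h_def using g(2) add_closedD(4)[OF add_closed_Cech[OF P V]] by blast
    show "h i a c = 0" if "c \<in> Cech V Q a i"
      unfolding h_def using g(3)[OF that] g(3)[OF diff_Cech[OF Q V that]] by (simp add: zero)
    assume ex: "exact V P Q i a" and c: "c \<in> Cech V P a i"
    define y where "y = g (i + 1) a (diff V c)"
    have y: "y \<in> Cech V P a i" unfolding y_def using g(2)[of "i + 1"] by simp
    note acQ = add_closedD[OF add_closed_Cech[OF Q V]]
    have "diff V y - diff V c \<in> Cech V Q a (i + 1)"
      unfolding y_def using g(4)[of c a "i + 1"] c by simp
    then have "diff V (c - y) \<in> Cech V Q a (i + 1)"
      using acQ(3) by (fastforce simp: dddiff)
    moreover have "c - y \<in> Cech V P a i" by (rule add_closedD(4)[OF add_closed_Cech[OF P V] c y])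
    ultimately obtain b where b: "b \<in> Cech V P a (i - 1)" "c - y - diff V b \<in> Cech V Q a i"
      using ex unfolding exact_def exact_at_def by blast
    have "g i a (c - y - diff V b) = 0" by (rule g(3)[OF b(2)])
    then have "h i a c = g i a (diff V b)"
      by (simp add: h_def y_def[symmetric] gdiff)
    then have "diff V (h i a c) - diff V b \<in> Cech V Q a i" using g(4)[OF b(1)] by simp
    with b(2) have "(c - y - diff V b) - (diff V (h i a c) - diff V b) \<in> Cech V Q a i" by (rule acQ(4))
    moreover have "h (i + 1) a (diff V c) = y"
      by (simp add: h_def y_def diff_diff[OF V] zero)
    ultimately show "c - diff V (h i a c) - h (i + 1) a (diff V c) \<in> Cech V Q a i"
      by (simp add: algebra_simps)
  qed
qed

section \<open>Linear maps tensored with the identity\<close>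

definition vars_in :: "nat set \<Rightarrow> ((nat \<Rightarrow>\<^sub>0 'e::comm_monoid_add) \<Rightarrow>\<^sub>0 'k::comm_ring_1) \<Rightarrow> bool" where
  "vars_in U f \<longleftrightarrow> (\<forall>m\<in>keys f. keys m \<subseteq> U)"

lemma vars_in_mult:
  assumes "vars_in U f" "vars_in U g" shows "vars_in U (f * g)"
  unfolding vars_in_def
proof safe
  fix m v assume "m \<in> keys (f * g)" and v: "v \<in> keys m"
  then obtain a b where "a \<in> keys f" "b \<in> keys g" "m = a + b"
    using keys_mult by blast
  then show "v \<in> U" using v assms keys_add[of a b] unfolding vars_in_def by blast
qed

lemma vars_in_emb: "p \<in> poly_ring U \<Longrightarrow> vars_in U (emb p)"
  by (auto simp: vars_in_def poly_ring_def keys_emb keys_toint)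

lemma vars_in_Xpow: "F \<subseteq> U \<Longrightarrow> vars_in U (Xpow F K)"
  unfolding vars_in_def Xpow_def using keys_sum[of "\<lambda>v. single v K" F] by (auto split: if_splits)

lemma loc_vars:
  assumes "hideal V P" "F \<subseteq> V" "f \<in> loc P F t"
  shows "vars_in V f"
proof -
  obtain K p where p: "p \<in> P" "Xpow F (int K) * f = emb p" using assms(3) by (auto simp: loc_def)
  then have "f = Xpow F (- int K) * emb p" by (metis Xpow_cancel(1))
  then show ?thesis
    using p(1) hidealD(1)[OF assms(1)] assms(2) by (auto intro!: vars_in_mult vars_in_emb vars_in_Xpow)
qed

lemma vars_in_mono: "vars_in U f \<Longrightarrow> U \<subseteq> W \<Longrightarrow> vars_in W f"
  by (auto simp: vars_in_def)

text \<open>The map \<phi> tensored with the identity, for the factorisation of each monomial into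
  a monomial in the variables U and one in the remaining variables; \<phi> may depend on the degree.\<close>
definition lmap :: "nat set \<Rightarrow> ('e \<Rightarrow> ((nat \<Rightarrow>\<^sub>0 'e::comm_monoid_add) \<Rightarrow>\<^sub>0 'k::comm_ring_1) \<Rightarrow> ((nat \<Rightarrow>\<^sub>0 'e) \<Rightarrow>\<^sub>0 'k))
    \<Rightarrow> ((nat \<Rightarrow>\<^sub>0 'e) \<Rightarrow>\<^sub>0 'k) \<Rightarrow> ((nat \<Rightarrow>\<^sub>0 'e) \<Rightarrow>\<^sub>0 'k)" where
  "lmap U \<phi> = lext (\<lambda>m u. \<phi> (deg (res U m)) (single (res U m) u) * single (res (- U) m) 1)"

lemma additive_lmap:
  assumes "\<And>a. additive_fun (\<phi> a)"
  shows "additive_fun (lmap U \<phi>)"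
  unfolding lmap_def
  by (rule additive_lext) (auto intro!: additive_funI simp: additive_fun_0[OF assms] additive_fun_add[OF assms] single_add distrib_right)

text \<open>Compatibility with scalars moves the coefficient of a term of y through \<phi>, so the
  claim can be checked on single terms. As \<phi> depends on the degree, \<psi> has to be its common
  value on the terms of x; for homogeneous x there is one.\<close>

lemma lmap_mult:
  assumes add: "\<And>a. additive_fun (\<phi> a)" and scale: "\<And>a u x. \<phi> a (smul u x) = smul u (\<phi> a x)"
    and x: "vars_in U x" "\<And>m. m \<in> keys x \<Longrightarrow> \<phi> (deg m) = \<psi>" and y: "vars_in (- U) y"
    and \<psi>: "additive_fun \<psi>"
  shows "lmap U \<phi> (x * y) = \<psi> x * y"
proof -
  note lm = additive_lmap[of \<phi> U, OF add]
  have *: "lmap U \<phi> (single m u * single m' w)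
      = \<psi> (single m u) * single m' w"
    if m: "m \<in> keys x" and m': "m' \<in> keys y" for m m' u w
  proof -
    have k: "keys m \<subseteq> U" "keys m' \<subseteq> - U"
      using m m' x y by (auto simp: vars_in_def)
    then have r: "res U (m + m') = m" "res (- U) (m + m') = m'"
      using res_none[of m "- U"] res_none[of m' U] k
      by (simp_all add: res_add res_id disjoint_eq_subset_Compl)
    have "lmap U \<phi> (single (m + m') (u * w)) = \<phi> (deg m) (single m (u * w)) * single m' 1"
      unfolding lmap_def
      by (subst lext_single) (simp_all add: r additive_fun_0[OF add])
    also have "\<phi> (deg m) (single m (u * w)) = smul w (\<psi> (single m u))"
      using scale[of "deg m" w "single m u"] x(2)[OF m] by (simp add: smul_single mult.commute)
    also have "\<dots> * single m' 1 = \<psi> (single m u) * smul w (single m' 1)"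
      by (simp add: mult_smul)
    finally show ?thesis by (simp add: smul_single mult_single)
  qed
  have **: "lmap U \<phi> (single m u * y) = \<psi> (single m u) * y"
    if m: "m \<in> keys x" for m u
    by (induction y rule: poly_mapping_single_induct)
      (simp_all add: * m distrib_left additive_fun_add[OF lm] additive_fun_0[OF lm])
  show ?thesis
    by (rule poly_mapping_single_induct[of "\<lambda>x'. lmap U \<phi> (x' * y) = \<psi> x' * y" x])
      (simp_all add: ** distrib_right additive_fun_add[OF lm] additive_fun_0[OF lm] additive_fun_add[OF \<psi>] additive_fun_0[OF \<psi>])
qed

section \<open>Tensor products of cochains\<close>

text \<open>For disjoint sets of variables this realises the tensor product over the field inside
  the common polynomial ring. With equal sets of variables it is the ordinary product of ideals, as
  in \<open>ideal_pow_Suc\<close>.\<close>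

definition tens :: "'a::comm_ring_1 set \<Rightarrow> 'a set \<Rightarrow> 'a set" where
  "tens P T = aspan {p * q | p q. p \<in> P \<and> q \<in> T}"

definition psum :: "'a::comm_ring_1 set \<Rightarrow> 'a set \<Rightarrow> 'a set" where
  "psum P Q = {p + q | p q. p \<in> P \<and> q \<in> Q}"

lemma tensI: "p \<in> P \<Longrightarrow> q \<in> T \<Longrightarrow> p * q \<in> tens P T"
  unfolding tens_def by (auto intro: aspan_base)

lemma add_closed_tens:
  assumes "add_closed P" shows "add_closed (tens P T)"
  unfolding tens_def
proof (rule add_closed_aspan)
  fix g assume "g \<in> {p * q | p q. p \<in> P \<and> q \<in> T}"
  then obtain p q where "p \<in> P" "q \<in> T" "g = p * q" by auto
  then have "- p \<in> P" "q \<in> T" "- g = - p * q" using add_closedD(3)[OF assms] by auto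
  then show "- g \<in> {p * q | p q. p \<in> P \<and> q \<in> T}" by blast
qed

lemma tens_least: "add_closed S \<Longrightarrow> (\<And>p q. p \<in> P \<Longrightarrow> q \<in> T \<Longrightarrow> p * q \<in> S) \<Longrightarrow> tens P T \<subseteq> S"
  unfolding tens_def by (rule aspan_least) auto

lemma tens_image:
  assumes "additive_fun f" "add_closed S" "\<And>p q. p \<in> P \<Longrightarrow> q \<in> T \<Longrightarrow> f (p * q) \<in> S" "x \<in> tens P T"
  shows "f x \<in> S"
proof -
  have "f x \<in> aspan S"
    by (rule aspan_image[OF assms(1) _ assms(4)[unfolded tens_def]]) (use assms(3) in \<open>auto intro: aspan_base\<close>)
  then show ?thesis using aspan_least[OF assms(2) subset_refl] by blast
qed

text \<open>Natural degrees make d - a truncate, so the degrees below a are a separate case in which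
  the component is zero.\<close>

lemma hcomp_mult_nat:
  fixes p q :: "'k::comm_ring_1 mpoly"
  assumes "homogen a p"
  shows "hcomp d (p * q) = (if a \<le> d then p * hcomp (d - a) q else 0)"
proof (cases "a \<le> d")
  case True
  then show ?thesis using hcomp_mult_homogen[OF assms, of "d - a" q] by simp
next
  case False
  have "deg m \<noteq> d" if "m \<in> keys (p * q)" for m
  proof -
    obtain b c where "b \<in> keys p" "m = b + c" using \<open>m \<in> _\<close> keys_mult by blast
    then show ?thesis using False assms by (auto simp: homogen_def deg_add)
  qed
  then show ?thesis using False unfolding hcomp_def by (auto intro: restr_none)
qed

lemma sum_hcomp_keys: "(\<Sum>d\<in>deg ` keys f. hcomp d f) = f"
  by (rule sum_hcomp) auto

text \<open>A and B may overlap: the case A = B is applied to products of ideals in one ring. Every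
  monomial over A \<union> B is its part in A times the rest, and the rest lies in B.\<close>

lemma hideal_tens:
  fixes P T :: "'k::comm_ring_1 mpoly set"
  assumes P: "hideal A P" and T: "hideal B T" and R: "R = A \<union> B"
  shows "hideal R (tens P T)"
proof (rule hidealI)
  have sub: "poly_ring A \<subseteq> poly_ring R" "poly_ring B \<subseteq> poly_ring R" using R by (auto intro!: poly_ring_mono)
  show "tens P T \<subseteq> poly_ring R"
    by (rule tens_least[OF add_closed_poly_ring poly_ring_mult]) (use hidealD(1)[OF P] hidealD(1)[OF T] sub in auto)
  show ac: "add_closed (tens P T)" by (rule add_closed_tens[OF hidealD(2)[OF P]])
  fix w assume w: "w \<in> tens P T"
  show "hcomp d w \<in> tens P T" for d
  proof (rule tens_image[OF additive_hcomp ac _ w])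
    fix p q assume pq: "p \<in> P" "q \<in> T"
    have "hcomp d (hcomp a p * q) \<in> tens P T" for a
      using hidealD(4)[OF P] hidealD(4)[OF T] pq
      by (auto simp: hcomp_mult_nat[of a "hcomp a p"] add_closedD(1)[OF ac] intro!: tensI)
    then have "(\<Sum>a\<in>deg ` keys p. hcomp d (hcomp a p * q)) \<in> tens P T" by (rule add_closed_sum[OF ac])
    then have "hcomp d ((\<Sum>a\<in>deg ` keys p. hcomp a p) * q) \<in> tens P T"
      by (simp add: sum_distrib_right additive_fun_sum[OF additive_hcomp])
    then show "hcomp d (p * q) \<in> tens P T" by (simp add: sum_hcomp_keys)
  qed
  fix u :: "'k mpoly" assume u: "u \<in> poly_ring R"
  show "u * w \<in> tens P T"
  proof (rule tens_image[OF _ ac _ w])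
    show "additive_fun ((*) u)" by (rule additive_funI) (simp_all add: distrib_left)
    fix p q assume pq: "p \<in> P" "q \<in> T"
    show "u * (p * q) \<in> tens P T"
    proof (rule poly_mapping_single_induct[of "\<lambda>u. u * (p * q) \<in> tens P T" u])
      fix m and c :: 'k assume m: "m \<in> keys u"
      have "keys m \<subseteq> R" using u m by (auto simp: poly_ring_def)
      then have 1: "single (res A m) c \<in> poly_ring A" "single (res (- A) m) 1 \<in> poly_ring B"
        using R by (auto simp: poly_ring_def keys_res)
      have "single m c = single (res A m) c * single (res (- A) m) 1"
        by (simp add: mult_single res_compl)
      then have "single m c * (p * q)
        = (single (res A m) c * p) * (single (res (- A) m) 1 * q)"
        by (simp add: mult_ac)
      also have "\<dots> \<in> tens P T" by (intro tensI hidealD(3)[OF P] hidealD(3)[OF T] pq 1)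
      finally show "single m c * (p * q) \<in> tens P T" .
    qed (simp_all add: add_closedD[OF ac] distrib_right)
  qed
qed

lemma psum_mem: "x \<in> psum P Q \<longleftrightarrow> (\<exists>p\<in>P. \<exists>q\<in>Q. x = p + q)"
  by (auto simp: psum_def)

lemma hideal_psum:
  assumes P: "hideal V P" and Q: "hideal V Q"
  shows "hideal V (psum P Q)"
proof (rule hidealI)
  note acP = add_closedD[OF hidealD(2)[OF P]] and acQ = add_closedD[OF hidealD(2)[OF Q]]
  show "psum P Q \<subseteq> poly_ring V"
    using hidealD(1)[OF P] hidealD(1)[OF Q] add_closedD(2)[OF add_closed_poly_ring] by (fastforce simp: psum_mem)
  show "add_closed (psum P Q)"
    unfolding add_closed_def
  proof (intro conjI ballI)
    show "0 \<in> psum P Q" using acP(1) acQ(1) by (force simp: psum_mem)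
    fix x assume "x \<in> psum P Q"
    then obtain p q where x: "p \<in> P" "q \<in> Q" "x = p + q" by (auto simp: psum_mem)
    then have "- x = (- p) + (- q)" by simp
    then show "- x \<in> psum P Q" using acP(3) acQ(3) x unfolding psum_mem by blast
    fix y assume "y \<in> psum P Q"
    then obtain p' q' where y: "p' \<in> P" "q' \<in> Q" "y = p' + q'" by (auto simp: psum_mem)
    then have "x + y = (p + p') + (q + q')" using x by simp
    then show "x + y \<in> psum P Q" using acP(2) acQ(2) x y unfolding psum_mem by blast
  qed
  fix w assume "w \<in> psum P Q"
  then obtain p q where w: "p \<in> P" "q \<in> Q" "w = p + q" by (auto simp: psum_mem)
  show "u * w \<in> psum P Q" if "u \<in> poly_ring V" for u
    using hidealD(3)[OF P that w(1)] hidealD(3)[OF Q that w(2)] w(3) unfolding psum_mem by (metis distrib_left)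
  show "hcomp d w \<in> psum P Q" for d
    using hidealD(4)[OF P w(1)] hidealD(4)[OF Q w(2)] w(3) unfolding psum_mem by (metis hcomp_add)
qed

lemma hcomp_Xpow_mult: "hcomp t (Xpow F (- K) * f) = Xpow F (- K) * hcomp (t + K * int (card F)) f"
  using hcomp_mult_homogen[OF homogen_Xpow, of "- K" F "t + K * int (card F)" f] by (simp add: algebra_simps)

text \<open>The component of a fraction is the fraction of a component of the numerator. The degree
  of the latter may be negative, and then the component is zero.\<close>

lemma hcomp_loc:
  assumes "hideal V P" "p \<in> P"
  shows "hcomp t (Xpow F (- int K) * emb p) \<in> loc P F t"
proof -
  let ?d = "t + int K * int (card F)"
  have "\<exists>p'\<in>P. hcomp ?d (emb p) = emb p'"
  proof (cases "?d \<ge> 0")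
    case True
    then obtain d where "?d = int d" using nonneg_int_cases by blast
    then show ?thesis using hidealD(4)[OF assms] by (auto simp: hcomp_emb)
  next
    case False
    have "hcomp ?d (emb p) = 0"
      unfolding hcomp_def using False by (intro restr_none) (auto simp: keys_emb deg_toint)
    then show ?thesis using add_closedD(1)[OF hidealD(2)[OF assms(1)]] by (metis emb_0)
  qed
  then obtain p' where p': "p' \<in> P" "hcomp ?d (emb p) = emb p'" by blast
  show ?thesis
  proof (rule locI[OF homogen_hcomp _ p'(1)])
    show "Xpow F (int K) * hcomp t (Xpow F (- int K) * emb p) = emb p'" by (simp add: hcomp_Xpow_mult p'(2))
  qed
qed

text \<open>Splitting the numerator gives parts that need not be homogeneous; taking components of
  degree t repairs this.\<close>

lemma loc_psum:
  assumes "hideal V P" "hideal V Q" "f \<in> loc (psum P Q) F t"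
  shows "\<exists>g\<in>loc P F t. \<exists>h\<in>loc Q F t. f = g + h"
proof -
  obtain K w where "w \<in> psum P Q" "Xpow F (int K) * f = emb w" using assms(3) by (auto simp: loc_def)
  then obtain p q where pq: "p \<in> P" "q \<in> Q" "Xpow F (int K) * f = emb (p + q)" by (auto simp: psum_mem)
  then have "f = Xpow F (- int K) * emb (p + q)" by (metis Xpow_cancel(1))
  then have "f = hcomp t (Xpow F (- int K) * emb p + Xpow F (- int K) * emb q)"
    using loc_homogen[OF assms(3)] by (simp add: homogen_iff_hcomp emb_add distrib_left)
  then show ?thesis using hcomp_loc[OF assms(1) pq(1)] hcomp_loc[OF assms(2) pq(2)] unfolding hcomp_add by blast
qed

lemma Cech_psum:
  assumes "hideal V P" "hideal V Q" "c \<in> Cech V (psum P Q) t k"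
  shows "\<exists>g\<in>Cech V P t k. \<exists>h\<in>Cech V Q t k. c = g + h"
proof -
  let ?ok = "\<lambda>F. F \<subseteq> V \<and> int (card F) = k"
  have "\<exists>g h. (if ?ok F then g \<in> loc P F t \<and> h \<in> loc Q F t \<and> c F = g + h else g = 0 \<and> h = 0)" for F
    using loc_psum[OF assms(1,2) Cech_in[OF assms(3)]] by (cases "?ok F") (auto simp: Bex_def)
  then obtain g h where gh: "\<And>F. if ?ok F then g F \<in> loc P F t \<and> h F \<in> loc Q F t \<and> c F = g F + h F else g F = 0 \<and> h F = 0"
    by metis
  have "g \<in> Cech V P t k" "h \<in> Cech V Q t k" using gh by (auto simp: Cech_def)
  moreover have "c = g + h"
  proof
    fix F show "c F = (g + h) F" using gh[of F] Cech_out[OF assms(3), of F] by (cases "?ok F") auto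
  qed
  ultimately show ?thesis by blast
qed

text \<open>A face E over the variables A \<union> B is the pair of \<open>E \<inter> A\<close> and
  \<open>E - A\<close>, so the Cech complex over A \<union> B is a tensor product of two Cech
  complexes. Signs appear only in the differential.\<close>

definition tensor :: "nat set \<Rightarrow> 'k::comm_ring_1 cochain \<Rightarrow> 'k cochain \<Rightarrow> 'k cochain" where
  "tensor A c e = (\<lambda>E. c (E \<inter> A) * e (E - A))"

definition single_cochain :: "nat set \<Rightarrow> 'k::comm_ring_1 lpoly \<Rightarrow> 'k cochain" where
  "single_cochain F x = (\<lambda>E. if E = F then x else 0)"

lemma additive_single_cochain: "additive_fun (single_cochain F)"
  by (rule additive_funI) (auto simp: single_cochain_def fun_eq_iff)

lemma smulc_single_cochain: "single_cochain F (smul u x) = smulc u (single_cochain F x)"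
  by (auto simp: single_cochain_def smulc_def smul_def fun_eq_iff)

lemma sum_single_cochain:
  assumes "finite S" "\<And>F. F \<notin> S \<Longrightarrow> c F = 0"
  shows "(\<Sum>F\<in>S. single_cochain F (c F)) = c"
proof
  fix E
  have "(\<Sum>F\<in>S. single_cochain F (c F)) E = (\<Sum>F\<in>S. if F = E then c F else 0)"
    by (induction S rule: infinite_finite_induct) (auto simp: single_cochain_def)
  then show "(\<Sum>F\<in>S. single_cochain F (c F)) E = c E"
    using assms by (auto simp: sum.delta')
qed

lemma single_cochain_Cech:
  assumes "hideal V P" "F \<subseteq> V" "int (card F) = k" "x \<in> loc P F t" "finite V"
  shows "single_cochain F x \<in> Cech V P t k"
  using assms add_closedD(1)[OF add_closed_loc[OF assms(1)]] by (simp add: Cech_def single_cochain_def)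

lemma tensor_diff: "tensor A (c - c') e = tensor A c e - tensor A c' e" "tensor A c (e - e') = tensor A c e - tensor A c e'"
  by (auto simp: tensor_def fun_eq_iff algebra_simps)

lemma loc_mult:
  assumes P: "hideal A P" and T: "hideal B T" and A: "finite A" and B: "finite B" and AB: "A \<inter> B = {}"
    and F: "F \<subseteq> A" and G: "G \<subseteq> B" and x: "x \<in> loc P F a" and y: "y \<in> loc T G b"
  shows "x * y \<in> loc (tens P T) (F \<union> G) (a + b)"
proof -
  obtain K p q where pq: "p \<in> P" "q \<in> T" "Xpow F (int K) * x = emb p" "Xpow G (int K) * y = emb q"
    by (rule loc_obtain2[OF A B P F x T G y])
  have XU: "Xpow (F \<union> G) (int K) = Xpow F (int K) * Xpow G (int K)"
    using F G A B AB by (intro Xpow_Un) (auto intro: finite_subset)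
  have "Xpow (F \<union> G) (int K) * (x * y) = (Xpow F (int K) * x) * (Xpow G (int K) * y)"
    unfolding XU by (simp only: mult_ac)
  also have "\<dots> = emb (p * q)" by (simp only: pq emb_mult)
  finally show ?thesis
    using x y by (intro locI[OF _ _ tensI[OF pq(1,2)]] homogen_mult) (auto simp: loc_homogen)
qed

text \<open>The numerator is a sum of products p q. Once p is cut into homogeneous components, the
  degree t part of a product of fractions is x times the component of y of complementary
  degree.\<close>

lemma loc_tens:
  assumes P: "hideal A P" and T: "hideal B T" and F: "finite F" and G: "finite G" and FG: "F \<inter> G = {}"
    and f: "f \<in> loc (tens P T) (F \<union> G) t"
  shows "f \<in> aspan {x * y | x y a. x \<in> loc P F a \<and> y \<in> loc T G (t - a)}" (is "_ \<in> aspan ?S")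
proof -
  obtain K w where w: "w \<in> tens P T" "Xpow (F \<union> G) (int K) * f = emb w" using f by (auto simp: loc_def)
  have "f = Xpow (F \<union> G) (- int K) * emb w" using w by (metis Xpow_cancel(1))
  then have "f = hcomp t (Xpow (F \<union> G) (- int K) * emb w)" using loc_homogen[OF f] by (simp add: homogen_iff_hcomp)
  moreover have "hcomp t (Xpow (F \<union> G) (- int K) * emb w) \<in> aspan ?S"
  proof (rule aspan_image[OF _ _ w(1)[unfolded tens_def]])
    show "additive_fun (\<lambda>w. hcomp t (Xpow (F \<union> G) (- int K) * emb w))"
      by (rule additive_funI) (simp_all add: emb_add distrib_left hcomp_add)
    fix g assume "g \<in> {p * q | p q. p \<in> P \<and> q \<in> T}"
    then obtain p q where pq: "p \<in> P" "q \<in> T" "g = p * q" by auto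
    let ?x = "\<lambda>a. Xpow F (- int K) * emb (hcomp a p)" and ?y = "Xpow G (- int K) * emb q"
    have "hcomp t (?x a * ?y) \<in> aspan ?S" for a
    proof -
      let ?a = "int a - int K * int (card F)"
      have "homogen ?a (?x a)"
        using homogen_Xpow_mult[of "int a" "emb (hcomp a p)" "- int K" F] by (simp add: hcomp_emb[symmetric])
      then have "hcomp t (?x a * ?y) = ?x a * hcomp (t - ?a) ?y" "?x a = hcomp ?a (?x a)"
        using hcomp_mult_homogen[of ?a "?x a" "t - ?a" ?y] by (simp_all add: homogen_iff_hcomp)
      moreover have "hcomp ?a (?x a) \<in> loc P F ?a" "hcomp (t - ?a) ?y \<in> loc T G (t - ?a)"
        using hcomp_loc[OF P hidealD(4)[OF P pq(1)]] hcomp_loc[OF T pq(2)] by auto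
      ultimately show ?thesis by (metis (mono_tags, lifting) aspan_base mem_Collect_eq)
    qed
    then have "(\<Sum>a\<in>deg ` keys p. hcomp t (?x a * ?y)) \<in> aspan ?S" by (rule aspan_sum)
    also have "(\<Sum>a\<in>deg ` keys p. hcomp t (?x a * ?y))
       = hcomp t (Xpow F (- int K) * emb (\<Sum>a\<in>deg ` keys p. hcomp a p) * ?y)"
      by (simp add: additive_fun_sum[OF additive_hcomp] additive_fun_sum[OF additive_emb] sum_distrib_left sum_distrib_right)
    also have "\<dots> = hcomp t (Xpow (F \<union> G) (- int K) * emb g)"
      unfolding sum_hcomp_keys pq(3) Xpow_Un[OF F G FG, of "- int K"] by (simp add: emb_mult mult_ac)
    finally show "hcomp t (Xpow (F \<union> G) (- int K) * emb g) \<in> aspan ?S" .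
  qed
  ultimately show ?thesis by simp
qed

definition pure :: "nat set \<Rightarrow> nat set \<Rightarrow> 'k::comm_ring_1 mpoly set \<Rightarrow> 'k mpoly set \<Rightarrow> int \<Rightarrow> int \<Rightarrow> 'k cochain set" where
  "pure A B P T t k = {tensor A c e | c e i a. c \<in> Cech A P a i \<and> e \<in> Cech B T (t - a) (k - i)}"

lemma pureI: "c \<in> Cech A P a i \<Longrightarrow> e \<in> Cech B T b j \<Longrightarrow> t = a + b \<Longrightarrow> k = i + j \<Longrightarrow> tensor A c e \<in> pure A B P T t k"
  unfolding pure_def by force

lemma tensor_Cech:
  assumes P: "hideal A P" and T: "hideal B T" and A: "finite A" and B: "finite B" and AB: "A \<inter> B = {}"
    and c: "c \<in> Cech A P a i" and e: "e \<in> Cech B T b j"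
  shows "tensor A c e \<in> Cech (A \<union> B) (tens P T) (a + b) (i + j)"
proof (rule ccI)
  fix E assume E: "E \<subseteq> A \<union> B" "int (card E) = i + j"
  have sub: "E \<inter> A \<subseteq> A" "E - A \<subseteq> B" "E \<inter> A \<union> (E - A) = E" using E by auto
  have fE: "finite E" using E A B finite_subset by blast
  have "add_closed (loc (tens P T) E (a + b))"
    using A B E(1) by (intro add_closed_loc[OF hideal_tens[OF P T refl]]) auto
  note 0 = add_closedD(1)[OF this]
  show "tensor A c e E \<in> loc (tens P T) E (a + b)"
  proof (cases "int (card (E \<inter> A)) = i")
    case True
    have "card E = card (E \<inter> A) + card (E - A)" using card_Int_Diff[OF fE, of A] by simp
    then have "int (card (E - A)) = j" using True E by simp
    then show ?thesis
      using loc_mult[OF P T A B AB sub(1,2) Cech_in[OF c sub(1) True] Cech_in[OF e sub(2)]] sub(3) by (simp add: tensor_def)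
  next
    case False
    then have "c (E \<inter> A) = 0" using Cech_out[OF c, of "E \<inter> A"] by simp
    then show ?thesis using 0 by (simp add: tensor_def)
  qed
next
  fix E assume E: "\<not> (E \<subseteq> A \<union> B \<and> int (card E) = i + j)"
  show "tensor A c e E = 0"
  proof (cases "E \<inter> A \<subseteq> A \<and> int (card (E \<inter> A)) = i \<and> E - A \<subseteq> B \<and> int (card (E - A)) = j")
    case True
    then have "E \<subseteq> A \<union> B" by auto
    then have "finite E" using A B finite_subset by blast
    then have "card E = card (E \<inter> A) + card (E - A)" using card_Int_Diff[of E A] by simp
    then show ?thesis using True E \<open>E \<subseteq> A \<union> B\<close> by simp
  next
    case False
    then have "c (E \<inter> A) = 0 \<or> e (E - A) = 0" using Cech_out[OF c, of "E \<inter> A"] Cech_out[OF e, of "E - A"] by metis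
    then show ?thesis by (auto simp: tensor_def)
  qed
qed

text \<open>A cochain is the sum of its entries on single faces, and on one face E a product x y is
  the pure tensor of x on \<open>E \<inter> A\<close> and y on \<open>E - A\<close>.\<close>

lemma Cech_tens:
  assumes P: "hideal A P" and T: "hideal B T" and A: "finite A" and B: "finite B" and AB: "A \<inter> B = {}"
  shows "Cech (A \<union> B) (tens P T) t k = aspan (pure A B P T t k)"
proof
  have fR: "finite (A \<union> B)" using A B by simp
  show "aspan (pure A B P T t k) \<subseteq> Cech (A \<union> B) (tens P T) t k"
  proof (rule aspan_least[OF add_closed_Cech[OF hideal_tens[OF P T refl] fR]])
    show "pure A B P T t k \<subseteq> Cech (A \<union> B) (tens P T) t k"
      using tensor_Cech[OF P T A B AB] by (fastforce simp: pure_def)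
  qed
  show "Cech (A \<union> B) (tens P T) t k \<subseteq> aspan (pure A B P T t k)"
  proof
    fix z assume z: "z \<in> Cech (A \<union> B) (tens P T) t k"
    have "single_cochain E (z E) \<in> aspan (pure A B P T t k)" if E: "E \<in> Pow (A \<union> B)" for E
    proof (cases "int (card E) = k")
      case True
      have sub: "E \<inter> A \<subseteq> A" "E - A \<subseteq> B" "E \<inter> A \<union> (E - A) = E" using E by auto
      have fE: "finite E" using E fR finite_subset by blast
      have card: "card E = card (E \<inter> A) + card (E - A)" using card_Int_Diff[OF fE, of A] by simp
      have "z E \<in> loc (tens P T) (E \<inter> A \<union> (E - A)) t" using Cech_in[OF z _ True] E sub(3) by auto
      then have "z E \<in> aspan {x * y | x y a. x \<in> loc P (E \<inter> A) a \<and> y \<in> loc T (E - A) (t - a)}"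
        using fE by (intro loc_tens[OF P T]) auto
      show ?thesis
      proof (rule aspan_image[OF additive_single_cochain _ \<open>z E \<in> aspan _\<close>])
        fix g assume "g \<in> {x * y | x y a. x \<in> loc P (E \<inter> A) a \<and> y \<in> loc T (E - A) (t - a)}"
        then obtain x y a where g: "g = x * y" "x \<in> loc P (E \<inter> A) a" "y \<in> loc T (E - A) (t - a)" by blast
        have "single_cochain E g = tensor A (single_cochain (E \<inter> A) x) (single_cochain (E - A) y)"
          by (auto simp: g(1) tensor_def single_cochain_def fun_eq_iff)
        also have "\<dots> \<in> pure A B P T t k"
          by (rule pureI[OF single_cochain_Cech[OF P sub(1) refl g(2) A] single_cochain_Cech[OF T sub(2) refl g(3) B]])
            (use True card in auto)
        finally show "single_cochain E g \<in> aspan (pure A B P T t k)" by (rule aspan_base)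
      qed
    next
      case False
      then have "z E = 0" using Cech_out[OF z, of E] by auto
      then show ?thesis by (simp add: additive_fun_0[OF additive_single_cochain] aspan_0)
    qed
    then have "(\<Sum>E\<in>Pow (A \<union> B). single_cochain E (z E)) \<in> aspan (pure A B P T t k)" by (rule aspan_sum)
    moreover have "(\<Sum>E\<in>Pow (A \<union> B). single_cochain E (z E)) = z"
      using fR by (intro sum_single_cochain) (auto intro!: Cech_out[OF z])
    ultimately show "z \<in> aspan (pure A B P T t k)" by simp
  qed
qed

text \<open>The Koszul sign (-1)^i for an integer exponent i.\<close>

definition signed :: "int \<Rightarrow> 'k::comm_ring_1 cochain \<Rightarrow> 'k cochain" where
  "signed i z = (if even i then z else - z)"

lemma signed_simps:
  "signed i (signed i z) = z" "signed (i + 1) z = - signed i z" "signed (i - 1) z = - signed i z" "signed i (y - z) = signed i y - signed i z"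
  "signed i (y + z) = signed i y + signed i z" "signed i (- z) = - signed i z"
  by (auto simp: signed_def)

lemma additive_signed: "additive_fun f \<Longrightarrow> f (signed i z) = signed i (f z)"
  by (simp add: signed_def additive_fun_minus)

text \<open>The variables of A precede those of B, so the position of j in E is its position in
  \<open>E \<inter> A\<close>, or its position in \<open>E - A\<close> shifted by
  \<open>card (E \<inter> A)\<close>. The shift equals i wherever c is nonzero, which produces the
  sign.\<close>

lemma diff_tensor:
  assumes A: "finite A" and B: "finite B" and AB: "\<And>a b. a \<in> A \<Longrightarrow> b \<in> B \<Longrightarrow> a < b"
    and c: "c \<in> Cech A P a i" and e: "e \<in> Cech B T b j"
  shows "diff (A \<union> B) (tensor A c e) = tensor A (diff A c) e + signed i (tensor A c (diff B e))"
proof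
  fix E
  have disj: "A \<inter> B = {}" using AB by force
  show "diff (A \<union> B) (tensor A c e) E = (tensor A (diff A c) e + signed i (tensor A c (diff B e))) E"
  proof (cases "E \<subseteq> A \<union> B")
    case True
    then have fE: "finite E" using A B finite_subset by blast
    have sub: "E \<inter> A \<subseteq> A" "E - A \<subseteq> B" using True by auto
    have "diff (A \<union> B) (tensor A c e) E = (\<Sum>j\<in>(E \<inter> A) \<union> (E - A). pos_sign j E * (c ((E - {j}) \<inter> A) * e (E - {j} - A)))"
      using True by (simp add: diff_def tensor_def Int_Diff_Un)
    also have "\<dots> = (\<Sum>j\<in>E \<inter> A. pos_sign j E * (c ((E - {j}) \<inter> A) * e (E - {j} - A)))
        + (\<Sum>j\<in>E - A. pos_sign j E * (c ((E - {j}) \<inter> A) * e (E - {j} - A)))"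
      using fE by (intro sum.union_disjoint) auto
    also have "(\<Sum>j\<in>E \<inter> A. pos_sign j E * (c ((E - {j}) \<inter> A) * e (E - {j} - A))) = diff A c (E \<inter> A) * e (E - A)"
    proof -
      have "pos_sign j E * (c ((E - {j}) \<inter> A) * e (E - {j} - A)) = pos_sign j (E \<inter> A) * c (E \<inter> A - {j}) * e (E - A)"
        if j: "j \<in> E \<inter> A" for j
      proof -
        have "{v\<in>E. v < j} = {v\<in>E \<inter> A. v < j}" using sub(2) AB j by fastforce
        moreover have "(E - {j}) \<inter> A = E \<inter> A - {j}" "E - {j} - A = E - A" using j by auto
        ultimately show ?thesis by (simp add: pos_sign_def mult.assoc)
      qed
      then show ?thesis by (simp add: diff_def sum_distrib_right)
    qed
    also have "(\<Sum>j\<in>E - A. pos_sign j E * (c ((E - {j}) \<inter> A) * e (E - {j} - A)))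
        = (- 1) ^ card (E \<inter> A) * c (E \<inter> A) * diff B e (E - A)"
    proof -
      have "pos_sign j E * (c ((E - {j}) \<inter> A) * e (E - {j} - A))
         = (- 1) ^ card (E \<inter> A) * c (E \<inter> A) * (pos_sign j (E - A) * e (E - A - {j}))"
        if j: "j \<in> E - A" for j
      proof -
        have "{v\<in>E. v < j} = (E \<inter> A) \<union> {v\<in>E - A. v < j}" using sub(2) AB j by auto
        then have "card {v\<in>E. v < j} = card (E \<inter> A) + card {v\<in>E - A. v < j}"
          using fE by (simp add: card_Un_disjoint disjoint_iff)
        moreover have "(E - {j}) \<inter> A = E \<inter> A" "E - {j} - A = E - A - {j}" using j by auto
        ultimately show ?thesis by (simp add: pos_sign_def power_add mult_ac)
      qed
      then show ?thesis using sub(2) by (simp add: diff_def sum_distrib_left)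
    qed
    also have "(- 1) ^ card (E \<inter> A) * c (E \<inter> A) * diff B e (E - A) = signed i (tensor A c (diff B e)) E"
      using Cech_out[OF c, of "E \<inter> A"] by (cases "int (card (E \<inter> A)) = i") (auto simp: signed_def tensor_def)
    finally show ?thesis by (simp add: tensor_def)
  next
    case False
    then have "\<not> E - A \<subseteq> B" by auto
    then have "e (E - A) = 0" "diff B e (E - A) = 0" using Cech_out[OF e, of "E - A"] by (auto simp: diff_def)
    then show ?thesis using False by (simp add: diff_def tensor_def signed_def)
  qed
qed

lemma additive_compose: "additive_fun f \<Longrightarrow> additive_fun g \<Longrightarrow> additive_fun (\<lambda>x. f (g x))"
  by (simp add: additive_fun_def)

lemma Cech_vars:
  assumes "hideal V P" "c \<in> Cech V P t k"
  shows "vars_in V (c F)"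
proof (cases "F \<subseteq> V \<and> int (card F) = k")
  case True
  then show ?thesis using loc_vars[OF assms(1) _ Cech_in[OF assms(2)]] by blast
next
  case False
  then show ?thesis using Cech_out[OF assms(2)] by (auto simp: vars_in_def)
qed

lemma Cech_homogen: "c \<in> Cech V P t k \<Longrightarrow> homogen t (c F)"
  using Cech_in[of c V P t k F] Cech_out[of c V P t k F] loc_homogen homogen_0 by metis

text \<open>The operators h \<otimes> 1 and 1 \<otimes> h on cochains over the variables A \<union> B. The sign in the second
  one makes it anticommute with d \<otimes> 1.\<close>
definition opA :: "nat set \<Rightarrow> (int \<Rightarrow> int \<Rightarrow> 'k::comm_ring_1 cochain \<Rightarrow> 'k cochain) \<Rightarrow> 'k cochain \<Rightarrow> 'k cochain" where
  "opA A h z = (\<lambda>E. \<Sum>F\<in>Pow A. lmap A (\<lambda>a x. h (int (card F)) a (single_cochain F x) (E \<inter> A)) (z (F \<union> (E - A))))"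

definition opB :: "nat set \<Rightarrow> nat set \<Rightarrow> (int \<Rightarrow> int \<Rightarrow> 'k::comm_ring_1 cochain \<Rightarrow> 'k cochain) \<Rightarrow> 'k cochain \<Rightarrow> 'k cochain" where
  "opB A B h z = (\<lambda>E. (- 1) ^ card (E \<inter> A) *
     (\<Sum>G\<in>Pow B. lmap (- A) (\<lambda>b y. h (int (card G)) b (single_cochain G y) (E - A)) (z ((E \<inter> A) \<union> G))))"

context
  fixes h :: "int \<Rightarrow> int \<Rightarrow> 'k::comm_ring_1 cochain \<Rightarrow> 'k cochain"
  assumes add: "\<And>i a. additive_fun (h i a)"
    and scale: "\<And>i a u c. h i a (smulc u c) = smulc u (h i a c)"
begin

lemma additive_component: "additive_fun (\<lambda>x. h i a (single_cochain F x) E)"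
  using additive_compose[OF add additive_single_cochain, of i a F] by (simp add: additive_fun_def)

lemma scale_component: "h i a (single_cochain F (smul u x)) E = smul u (h i a (single_cochain F x) E)"
  by (simp add: smulc_single_cochain scale) (simp add: smulc_def)

lemma additive_opA: "additive_fun (opA A h)"
  using additive_fun_add[OF additive_lmap[OF additive_component]] additive_fun_0[OF additive_lmap[OF additive_component]]
  by (intro additive_funI) (simp_all add: opA_def fun_eq_iff sum.distrib)

lemma additive_opB: "additive_fun (opB A B h)"
  using additive_fun_add[OF additive_lmap[OF additive_component]] additive_fun_0[OF additive_lmap[OF additive_component]]
  by (intro additive_funI) (simp_all add: opB_def fun_eq_iff sum.distrib distrib_left)

lemma sum_component:
  assumes "finite V" "hideal V P" "c \<in> Cech V P t k"
  shows "(\<Sum>F\<in>Pow V. h k t (single_cochain F (c F)) E) = h k t c E"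
proof -
  have "(\<Sum>F\<in>Pow V. h k t (single_cochain F (c F))) = h k t (\<Sum>F\<in>Pow V. single_cochain F (c F))"
    by (simp add: additive_fun_sum[OF add])
  also have "(\<Sum>F\<in>Pow V. single_cochain F (c F)) = c"
    using assms(1) by (intro sum_single_cochain) (auto intro!: Cech_out[OF assms(3)])
  finally have "(\<Sum>F\<in>Pow V. h k t (single_cochain F (c F))) E = h k t c E" by simp
  moreover have "sum f S E = (\<Sum>x\<in>S. f x E)" for f :: "nat set \<Rightarrow> 'k cochain" and S
    by (induction S rule: infinite_finite_induct) auto
  ultimately show ?thesis by simp
qed

lemma lmap_component:
  assumes "hideal V P" "c \<in> Cech V P t k" "V \<subseteq> U" "vars_in (- U) y"
  shows "lmap U (\<lambda>a x. h (int (card F)) a (single_cochain F x) E) (c F * y) = h k t (single_cochain F (c F)) E * y"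
proof (cases "int (card F) = k")
  case True
  show ?thesis
  proof (rule lmap_mult[OF additive_component scale_component _ _ assms(4) additive_component])
    show "vars_in U (c F)" using Cech_vars[OF assms(1,2)] assms(3) by (rule vars_in_mono)
    fix m assume "m \<in> keys (c F)"
    then show "(\<lambda>x. h (int (card F)) (deg m) (single_cochain F x) E) = (\<lambda>x. h k t (single_cochain F x) E)"
      using Cech_homogen[OF assms(2), of F] True by (simp add: homogen_def)
  qed
next
  case False
  then have "c F = 0" using Cech_out[OF assms(2)] by auto
  then show ?thesis
    by (simp add: additive_fun_0[OF additive_lmap[OF additive_component]] additive_fun_0[OF additive_component])
qed

text \<open>\<open>opA\<close> is defined on arbitrary cochains, with no chosen decomposition into
  pure tensors, so it is additive by construction; here it is computed on pure tensors. Summing over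
  F reassembles c from its entries.\<close>

lemma opA_tensor:
  assumes A: "finite A" and AB: "A \<inter> B = {}" and P: "hideal A P" and T: "hideal B T"
    and c: "c \<in> Cech A P a i" and e: "e \<in> Cech B T b j"
  shows "opA A h (tensor A c e) = tensor A (h i a c) e"
proof
  fix E
  have "vars_in (- A) (e (E - A))" using Cech_vars[OF T e] by (rule vars_in_mono) (use AB in auto)
  then have *: "lmap A (\<lambda>a x. h (int (card F)) a (single_cochain F x) (E \<inter> A)) (c F * e (E - A))
      = h i a (single_cochain F (c F)) (E \<inter> A) * e (E - A)" for F
    by (rule lmap_component[OF P c subset_refl])
  have "tensor A c e (F \<union> (E - A)) = c F * e (E - A)" if "F \<in> Pow A" for F
  proof -
    have "(F \<union> (E - A)) \<inter> A = F" "F \<union> (E - A) - A = E - A" using that by auto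
    then show ?thesis by (simp add: tensor_def)
  qed
  then have "opA A h (tensor A c e) E = (\<Sum>F\<in>Pow A. h i a (single_cochain F (c F)) (E \<inter> A) * e (E - A))"
    unfolding opA_def by (intro sum.cong refl) (simp add: *)
  also have "\<dots> = h i a c (E \<inter> A) * e (E - A)"
    by (simp add: sum_component[OF A P c] flip: sum_distrib_right)
  finally show "opA A h (tensor A c e) E = tensor A (h i a c) e E" by (simp add: tensor_def)
qed

text \<open>The factor (-1)^card (E \<inter> A) in \<open>opB\<close> becomes (-1)^i, because c is
  supported on faces of cardinality i.\<close>

lemma opB_tensor:
  assumes B: "finite B" and AB: "A \<inter> B = {}" and P: "hideal A P" and T: "hideal B T"
    and c: "c \<in> Cech A P a i" and e: "e \<in> Cech B T b j"
  shows "opB A B h (tensor A c e) = signed i (tensor A c (h j b e))"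
proof
  fix E
  have v: "vars_in (- (- A)) (c (E \<inter> A))" using Cech_vars[OF P c] by simp
  have *: "lmap (- A) (\<lambda>a x. h (int (card F)) a (single_cochain F x) (E - A)) (e F * c (E \<inter> A))
      = h j b (single_cochain F (e F)) (E - A) * c (E \<inter> A)" for F
    by (rule lmap_component[OF T e _ v]) (use AB in auto)
  have "tensor A c e ((E \<inter> A) \<union> G) = e G * c (E \<inter> A)" if "G \<in> Pow B" for G
  proof -
    have "(E \<inter> A \<union> G) \<inter> A = E \<inter> A" "E \<inter> A \<union> G - A = G" using that AB by auto
    then show ?thesis by (simp add: tensor_def mult.commute)
  qed
  then have "opB A B h (tensor A c e) E
      = (- 1) ^ card (E \<inter> A) * (\<Sum>F\<in>Pow B. h j b (single_cochain F (e F)) (E - A) * c (E \<inter> A))"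
    unfolding opB_def by (intro arg_cong2[where f = "(*)"] sum.cong refl) (simp add: *)
  also have "\<dots> = (- 1) ^ card (E \<inter> A) * (h j b e (E - A) * c (E \<inter> A))"
    by (simp add: sum_component[OF B T e] flip: sum_distrib_right)
  also have "\<dots> = signed i (tensor A c (h j b e)) E"
    using Cech_out[OF c, of "E \<inter> A"]
    by (cases "int (card (E \<inter> A)) = i") (auto simp: signed_def tensor_def mult.commute)
  finally show "opB A B h (tensor A c e) E = signed i (tensor A c (h j b e)) E" .
qed

end

lemma Cech_psum_tens:
  assumes P: "hideal A P" "hideal A Q" and T: "hideal B T" "hideal B U"
    and A: "finite A" and B: "finite B" and AB: "A \<inter> B = {}"
  shows "Cech (A \<union> B) (psum (tens Q T) (tens P U)) t k = aspan (pure A B Q T t k \<union> pure A B P U t k)"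
proof
  have hQT: "hideal (A \<union> B) (tens Q T)" and hPU: "hideal (A \<union> B) (tens P U)"
    using hideal_tens P T by blast+
  note W = hideal_psum[OF hQT hPU]
  have sub: "tens Q T \<subseteq> psum (tens Q T) (tens P U)" "tens P U \<subseteq> psum (tens Q T) (tens P U)"
    using add_closedD(1)[OF hidealD(2)[OF hQT]] add_closedD(1)[OF hidealD(2)[OF hPU]]
    by (force simp: psum_mem)+
  show "aspan (pure A B Q T t k \<union> pure A B P U t k) \<subseteq> Cech (A \<union> B) (psum (tens Q T) (tens P U)) t k"
  proof (rule aspan_least[OF add_closed_Cech[OF W]])
    have "pure A B Q T t k \<subseteq> Cech (A \<union> B) (tens Q T) t k" "pure A B P U t k \<subseteq> Cech (A \<union> B) (tens P U) t k"
      unfolding Cech_tens[OF P(2) T(1) A B AB] Cech_tens[OF P(1) T(2) A B AB] using aspan_base by auto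
    then show "pure A B Q T t k \<union> pure A B P U t k \<subseteq> Cech (A \<union> B) (psum (tens Q T) (tens P U)) t k"
      using Cech_mono[OF sub(1)] Cech_mono[OF sub(2)] by blast
  qed (use A B in auto)
  show "Cech (A \<union> B) (psum (tens Q T) (tens P U)) t k \<subseteq> aspan (pure A B Q T t k \<union> pure A B P U t k)"
  proof
    fix c assume "c \<in> Cech (A \<union> B) (psum (tens Q T) (tens P U)) t k"
    from Cech_psum[OF hQT hPU this] obtain g h where gh: "g \<in> aspan (pure A B Q T t k)" "h \<in> aspan (pure A B P U t k)" "c = g + h"
      unfolding Cech_tens[OF P(2) T(1) A B AB] Cech_tens[OF P(1) T(2) A B AB] by blast
    have "g \<in> aspan (pure A B Q T t k \<union> pure A B P U t k)" "h \<in> aspan (pure A B Q T t k \<union> pure A B P U t k)"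
      using gh(1,2) by (auto intro: aspan_mono[THEN subsetD, rotated])
    then show "c \<in> aspan (pure A B Q T t k \<union> pure A B P U t k)" unfolding gh(3) by (rule aspan_add)
  qed
qed

text \<open>If h is a contracting homotopy for P/Q and h' one for T/U, then 1 - [d, h \<otimes> 1] maps
  a pure tensor c \<otimes> e to p(c) \<otimes> e with p = 1 - [d, h], and likewise on the other factor.
  In a bidegree where one of the two complexes is exact, p(c) \<otimes> p'(e) vanishes.\<close>
theorem exact_tens:
  fixes P Q T U :: "'k::field mpoly set"
  assumes A: "finite A" and B: "finite B" and AB: "\<And>a b. a \<in> A \<Longrightarrow> b \<in> B \<Longrightarrow> a < b"
    and P: "hideal A P" "hideal A Q" "Q \<subseteq> P" and T: "hideal B T" "hideal B U" "U \<subseteq> T"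
    and ex: "\<And>i a. exact A P Q i a \<or> exact B T U (k - i) (t - a)"
  shows "exact (A \<union> B) (tens P T) (psum (tens Q T) (tens P U)) k t"
proof -
  let ?R = "A \<union> B" and ?W = "psum (tens Q T) (tens P U)"
  have disj: "A \<inter> B = {}" using AB by force
  have fR: "finite ?R" using A B by simp
  have hPT: "hideal ?R (tens P T)" by (rule hideal_tens[OF P(1) T(1) refl])
  have hW: "hideal ?R ?W" by (rule hideal_psum[OF hideal_tens[OF P(2) T(1) refl] hideal_tens[OF P(1) T(2) refl]])
  note PT = Cech_tens[OF P(1) T(1) A B disj] and W = Cech_psum_tens[OF P(1,2) T(1,2) A B disj]
  obtain hA where hA: "\<And>i a. additive_fun (hA i a)"
    "\<And>i a u c. hA i a (smulc u c) = smulc u (hA i a c)"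
    "\<And>i a c. hA i a c \<in> Cech A P a (i - 1)"
    "\<And>i a c. c \<in> Cech A Q a i \<Longrightarrow> hA i a c = 0"
    "\<And>i a c. exact A P Q i a \<Longrightarrow> c \<in> Cech A P a i \<Longrightarrow> c - diff A (hA i a c) - hA (i + 1) a (diff A c) \<in> Cech A Q a i"
    by (rule exact_homotopy[OF A P(1,2)], rule that)
  obtain hB where hB: "\<And>i a. additive_fun (hB i a)"
    "\<And>i a u c. hB i a (smulc u c) = smulc u (hB i a c)"
    "\<And>i a c. hB i a c \<in> Cech B T a (i - 1)"
    "\<And>i a c. c \<in> Cech B U a i \<Longrightarrow> hB i a c = 0"
    "\<And>i a c. exact B T U i a \<Longrightarrow> c \<in> Cech B T a i \<Longrightarrow> c - diff B (hB i a c) - hB (i + 1) a (diff B c) \<in> Cech B U a i"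
    by (rule exact_homotopy[OF B T(1,2)], rule that)
  define HA where "HA = opA A hA"
  define HB where "HB = opB A B hB"
  have aHA: "additive_fun HA" and aHB: "additive_fun HB"
    unfolding HA_def HB_def by (rule additive_opA[OF hA(1,2)] additive_opB[OF hB(1,2)])+
  have HA: "HA (tensor A c e) = tensor A (hA i a c) e" if "c \<in> Cech A P a i" "e \<in> Cech B T b j" for c e a i b j
    unfolding HA_def by (rule opA_tensor[OF hA(1,2) A disj P(1) T(1) that])
  have HB: "HB (tensor A c e) = signed i (tensor A c (hB j b e))" if "c \<in> Cech A P a i" "e \<in> Cech B T b j" for c e a i b j
    unfolding HB_def by (rule opB_tensor[OF hB(1,2) B disj P(1) T(1) that])
  have QP: "c \<in> Cech A P a i" if "c \<in> Cech A Q a i" for c a i using Cech_mono[OF P(3)] that by blast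
  have UT: "e \<in> Cech B T b j" if "e \<in> Cech B U b j" for e b j using Cech_mono[OF T(3)] that by blast
  have zero: "0 \<in> aspan S" for S :: "'k cochain set" by (rule aspan_0)
  have signed_aspan: "signed i z \<in> Cech ?R S t k" if "hideal ?R S" "z \<in> Cech ?R S t k" for i z S k
    using add_closedD(3)[OF add_closed_Cech[OF that(1) fR] that(2)] that(2) by (simp add: signed_def)
  have in_PT: "tensor A c e \<in> Cech ?R (tens P T) t k" if "c \<in> Cech A P a i" "e \<in> Cech B T b j" "t = a + b" "k = i + j" for c e a i b j k
    unfolding PT by (rule aspan_base[OF pureI[OF that]])
  have in_W: "tensor A c e \<in> Cech ?R ?W t k" if "c \<in> Cech A P a i" "e \<in> Cech B T b j" "t = a + b" "k = i + j"
      "c \<in> Cech A Q a i \<or> e \<in> Cech B U b j" for c e a i b j k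
  proof -
    have "tensor A c e \<in> pure A B Q T t k \<union> pure A B P U t k"
      using that(5)
    proof
      assume "c \<in> Cech A Q a i" then show ?thesis using pureI[OF _ that(2,3,4)] by blast
    next
      assume "e \<in> Cech B U b j" then show ?thesis using pureI[OF that(1) _ that(3,4)] by blast
    qed
    then show ?thesis unfolding W by (rule aspan_base)
  qed
  have PT_image: "f z \<in> S" if "additive_fun f" "add_closed S" "z \<in> Cech ?R (tens P T) t k"
      "\<And>c e a i. c \<in> Cech A P a i \<Longrightarrow> e \<in> Cech B T (t - a) (k - i) \<Longrightarrow> f (tensor A c e) \<in> S" for f S z k
  proof -
    have "f z \<in> aspan S"
      by (rule aspan_image[OF that(1) _ that(3)[unfolded PT]]) (use that(4) in \<open>auto simp: pure_def intro!: aspan_base\<close>)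
    then show ?thesis using aspan_least[OF that(2) subset_refl] by blast
  qed
  have W_image: "f z \<in> S" if "additive_fun f" "add_closed S" "z \<in> Cech ?R ?W t k"
      "\<And>c e a i. c \<in> Cech A P a i \<Longrightarrow> e \<in> Cech B T (t - a) (k - i) \<Longrightarrow>
         c \<in> Cech A Q a i \<or> e \<in> Cech B U (t - a) (k - i) \<Longrightarrow> f (tensor A c e) \<in> S" for f S z k
  proof -
    have "f z \<in> aspan S"
    proof (rule aspan_image[OF that(1) _ that(3)[unfolded W]])
      fix g assume "g \<in> pure A B Q T t k \<union> pure A B P U t k"
      then obtain c e i a where "g = tensor A c e" "c \<in> Cech A P a i" "e \<in> Cech B T (t - a) (k - i)"
        "c \<in> Cech A Q a i \<or> e \<in> Cech B U (t - a) (k - i)"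
        unfolding pure_def using QP UT by blast
      then show "f g \<in> aspan S" using that(4) by (auto intro!: aspan_base)
    qed
    then show ?thesis using aspan_least[OF that(2) subset_refl] by blast
  qed
  note acPT = add_closed_Cech[OF hPT fR] and acW = add_closed_Cech[OF hW fR]
  have HA_PT: "HA z \<in> Cech ?R (tens P T) t (k - 1)" if "z \<in> Cech ?R (tens P T) t k" for z k
  proof (rule PT_image[OF aHA acPT that])
    fix c e a i assume "c \<in> Cech A P a i" "e \<in> Cech B T (t - a) (k - i)"
    then show "HA (tensor A c e) \<in> Cech ?R (tens P T) t (k - 1)"
      by (simp add: HA) (rule in_PT[OF hA(3)], auto)
  qed
  have HB_PT: "HB z \<in> Cech ?R (tens P T) t (k - 1)" if "z \<in> Cech ?R (tens P T) t k" for z k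
  proof (rule PT_image[OF aHB acPT that])
    fix c e a i assume "c \<in> Cech A P a i" "e \<in> Cech B T (t - a) (k - i)"
    then show "HB (tensor A c e) \<in> Cech ?R (tens P T) t (k - 1)"
      by (simp add: HB) (rule signed_aspan[OF hPT in_PT[OF _ hB(3)]], auto)
  qed
  \<comment> \<open>\<open>hA\<close> kills Q, so \<open>HA\<close> kills Q \<otimes> T, while it
    maps P \<otimes> U into itself.\<close>
  have HA_W: "HA z \<in> Cech ?R ?W t (k - 1)" if "z \<in> Cech ?R ?W t k" for z k
  proof (rule W_image[OF aHA acW that])
    fix c e a i assume c: "c \<in> Cech A P a i" "e \<in> Cech B T (t - a) (k - i)"
      and "c \<in> Cech A Q a i \<or> e \<in> Cech B U (t - a) (k - i)"
    then have "hA i a c \<in> Cech A Q a (i - 1) \<or> e \<in> Cech B U (t - a) (k - i)"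
      using hA(4) add_closedD(1)[OF add_closed_Cech[OF P(2) A]] by metis
    then show "HA (tensor A c e) \<in> Cech ?R ?W t (k - 1)"
      unfolding HA[OF c] by (intro in_W[OF hA(3) c(2)]) auto
  qed
  have HB_W: "HB z \<in> Cech ?R ?W t (k - 1)" if "z \<in> Cech ?R ?W t k" for z k
  proof (rule W_image[OF aHB acW that])
    fix c e a i assume c: "c \<in> Cech A P a i" "e \<in> Cech B T (t - a) (k - i)"
      and "c \<in> Cech A Q a i \<or> e \<in> Cech B U (t - a) (k - i)"
    then have "c \<in> Cech A Q a i \<or> hB (k - i) (t - a) e \<in> Cech B U (t - a) (k - i - 1)"
      using hB(4) add_closedD(1)[OF add_closed_Cech[OF T(2) B]] by metis
    then show "HB (tensor A c e) \<in> Cech ?R ?W t (k - 1)"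
      unfolding HB[OF c] by (intro signed_aspan[OF hW] in_W[OF c(1) hB(3)]) auto
  qed
  define D where "D = (diff ?R :: 'k cochain \<Rightarrow> _)"
  have aD: "additive_fun D" unfolding D_def by (rule additive_diff)
  have DD: "D (D z) = 0" for z unfolding D_def by (rule diff_diff[OF fR])
  have D: "D (tensor A c e) = tensor A (diff A c) e + signed i (tensor A c (diff B e))" if "c \<in> Cech A P a i" "e \<in> Cech B T b j" for c e a i b j
    unfolding D_def by (rule diff_tensor[OF A B AB that])
  have D_W: "D z \<in> Cech ?R ?W t (k + 1)" if "z \<in> Cech ?R ?W t k" for z k
    unfolding D_def by (rule diff_Cech[OF hW fR that])
  define \<Theta>A where "\<Theta>A z = z - D (HA z) - HA (D z)" for z
  define \<Theta>B where "\<Theta>B z = z - D (HB z) - HB (D z)" for z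
  have ddA: "diff A c \<in> Cech A P a (i + 1)" if "c \<in> Cech A P a i" for c a i by (rule diff_Cech[OF P(1) A that])
  have ddB: "diff B e \<in> Cech B T b (j + 1)" if "e \<in> Cech B T b j" for e b j by (rule diff_Cech[OF T(1) B that])
  define \<theta>A where "\<theta>A i a c = c - diff A (hA i a c) - hA (i + 1) a (diff A c)" for i a c
  define \<theta>B where "\<theta>B j b e = e - diff B (hB j b e) - hB (j + 1) b (diff B e)" for j b e
  \<comment> \<open>The two terms containing \<open>diff B e\<close> cancel: \<open>hA\<close>
    lowers i by one, which reverses the sign of the second part of D.\<close>
  have \<Theta>A: "\<Theta>A (tensor A c e) = tensor A (\<theta>A i a c) e" if c: "c \<in> Cech A P a i" and e: "e \<in> Cech B T b j" for c e a i b j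
    unfolding \<Theta>A_def \<theta>A_def D[OF c e] HA[OF c e] D[OF hA(3) e] additive_fun_add[OF aHA]
      HA[OF ddA[OF c] e] additive_signed[OF aHA] HA[OF c ddB[OF e]]
    by (simp add: tensor_diff signed_simps)
  \<comment> \<open>Here the terms containing \<open>diff A c\<close> cancel, since the sign in
    \<open>HB\<close> changes when i grows to i + 1.\<close>
  have \<Theta>B: "\<Theta>B (tensor A c e) = tensor A c (\<theta>B j b e)" if c: "c \<in> Cech A P a i" and e: "e \<in> Cech B T b j" for c e a i b j
    unfolding \<Theta>B_def \<theta>B_def HB[OF c e] additive_signed[OF aD] D[OF c e] D[OF c hB(3)] additive_fun_add[OF aHB]
      HB[OF ddA[OF c] e] additive_signed[OF aHB] HB[OF c ddB[OF e]]
    by (simp add: tensor_diff signed_simps)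
  have \<theta>A_Cech: "\<theta>A i a c \<in> Cech A P a i" if "c \<in> Cech A P a i" for i a c
  proof -
    note ac = add_closedD(4)[OF add_closed_Cech[OF P(1) A]]
    show ?thesis unfolding \<theta>A_def
      using that ddA[OF hA(3)[of i a c]] hA(3)[of "i + 1" a "diff A c"] by (intro ac) auto
  qed
  have \<theta>B_Cech: "\<theta>B i a c \<in> Cech B T a i" if "c \<in> Cech B T a i" for i a c
  proof -
    note ac = add_closedD(4)[OF add_closed_Cech[OF T(1) B]]
    show ?thesis unfolding \<theta>B_def
      using that ddB[OF hB(3)[of i a c]] hB(3)[of "i + 1" a "diff B c"] by (intro ac) auto
  qed
  have \<Theta>_W: "\<Theta>B (\<Theta>A z) \<in> Cech ?R ?W t k" if z: "z \<in> Cech ?R (tens P T) t k" for z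
  proof (rule PT_image[OF _ acW z])
    show "additive_fun (\<lambda>z. \<Theta>B (\<Theta>A z))"
      by (rule additive_funI)
        (simp_all add: \<Theta>A_def \<Theta>B_def additive_fun_0[OF aD] additive_fun_0[OF aHA] additive_fun_0[OF aHB]
          additive_fun_add[OF aD] additive_fun_add[OF aHA] additive_fun_add[OF aHB]
          additive_fun_minus[OF aD] additive_fun_minus[OF aHA] additive_fun_minus[OF aHB] algebra_simps)
    fix c e a i assume c: "c \<in> Cech A P a i" and e: "e \<in> Cech B T (t - a) (k - i)"
    have "\<theta>A i a c \<in> Cech A Q a i \<or> \<theta>B (k - i) (t - a) e \<in> Cech B U (t - a) (k - i)"
      using ex[of i a] hA(5)[OF _ c] hB(5)[OF _ e] unfolding \<theta>A_def \<theta>B_def by blast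
    then show "\<Theta>B (\<Theta>A (tensor A c e)) \<in> Cech ?R ?W t k"
      unfolding \<Theta>A[OF c e] \<Theta>B[OF \<theta>A_Cech[OF c] e] by (intro in_W[OF \<theta>A_Cech[OF c] \<theta>B_Cech[OF e]]) auto
  qed
  show ?thesis
    unfolding exact_def exact_at_def
  proof (intro ballI impI)
    fix z assume z: "z \<in> Cech ?R (tens P T) t k" and "diff ?R z \<in> Cech ?R ?W t (k + 1)"
    then have Dz: "D z \<in> Cech ?R ?W t (k + 1)" by (simp add: D_def)
    \<comment> \<open>Two corrections in turn: z = y + D (HA z) + HA (D z), and y = \<Theta>B y + D
      (HB y) + HB (D y). All terms other than the boundaries lie in ?W, so HA z + HB y is the
      required cochain.\<close>
    define y where "y = \<Theta>A z"
    have HDz: "HA (D z) \<in> Cech ?R ?W t k" using HA_W[OF Dz] by simp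
    have "D y = D z - D (HA (D z))"
      unfolding y_def \<Theta>A_def by (simp add: additive_fun_minus[OF aD] DD)
    then have Dy: "D y \<in> Cech ?R ?W t (k + 1)" using add_closedD(4)[OF acW Dz D_W[OF HDz]] by simp
    have HDy: "HB (D y) \<in> Cech ?R ?W t k" using HB_W[OF Dy] by simp
    have HAz: "HA z \<in> Cech ?R (tens P T) t (k - 1)" by (rule HA_PT[OF z])
    have DPT: "D x \<in> Cech ?R (tens P T) t (k + 1)" if "x \<in> Cech ?R (tens P T) t k" for x k
      unfolding D_def by (rule diff_Cech[OF hPT fR that])
    have "y \<in> Cech ?R (tens P T) t k"
      unfolding y_def \<Theta>A_def using z DPT[OF HAz] HA_PT[OF DPT[OF z]]
      by (intro add_closedD(4)[OF acPT]) auto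
    then have "HB y \<in> Cech ?R (tens P T) t (k - 1)" by (rule HB_PT)
    then have b: "HA z + HB y \<in> Cech ?R (tens P T) t (k - 1)" by (rule add_closedD(2)[OF acPT HAz])
    have "HA (D z) + (HB (D y) + \<Theta>B y) \<in> Cech ?R ?W t k"
      using \<Theta>_W[OF z] HDz HDy unfolding y_def[symmetric] by (intro add_closedD(2)[OF acW])
    moreover have "HA (D z) + (HB (D y) + \<Theta>B y) = z - D (HA z + HB y)"
      unfolding \<Theta>B_def using y_def[unfolded \<Theta>A_def] by (simp add: additive_fun_add[OF aD] algebra_simps)
    ultimately show "\<exists>b\<in>Cech ?R (tens P T) t (k - 1). z - diff ?R b \<in> Cech ?R ?W t k"
      using b unfolding D_def by auto
  qed
qed

section \<open>Comparison with the numerator description\<close>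

text \<open>Dividing by x_F^N does not affect vanishing, since N can be absorbed into the exponent
  K.\<close>

lemma loc_zero_iff:
  assumes "finite F" "hideal V J" "F \<subseteq> V"
  shows "loc_zero J F p \<longleftrightarrow> (\<exists>K. Xpow F (int K) * (Xpow F (- int N) * emb p) \<in> emb ` J)"
proof
  assume "loc_zero J F p"
  then obtain K where "xprod F ^ K * p \<in> J" by (auto simp: loc_zero_def)
  moreover have "Xpow F (int (K + N)) * (Xpow F (- int N) * emb p) = emb (xprod F ^ K * p)"
    by (simp add: emb_mult emb_xprod_power[OF assms(1)] Xpow_mult flip: mult.assoc)
  ultimately show "\<exists>K. Xpow F (int K) * (Xpow F (- int N) * emb p) \<in> emb ` J" by blast
next
  assume "\<exists>K. Xpow F (int K) * (Xpow F (- int N) * emb p) \<in> emb ` J"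
  then obtain K q where q: "q \<in> J" "Xpow F (int K) * (Xpow F (- int N) * emb p) = emb q" by auto
  have "emb (xprod F ^ K * p) = Xpow F (int N) * (Xpow F (int K) * (Xpow F (- int N) * emb p))"
    by (simp add: emb_mult emb_xprod_power[OF assms(1)] mult.left_commute[of "Xpow F (int N)"])
  also have "\<dots> = emb (xprod F ^ N * q)"
    unfolding q(2) by (simp add: emb_mult emb_xprod_power[OF assms(1)])
  finally have "xprod F ^ K * p = xprod F ^ N * q" by (simp add: emb_inject)
  then show "loc_zero J F p"
    using hidealD(3)[OF assms(2) poly_ring_power[OF xprod_poly_ring[OF assms(3)]] q(1)]
    unfolding loc_zero_def by metis
qed

text \<open>The degree k is an integer for the sake of \<open>cech_coboundary\<close>, which leaves
  b unconstrained for i = 0: with k = -1 no face qualifies, and the cochain is 0 for every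
  b.\<close>

definition frac_cochain :: "nat set \<Rightarrow> int \<Rightarrow> (nat set \<Rightarrow> 'k::comm_ring_1 mpoly) \<Rightarrow> nat \<Rightarrow> 'k cochain" where
  "frac_cochain V k c N F = (if F \<subseteq> V \<and> int (card F) = k then Xpow F (- int N) * emb (c F) else 0)"

lemma frac_cochain_Cech:
  assumes "cech_cochain V i t c N"
  shows "frac_cochain V (int i) c N \<in> Cech V (poly_ring V) t (int i)"
proof (rule ccI)
  fix F assume F: "F \<subseteq> V" "int (card F) = int i"
  then have "c F \<in> poly_ring V" "homog (t + int (N * card F)) (c F)"
    using assms by (auto simp: cech_cochain_def)
  then have "Xpow F (- int N) * emb (c F) \<in> loc (poly_ring V) F t"
    by (intro emb_in_loc) (auto simp: homogen_emb)
  then show "frac_cochain V (int i) c N F \<in> loc (poly_ring V) F t" using F by (simp add: frac_cochain_def)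
qed (auto simp: frac_cochain_def)

text \<open>There are finitely many faces and every large exponent works for each of them, so their
  maximum is a common exponent N.\<close>

lemma frac_cochain_surj:
  assumes V: "finite V" and c': "c' \<in> Cech V (poly_ring V) t (int i)"
  shows "\<exists>c N. cech_cochain V i t c N \<and> c' = frac_cochain V (int i) c N"
proof -
  let ?S = "{F. F \<subseteq> V \<and> card F = i}"
  have "finite ?S" using V by (auto intro: finite_subset[of _ "Pow V"])
  have "\<exists>K0. \<forall>K\<ge>K0. \<exists>p\<in>poly_ring V. homog (t + int (K * card F)) p \<and> Xpow F (int K) * c' F = emb p" if "F \<in> ?S" for F
  proof -
    have F: "F \<subseteq> V" "c' F \<in> loc (poly_ring V) F t" using that Cech_in[OF c', of F] by auto
    show ?thesis by (rule loc_obtain_homog[OF F(2) hideal_poly_ring F(1) V]) blast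
  qed
  then obtain K0 where K0: "\<And>F K. F \<in> ?S \<Longrightarrow> K \<ge> K0 F \<Longrightarrow>
      \<exists>p\<in>poly_ring V. homog (t + int (K * card F)) p \<and> Xpow F (int K) * c' F = emb p"
    by metis
  define N where "N = Max (insert 0 (K0 ` ?S))"
  have "K0 F \<le> N" if "F \<in> ?S" for F
    using that \<open>finite ?S\<close> unfolding N_def by (intro Max_ge) auto
  then have "\<exists>p. F \<in> ?S \<longrightarrow> p \<in> poly_ring V \<and> homog (t + int (N * card F)) p \<and> Xpow F (int N) * c' F = emb p" for F
    using K0 by blast
  then obtain c where c: "\<And>F. F \<in> ?S \<Longrightarrow> c F \<in> poly_ring V \<and> homog (t + int (N * card F)) (c F) \<and> Xpow F (int N) * c' F = emb (c F)"
    by metis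
  have "cech_cochain V i t c N" using c by (auto simp: cech_cochain_def)
  moreover have "c' = frac_cochain V (int i) c N"
  proof
    fix F
    show "c' F = frac_cochain V (int i) c N F"
    proof (cases "F \<in> ?S")
      case True
      then have "Xpow F (- int N) * emb (c F) = c' F" using c[OF True] by (metis Xpow_cancel(1))
      then show ?thesis using True by (simp add: frac_cochain_def)
    next
      case False
      then show ?thesis using Cech_out[OF c', of F] by (auto simp: frac_cochain_def)
    qed
  qed
  ultimately show ?thesis by blast
qed

lemma diff_frac_cochain:
  fixes c :: "nat set \<Rightarrow> 'k::comm_ring_1 mpoly"
  assumes "finite V" "F \<subseteq> V"
  shows "diff V (frac_cochain V (int (card F) - 1) c N) F = Xpow F (- int N) * emb (cech_d c N F)"
proof -
  have fF: "finite F" using assms finite_subset by blast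
  have "pos_sign j F * frac_cochain V (int (card F) - 1) c N (F - {j})
      = Xpow F (- int N) * emb ((- 1) ^ card {v\<in>F. v < j} * c (F - {j}) * Var j ^ N)" if j: "j \<in> F" for j
  proof -
    have card: "int (card (F - {j})) = int (card F) - 1" using card.remove[OF fF j] by simp
    have emb_sign: "emb ((- 1) ^ n :: 'k mpoly) = (- 1) ^ n" for n by (simp add: emb_power emb_uminus)
    have "insert j (F - {j}) = F" using j by auto
    then have "Xpow F (- int N) = (Xpow {j} (- int N) * Xpow (F - {j}) (- int N) :: 'k lpoly)"
      using Xpow_insert[of "F - {j}" j "- int N"] fF by (metis Diff_iff finite_Diff singletonI)
    then have "Xpow F (- int N) * emb (Var j ^ N :: 'k mpoly) = Xpow (F - {j}) (- int N)"
      using Xpow_cancel(1)[of "{j}" "int N" "Xpow (F - {j}) (- int N) :: 'k lpoly"]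
      by (simp add: emb_power emb_Var Xpow_power mult_ac)
    moreover have "Xpow F (- int N) * emb ((- 1) ^ card {v\<in>F. v < j} * c (F - {j}) * Var j ^ N)
       = (- 1) ^ card {v\<in>F. v < j} * emb (c (F - {j})) * (Xpow F (- int N) * emb (Var j ^ N))"
      by (simp only: emb_mult emb_sign mult_ac)
    ultimately have "Xpow F (- int N) * emb ((- 1) ^ card {v\<in>F. v < j} * c (F - {j}) * Var j ^ N)
       = (- 1) ^ card {v\<in>F. v < j} * emb (c (F - {j})) * Xpow (F - {j}) (- int N)" by simp
    then show ?thesis
      using assms(2) card by (auto simp: frac_cochain_def pos_sign_def mult_ac)
  qed
  then show ?thesis
    using assms(2) by (simp add: diff_def cech_d_def additive_fun_sum[OF additive_emb] sum_distrib_left)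
qed

lemma cech_cocycle_iff:
  assumes V: "finite V" and J: "hideal V J" and c: "cech_cochain V i t c N"
  shows "cech_cocycle J V i c N \<longleftrightarrow> diff V (frac_cochain V (int i) c N) \<in> Cech V J t (int i + 1)"
proof -
  let ?c = "frac_cochain V (int i) c N"
  have dc: "diff V ?c \<in> Cech V (poly_ring V) t (int i + 1)"
    by (rule diff_Cech[OF hideal_poly_ring V frac_cochain_Cech[OF c]])
  have *: "loc_zero J G (cech_d c N G) \<longleftrightarrow> diff V ?c G \<in> loc J G t" if G: "G \<subseteq> V" "card G = Suc i" for G
  proof -
    have fG: "finite G" using G V finite_subset by blast
    have "homogen t (diff V ?c G)" by (rule Cech_homogen[OF dc])
    moreover have "diff V ?c G = Xpow G (- int N) * emb (cech_d c N G)"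
      using diff_frac_cochain[OF V G(1), of c N] G(2) by simp
    ultimately show ?thesis using loc_zero_iff[OF fG J G(1), of "cech_d c N G" N] by (simp add: loc_def)
  qed
  show ?thesis
  proof
    assume "cech_cocycle J V i c N"
    then show "diff V ?c \<in> Cech V J t (int i + 1)"
      using * by (intro ccI Cech_out[OF dc]) (auto simp: cech_cocycle_def)
  next
    assume "diff V ?c \<in> Cech V J t (int i + 1)"
    then show "cech_cocycle J V i c N"
      unfolding cech_cocycle_def using * Cech_in by fastforce
  qed
qed

lemma cech_coboundary_iff:
  assumes V: "finite V" and J: "hideal V J" and c: "cech_cochain V i t c N"
  shows "cech_coboundary J V i t c N \<longleftrightarrow>
    (\<exists>b\<in>Cech V (poly_ring V) t (int i - 1). frac_cochain V (int i) c N - diff V b \<in> Cech V J t (int i))"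
proof -
  let ?c = "frac_cochain V (int i) c N"
  let ?b = "\<lambda>b N'. frac_cochain V (int i - 1) b N'"
  have *: "loc_eq J F (c F) N (cech_d b N' F) N' \<longleftrightarrow> ?c F - diff V (?b b N') F \<in> loc J F t"
    if b: "?b b N' \<in> Cech V (poly_ring V) t (int i - 1)" and F: "F \<subseteq> V" "card F = i" for b N' F
  proof -
    have fF: "finite F" using F V finite_subset by blast
    have "diff V (?b b N') \<in> Cech V (poly_ring V) t (int i)"
      using diff_Cech[OF hideal_poly_ring V b] by simp
    then have homogen: "homogen t (?c F - diff V (?b b N') F)"
      by (intro homogen_diff Cech_homogen[OF frac_cochain_Cech[OF c]] Cech_homogen)
    have d: "diff V (?b b N') F = Xpow F (- int N') * emb (cech_d b N' F)"
      using diff_frac_cochain[OF V F(1), of b N'] F(2) by simp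
    \<comment> \<open>Both fractions are brought to the denominator x_F^(N + N'), where the
      difference of the numerators is the one in \<open>loc_eq\<close>.\<close>
    have 1: "Xpow F (- int N) * f = Xpow F (- int (N + N')) * (Xpow F (int N') * f)"
      and 2: "Xpow F (- int N') * f = Xpow F (- int (N + N')) * (Xpow F (int N) * f)" for f :: "'a lpoly"
      by (simp_all add: Xpow_mult flip: mult.assoc)
    have "?c F - diff V (?b b N') F = Xpow F (- int (N + N')) * (Xpow F (int N') * emb (c F)) - Xpow F (- int (N + N')) * (Xpow F (int N) * emb (cech_d b N' F))"
      unfolding d 1[symmetric] 2[symmetric] using F by (simp add: frac_cochain_def)
    also have "\<dots> = Xpow F (- int (N + N')) * emb (xprod F ^ N' * c F - xprod F ^ N * cech_d b N' F)"
      by (simp only: emb_diff emb_mult emb_xprod_power[OF fF] right_diff_distrib)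
    finally have e: "?c F - diff V (?b b N') F = \<dots>" .
    show ?thesis
      unfolding loc_eq_def loc_zero_iff[OF fF J F(1), of _ "N + N'"] e[symmetric]
      using homogen by (simp add: loc_def)
  qed
  have cdiff: "?c - diff V b \<in> Cech V J t (int i) \<longleftrightarrow> (\<forall>F. F \<subseteq> V \<and> card F = i \<longrightarrow> ?c F - diff V b F \<in> loc J F t)"
    if b: "b \<in> Cech V (poly_ring V) t (int i - 1)" for b
  proof
    assume "?c - diff V b \<in> Cech V J t (int i)"
    then show "\<forall>F. F \<subseteq> V \<and> card F = i \<longrightarrow> ?c F - diff V b F \<in> loc J F t" using Cech_in by fastforce
  next
    assume "\<forall>F. F \<subseteq> V \<and> card F = i \<longrightarrow> ?c F - diff V b F \<in> loc J F t"
    moreover have "diff V b \<in> Cech V (poly_ring V) t (int i)" using diff_Cech[OF hideal_poly_ring V b] by simp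
    ultimately show "?c - diff V b \<in> Cech V J t (int i)"
      using Cech_out[OF frac_cochain_Cech[OF c]] Cech_out[of "diff V b"] by (intro ccI) auto
  qed
  show ?thesis
  proof
    assume "cech_coboundary J V i t c N"
    then obtain b N' where b: "0 < i \<longrightarrow> cech_cochain V (i - 1) t b N'"
      "\<forall>F. F \<subseteq> V \<and> card F = i \<longrightarrow> loc_eq J F (c F) N (cech_d b N' F) N'"
      unfolding cech_coboundary_def by blast
    have bc: "?b b N' \<in> Cech V (poly_ring V) t (int i - 1)"
    proof (cases "i = 0")
      case True
      then show ?thesis by (intro ccI) (auto simp: frac_cochain_def)
    next
      case False
      then show ?thesis using frac_cochain_Cech[of V "i - 1" t b N'] b(1) by (simp add: of_nat_diff)
    qed
    then show "\<exists>b\<in>Cech V (poly_ring V) t (int i - 1). ?c - diff V b \<in> Cech V J t (int i)"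
      using cdiff[OF bc] *[OF bc] b(2) by blast
  next
    assume "\<exists>b\<in>Cech V (poly_ring V) t (int i - 1). ?c - diff V b \<in> Cech V J t (int i)"
    then obtain b' where b': "b' \<in> Cech V (poly_ring V) t (int i - 1)" "?c - diff V b' \<in> Cech V J t (int i)" by blast
    have "\<exists>b N'. (0 < i \<longrightarrow> cech_cochain V (i - 1) t b N') \<and> b' = ?b b N'"
    proof (cases "i = 0")
      case True
      then have "b' = ?b (\<lambda>_. 0) 0" using Cech_neg[OF _ b'(1)] by (auto simp: frac_cochain_def fun_eq_iff)
      then show ?thesis using True by blast
    next
      case False
      then show ?thesis using frac_cochain_surj[OF V, of b' t "i - 1"] b'(1) by (simp add: of_nat_diff)
    qed
    then obtain b N' where b: "0 < i \<longrightarrow> cech_cochain V (i - 1) t b N'" "b' = ?b b N'" by blast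
    have "loc_eq J F (c F) N (cech_d b N' F) N'" if "F \<subseteq> V" "card F = i" for F
      using *[OF b'(1)[unfolded b(2)] that] cdiff[OF b'(1)] b'(2) that unfolding b(2) by simp
    then show "cech_coboundary J V i t c N"
      unfolding cech_coboundary_def using b(1) by (intro exI[of _ b] exI[of _ N']) simp
  qed
qed

text \<open>The bridge to the given definition. It rests on every Cech cochain being a family of
  numerators over one exponent, also for the cochain that is to bound.\<close>

theorem loc_coh_nonzero_iff:
  assumes "finite V" "hideal V J"
  shows "loc_coh_nonzero V J i t \<longleftrightarrow> \<not> exact V (poly_ring V) J (int i) t"
proof
  assume "loc_coh_nonzero V J i t"
  then obtain c N where c: "cech_cochain V i t c N" "cech_cocycle J V i c N" "\<not> cech_coboundary J V i t c N"
    unfolding loc_coh_nonzero_def by blast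
  then show "\<not> exact V (poly_ring V) J (int i) t"
    unfolding exact_def exact_at_def
    using frac_cochain_Cech[OF c(1)] cech_cocycle_iff[OF assms c(1)] cech_coboundary_iff[OF assms c(1)] by blast
next
  assume "\<not> exact V (poly_ring V) J (int i) t"
  then obtain c' where c': "c' \<in> Cech V (poly_ring V) t (int i)" "diff V c' \<in> Cech V J t (int i + 1)"
    "\<not> (\<exists>b\<in>Cech V (poly_ring V) t (int i - 1). c' - diff V b \<in> Cech V J t (int i))"
    unfolding exact_def exact_at_def by blast
  obtain c N where "cech_cochain V i t c N" "c' = frac_cochain V (int i) c N"
    using frac_cochain_surj[OF assms(1) c'(1)] by blast
  then show "loc_coh_nonzero V J i t"
    unfolding loc_coh_nonzero_def using c' cech_cocycle_iff[OF assms] cech_coboundary_iff[OF assms] by metis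
qed

section \<open>Nonvanishing of local cohomology\<close>

definition mulc :: "nat \<Rightarrow> int \<Rightarrow> 'k::comm_ring_1 cochain \<Rightarrow> 'k cochain" where
  "mulc v K c = (\<lambda>F. Xpow {v} K * c F)"

lemma additive_mulc: "additive_fun (mulc v K)"
  by (rule additive_funI) (auto simp: mulc_def fun_eq_iff distrib_left)

lemma diff_mulc: "diff V (mulc v K c) = mulc v K (diff V c)"
  by (rule ext) (simp add: diff_def mulc_def sum_distrib_left mult.left_commute)

lemma mulc_mulc: "mulc v K (mulc v L c) = mulc v (K + L) c"
  by (simp add: mulc_def Xpow_mult flip: mult.assoc)

lemma mulc_0 [simp]: "mulc v 0 c = c"
  by (simp add: mulc_def)

lemma mulc_Cech_mono:
  assumes PQ: "\<And>p. p \<in> P \<Longrightarrow> Var v ^ n * p \<in> Q" and c: "c \<in> Cech V P t k"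
  shows "mulc v (int n) c \<in> Cech V Q (t + int n) k"
proof (rule ccI)
  fix F assume "F \<subseteq> V" "int (card F) = k"
  then have F: "c F \<in> loc P F t" by (rule Cech_in[OF c])
  then obtain K p where p: "p \<in> P" "Xpow F (int K) * c F = emb p" by (auto simp: loc_def)
  have "homogen (t + int n) (Xpow {v} (int n) * c F)" using homogen_Xpow_mult[OF loc_homogen[OF F], of "int n" "{v}"] by simp
  moreover have "Xpow F (int K) * (Xpow {v} (int n) * c F) = emb (Var v ^ n * p)"
    by (simp only: emb_mult emb_power emb_Var Xpow_power mult.left_commute[of "Xpow F (int K)"] p(2)) simp
  ultimately show "mulc v (int n) c F \<in> loc Q F (t + int n)"
    unfolding mulc_def by (rule locI) (rule PQ[OF p(1)])
next
  fix F assume "\<not> (F \<subseteq> V \<and> int (card F) = k)"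
  then show "mulc v (int n) c F = 0" using Cech_out[OF c] by (simp add: mulc_def)
qed

lemma mulc_Cech:
  assumes "hideal V P" "v \<in> V" "c \<in> Cech V P t k"
  shows "mulc v (int n) c \<in> Cech V P (t + int n) k"
  by (rule mulc_Cech_mono[OF _ assms(3)]) (intro hidealD(3)[OF assms(1)] poly_ring_power Var_poly_ring assms(2))

section \<open>The Cech-Koszul double complex\<close>

definition koszul :: "nat set \<Rightarrow> (nat set \<Rightarrow> 'k::comm_ring_1 cochain) \<Rightarrow> nat set \<Rightarrow> 'k cochain" where
  \<comment> \<open>The Koszul differential on families of cochains indexed by subsets G: it passes
    from subsets of size k + 1 to size k with coefficients \<plusminus> x_v, and so raises the
    internal degree by one.\<close>
  "koszul V w G = (\<Sum>v\<in>V - G. mulc v 1 (\<lambda>F. pos_sign v (insert v G) * w (insert v G) F))"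

lemma sum_fun_apply: "sum f S E = (\<Sum>x\<in>S. f x E)"
  by (induction S rule: infinite_finite_induct) auto

lemma koszul_apply: "koszul V w G F = (\<Sum>v\<in>V - G. Xpow {v} 1 * (pos_sign v (insert v G) * w (insert v G) F))"
  by (simp add: koszul_def sum_fun_apply mulc_def)

lemma koszul_Cech:
  assumes P: "hideal V P" and V: "finite V"
    and w: "\<And>v. v \<in> V - G \<Longrightarrow> w (insert v G) \<in> Cech V P (t - 1) k"
  shows "koszul V w G \<in> Cech V P t k"
  unfolding koszul_def
proof (rule add_closed_sum[OF add_closed_Cech[OF P V]])
  fix v assume v: "v \<in> V - G"
  have "(\<lambda>F. pos_sign v (insert v G) * w (insert v G) F) = w (insert v G) \<or> (\<lambda>F. pos_sign v (insert v G) * w (insert v G) F) = - w (insert v G)"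
    by (cases "even (card {u \<in> insert v G. u < v})") (auto simp: pos_sign_def fun_eq_iff)
  then have "(\<lambda>F. pos_sign v (insert v G) * w (insert v G) F) \<in> Cech V P (t - 1) k"
    using w[OF v] add_closedD(3)[OF add_closed_Cech[OF P V]] by metis
  from mulc_Cech[OF P _ this, of v 1]
  show "mulc v 1 (\<lambda>F. pos_sign v (insert v G) * w (insert v G) F) \<in> Cech V P t k" using v by simp
qed

lemma koszul_koszul:
  assumes "finite V" "G \<subseteq> V"
  shows "koszul V (koszul V w) G = 0"
proof
  fix F
  have "finite G" using assms finite_subset by blast
  have "koszul V (koszul V w) G F = (\<Sum>v\<in>V - G. \<Sum>u\<in>(V - G) - {v}. Xpow {v} 1 * (pos_sign v (insert v G) *
      (Xpow {u} 1 * (pos_sign u (insert u (insert v G)) * w (insert u (insert v G)) F))))"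
    unfolding koszul_apply sum_distrib_left by (intro sum.cong refl) auto
  also have "\<dots> = 0"
  proof (rule sum_antisym)
    fix u v assume uv: "u \<in> V - G" "v \<in> V - G" "u < v"
    then have "insert v (insert u G) = insert u (insert v G)"
      "pos_sign v (insert u (insert v G)) = (- pos_sign v (insert v G) :: 'a lpoly)"
      "pos_sign u (insert v (insert u G)) = (pos_sign u (insert u G) :: 'a lpoly)"
      using pos_sign_insert[of "insert v G" u v] pos_sign_insert[of "insert u G" v u] \<open>finite G\<close> by auto
    then show "Xpow {v} 1 * (pos_sign v (insert v G) * (Xpow {u} 1 * (pos_sign u (insert u (insert v G)) * w (insert u (insert v G)) F)))
      = - (Xpow {u} 1 * (pos_sign u (insert u G) * (Xpow {v} 1 * (pos_sign v (insert v (insert u G)) * w (insert v (insert u G)) F))))"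
      by (simp add: mult_ac)
  qed (use assms in auto)
  finally show "koszul V (koszul V w) G F = 0 F" by simp
qed

lemma koszul_diff: "koszul V (\<lambda>G. w G - w' G) G = koszul V w G - koszul V w' G"
  by (auto simp: koszul_apply fun_eq_iff sum_subtractf algebra_simps)

lemma koszul_cong: "(\<And>v. v \<in> V - G \<Longrightarrow> w (insert v G) = w' (insert v G)) \<Longrightarrow> koszul V w G = koszul V w' G"
  by (rule ext) (simp add: koszul_apply)

lemma diff_koszul: "diff V (koszul V w G) = koszul V (\<lambda>G. diff V (w G)) G"
proof
  fix F
  show "diff V (koszul V w G) F = koszul V (\<lambda>G. diff V (w G)) G F"
  proof (cases "F \<subseteq> V")
    case True
    then have "diff V (koszul V w G) F = (\<Sum>j\<in>F. \<Sum>v\<in>V - G. pos_sign j F * (Xpow {v} 1 * (pos_sign v (insert v G) * w (insert v G) (F - {j}))))"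
      by (simp add: diff_def koszul_apply sum_distrib_left)
    also have "\<dots> = (\<Sum>v\<in>V - G. \<Sum>j\<in>F. pos_sign j F * (Xpow {v} 1 * (pos_sign v (insert v G) * w (insert v G) (F - {j}))))"
      by (rule sum.swap)
    also have "\<dots> = koszul V (\<lambda>G. diff V (w G)) G F"
      using True by (simp add: diff_def koszul_apply sum_distrib_left mult.left_commute)
    finally show ?thesis .
  qed (simp add: diff_def koszul_apply)
qed

definition diag_cochain :: "nat set \<Rightarrow> 'k::comm_ring_1 cochain" where
  "diag_cochain G = single_cochain G (Xpow G (- 1))"

text \<open>Both sides have the entry \<plusminus> 1/x_G on the faces G + v and are zero elsewhere:
  the Cech map keeps the fraction 1/x_G, and the Koszul map multiplies 1/x_(G+v) by x_v.\<close>

lemma diff_diag_cochain: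
  assumes V: "finite V" and G: "G \<subseteq> V"
  shows "diff V (diag_cochain G :: 'k::comm_ring_1 cochain) = koszul V diag_cochain G"
proof
  fix F
  have fG: "finite G" using V G finite_subset by blast
  have "Xpow {v} 1 * (pos_sign v (insert v G) * diag_cochain (insert v G) F) = (if F = insert v G then pos_sign v F * Xpow G (- 1) else (0 :: 'k lpoly))"
    if "v \<in> V - G" for v
  proof -
    have "Xpow {v} 1 * Xpow (insert v G) (- 1) = (Xpow G (- 1) :: 'k lpoly)"
      using that fG by (subst Xpow_insert) (auto simp: Xpow_mult simp flip: mult.assoc)
    then show ?thesis by (simp add: diag_cochain_def single_cochain_def mult.left_commute[of "Xpow {v} 1"])
  qed
  then have k: "koszul V diag_cochain G F = (\<Sum>v\<in>V - G. if F = insert v G then pos_sign v F * Xpow G (- 1) else (0 :: 'k lpoly))"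
    unfolding koszul_apply by (intro sum.cong refl)
  show "diff V (diag_cochain G) F = (koszul V diag_cochain G F :: 'k lpoly)"
  proof (cases "F \<subseteq> V")
    case True
    then have fF: "finite F" using V finite_subset by blast
    have "diff V (diag_cochain G) F = (\<Sum>j\<in>F. if F - {j} = G then pos_sign j F * Xpow G (- 1) else (0 :: 'k lpoly))"
      using True by (auto simp: diff_def diag_cochain_def single_cochain_def intro!: sum.cong)
    also have "\<dots> = (\<Sum>j | j \<in> F \<and> F - {j} = G. pos_sign j F * Xpow G (- 1))"
      using fF by (simp add: sum.inter_filter)
    also have "{j. j \<in> F \<and> F - {j} = G} = {v. v \<in> V - G \<and> F = insert v G}" using True by auto
    also have "(\<Sum>v | v \<in> V - G \<and> F = insert v G. pos_sign v F * Xpow G (- 1)) = (koszul V diag_cochain G F :: 'k lpoly)"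
      unfolding k using V by (subst sum.inter_filter) auto
    finally show ?thesis .
  next
    case False
    then have "koszul V diag_cochain G F = (0 :: 'k lpoly)" unfolding k using G by (intro sum.neutral) auto
    then show ?thesis using False by (simp add: diff_def)
  qed
qed

text \<open>If all the cohomology groups below vanish, then a zigzag through the Cech-Koszul double
  complex, from the family 1/x_G in the diagonal down to the element 1 in the corner, shows
  that 1 vanishes.\<close>
theorem exists_not_exact:
  fixes J :: "'k::comm_ring_1 mpoly set"
  assumes V: "finite V" and J: "hideal V J" and one: "1 \<notin> J"
  shows "\<exists>k. \<not> exact V (poly_ring V) J (int k) (- int k)"
proof (rule ccontr)
  let ?S = "poly_ring V"
  assume "\<not> ?thesis"
  then have ex: "exact V ?S J (int k) (- int k)" for k by blast
  have S: "hideal V ?S" by (rule hideal_poly_ring)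
  \<comment> \<open>One stage of the zigzag: on subsets of size k the diagonal family is, modulo J,
    a Koszul image of w' plus a Cech boundary of w.\<close>
  let ?P = "\<lambda>k. \<exists>w w'. (\<forall>G. G \<subseteq> V \<and> card G = k \<longrightarrow> w G \<in> Cech V ?S (- int k) (int k - 1)) \<and>
     (\<forall>G. G \<subseteq> V \<and> card G = Suc k \<longrightarrow> w' G \<in> Cech V ?S (- int k - 1) (int k)) \<and>
     (\<forall>G. G \<subseteq> V \<and> card G = k \<longrightarrow> diag_cochain G - koszul V w' G - diff V (w G) \<in> Cech V J (- int k) (int k))"
  have "?P 0"
  \<comment> \<open>The descent starts at card V + 1, where there are no subsets G and the claim is
    vacuous.\<close>
  proof (rule inc_induct[of 0 "Suc (card V)" ?P])
    have "card G \<noteq> Suc (card V)" "card G \<noteq> Suc (Suc (card V))" if "G \<subseteq> V" for G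
      using card_mono[OF V that] by auto
    then show "?P (Suc (card V))" by blast
  next
    fix k assume P: "?P (Suc k)"
    have k: "- int (Suc k) = - int k - 1" "int (Suc k) = int k + 1" "int k + 1 - 1 = int k" "- (int k + 1) = - int k - 1" by simp_all
    from P[unfolded k] obtain w1 w2
      where W: "\<forall>G. G \<subseteq> V \<and> card G = Suc k \<longrightarrow> w1 G \<in> Cech V ?S (- int k - 1) (int k)"
        "\<forall>G. G \<subseteq> V \<and> card G = Suc k \<longrightarrow>
          diag_cochain G - koszul V w2 G - diff V (w1 G) \<in> Cech V J (- int k - 1) (int k + 1)"
      by (elim exE conjE) (rule that)
    have w1: "w1 G \<in> Cech V ?S (- int k - 1) (int k)" if "G \<subseteq> V" "card G = Suc k" for G
      using W(1) that by simp
    have r: "diag_cochain G - koszul V w2 G - diff V (w1 G) \<in> Cech V J (- int k - 1) (int k + 1)"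
      if "G \<subseteq> V" "card G = Suc k" for G
      using W(2) that by simp
    have "\<exists>w. w \<in> Cech V ?S (- int k) (int k - 1) \<and>
        diag_cochain G - koszul V w1 G - diff V w \<in> Cech V J (- int k) (int k)"
      if G: "G \<subseteq> V" "card G = k" for G
    proof -
      have fG: "finite G" using G V finite_subset by blast
      have ins: "insert v G \<subseteq> V" "card (insert v G) = Suc k" if "v \<in> V - G" for v
        using that G fG by auto
      let ?u = "diag_cochain G - koszul V w1 G"
      have "Xpow G (- 1) * emb 1 \<in> loc ?S G (- int k)"
        by (rule emb_in_loc) (use homogen_emb[of 0 1] in \<open>auto simp: G homog_def mon_deg_def\<close>)
      then have "diag_cochain G \<in> Cech V ?S (- int k) (int k)"
        unfolding diag_cochain_def using G by (intro single_cochain_Cech[OF S _ _ _ V]) auto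
      moreover have "koszul V w1 G \<in> Cech V ?S (- int k) (int k)"
        using ins by (intro koszul_Cech[OF S V] w1)
      ultimately have u: "?u \<in> Cech V ?S (- int k) (int k)" by (rule add_closedD(4)[OF add_closed_Cech[OF S V]])
      \<comment> \<open>The differential of ?u is the Koszul image of the previous remainders,
        because the Koszul map commutes with d and squares to zero. The remainders lie over J, so ?u
        is a cycle modulo J and exactness yields the next w.\<close>
      have "diff V ?u = koszul V (\<lambda>G. diag_cochain G - diff V (w1 G)) G"
        by (simp add: additive_fun_minus[OF additive_diff] diff_diag_cochain[OF V G(1)] diff_koszul koszul_diff)
      also have "\<dots> = koszul V (\<lambda>G. diag_cochain G - koszul V w2 G - diff V (w1 G)) G"
        using koszul_koszul[OF V G(1), of w2] koszul_diff[of V "\<lambda>G. diag_cochain G - diff V (w1 G)" "koszul V w2" G]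
        by (simp add: algebra_simps)
      also have "\<dots> \<in> Cech V J (- int k) (int k + 1)"
        using ins by (intro koszul_Cech[OF J V] r)
      finally show ?thesis
        using ex[of k] u unfolding exact_def exact_at_def by blast
    qed
    then obtain w where "\<And>G. G \<subseteq> V \<Longrightarrow> card G = k \<Longrightarrow> w G \<in> Cech V ?S (- int k) (int k - 1) \<and>
        diag_cochain G - koszul V w1 G - diff V (w G) \<in> Cech V J (- int k) (int k)"
      by metis
    then show "?P k" using w1 by blast
  qed simp
  then obtain w w'
    where W: "\<forall>G. G \<subseteq> V \<and> card G = 0 \<longrightarrow> w G \<in> Cech V ?S (- int 0) (int 0 - 1)"
      "\<forall>G. G \<subseteq> V \<and> card G = Suc 0 \<longrightarrow> w' G \<in> Cech V ?S (- int 0 - 1) (int 0)"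
      "\<forall>G. G \<subseteq> V \<and> card G = 0 \<longrightarrow> diag_cochain G - koszul V w' G - diff V (w G) \<in> Cech V J (- int 0) (int 0)"
    by (elim exE conjE) (rule that)
  have w: "w {} \<in> Cech V ?S 0 (- 1)" using W(1)[rule_format, of "{}"] by simp
  have w': "w' G \<in> Cech V ?S (- 1) 0" if "G \<subseteq> V" "card G = 1" for G
    using W(2)[rule_format, of G] that by simp
  have *: "diag_cochain {} - koszul V w' {} - diff V (w {}) \<in> Cech V J 0 0"
    using W(3)[rule_format, of "{}"] by simp
  \<comment> \<open>In cohomological degree 0 the only face is the empty one, so the entry is a
    polynomial; its internal degree is -1.\<close>
  have "w' G = 0" if "G \<subseteq> V" "card G = 1" for G
  proof
    fix F
    show "w' G F = 0 F"
    proof (cases "F = {}")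
      case True
      have "w' G F \<in> loc ?S F (- 1)" using Cech_in[OF w'[OF that], of F] True by simp
      then obtain p where p: "w' G F = emb p" "homogen (- 1) (emb p)" using True by (auto simp: loc_def)
      then have "emb p = 0"
        by (auto simp: homogen_def keys_emb deg_toint simp flip: keys_eq_empty)
      then show ?thesis using p by simp
    next
      case False
      then have "\<not> (F \<subseteq> V \<and> int (card F) = 0)" using V finite_subset[of F V] by auto
      then show ?thesis using Cech_out[OF w'[OF that]] by simp
    qed
  qed
  then have "koszul V w' {} = koszul V (\<lambda>_. 0) {}" by (intro koszul_cong) auto
  also have "\<dots> = 0" by (rule ext) (simp add: koszul_apply)
  finally have "diag_cochain {} \<in> Cech V J 0 0"
    using * Cech_neg[OF _ w] by (simp add: additive_fun_0[OF additive_diff])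
  then have "(1 :: 'k lpoly) \<in> loc J {} 0"
    using Cech_in[of "diag_cochain {}" V J 0 0 "{}"] by (simp add: diag_cochain_def single_cochain_def)
  then obtain p where "p \<in> J" "emb p = 1" by (auto simp: loc_def)
  then show False using one emb_inject[of p 1] by simp
qed

section \<open>Vanishing in large degrees\<close>

lemma nat_seq_mono_subseq:
  fixes s :: "nat \<Rightarrow> nat"
  shows "\<exists>\<psi> :: nat \<Rightarrow> nat. strict_mono \<psi> \<and> (\<forall>m n. m \<le> n \<longrightarrow> s (\<psi> m) \<le> s (\<psi> n))"
proof -
  obtain f where f: "strict_mono f" "monoseq (\<lambda>n. s (f n))" using seq_monosub by blast
  show ?thesis
  proof (cases "\<forall>m n. m \<le> n \<longrightarrow> s (f m) \<le> s (f n)")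
    case True
    show ?thesis by (intro exI[of _ f] conjI f(1) True)
  next
    case False
    then have dec: "\<And>m n. m \<le> n \<Longrightarrow> s (f n) \<le> s (f m)"
      using f(2) unfolding monoseq_def by blast
    obtain N where N: "\<And>n. s (f N) \<le> s (f n)"
      using ex_has_least_nat[of "\<lambda>_. True" 0 "\<lambda>n. s (f n)"] by blast
    have "strict_mono (\<lambda>n. f (n + N))" using f(1) by (simp add: strict_mono_def)
    \<comment> \<open>A decreasing sequence of naturals is constant from the index of its minimum
      on.\<close>
    moreover have "s (f (n + N)) = s (f N)" for n using N dec[of N "n + N"] by (simp add: antisym)
    ultimately show ?thesis by (metis order_refl)
  qed
qed

text \<open>One coordinate at a time: the subsequence found for V is thinned out once more for
  v.\<close>

lemma dickson:
  fixes f :: "nat \<Rightarrow> 'a \<Rightarrow> nat"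
  assumes "finite V"
  shows "\<exists>\<phi> :: nat \<Rightarrow> nat. strict_mono \<phi> \<and> (\<forall>v\<in>V. \<forall>m n. m \<le> n \<longrightarrow> f (\<phi> m) v \<le> f (\<phi> n) v)"
  using assms
proof (induction V rule: finite_induct)
  case empty
  show ?case by (rule exI[of _ id]) (simp add: strict_mono_def)
next
  case (insert v V)
  then obtain \<phi> :: "nat \<Rightarrow> nat" where \<phi>: "strict_mono \<phi>" "\<And>v m n. v \<in> V \<Longrightarrow> m \<le> n \<Longrightarrow> f (\<phi> m) v \<le> f (\<phi> n) v" by blast
  obtain \<psi> :: "nat \<Rightarrow> nat" where \<psi>: "strict_mono \<psi>" "\<And>m n. m \<le> n \<Longrightarrow> f (\<phi> (\<psi> m)) v \<le> f (\<phi> (\<psi> n)) v"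
    using nat_seq_mono_subseq[of "\<lambda>n. f (\<phi> n) v"] by blast
  have "strict_mono (\<lambda>n. \<phi> (\<psi> n))" using \<phi>(1) \<psi>(1) by (simp add: strict_mono_def)
  moreover have "f (\<phi> (\<psi> m)) u \<le> f (\<phi> (\<psi> n)) u" if "u \<in> insert v V" "m \<le> n" for u m n
    using that \<phi>(2)[of u "\<psi> m" "\<psi> n"] \<psi> by (auto simp: strict_mono_less_eq)
  ultimately show ?case by blast
qed

lemma lookup_le_deg: "lookup m v \<le> deg (m :: 'a \<Rightarrow>\<^sub>0 nat)"
proof (cases "v \<in> keys m")
  case True
  then show ?thesis unfolding deg_def lext_def by (intro member_le_sum) auto
qed (simp add: in_keys_iff)

lemma finite_monomials:
  assumes "finite V"
  shows "finite {m :: 'a \<Rightarrow>\<^sub>0 nat. keys m \<subseteq> V \<and> deg m = d}"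
proof (rule finite_imageD)
  have "lookup ` {m :: 'a \<Rightarrow>\<^sub>0 nat. keys m \<subseteq> V \<and> deg m = d}
      \<subseteq> {f. \<forall>x. (x \<in> V \<longrightarrow> f x \<in> {..d}) \<and> (x \<notin> V \<longrightarrow> f x = 0)}"
    using lookup_le_deg by (auto simp: in_keys_iff)
  moreover have "finite {f. \<forall>x. (x \<in> V \<longrightarrow> f x \<in> {..d}) \<and> (x \<notin> V \<longrightarrow> f x = 0)}"
    using assms by (intro finite_set_of_finite_funs) auto
  ultimately show "finite (lookup ` {m :: 'a \<Rightarrow>\<^sub>0 nat. keys m \<subseteq> V \<and> deg m = d})"
    by (rule finite_subset)
  show "inj_on lookup {m :: 'a \<Rightarrow>\<^sub>0 nat. keys m \<subseteq> V \<and> deg m = d}"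
    by (rule inj_onI) (simp add: lookup_inject)
qed

lemma lookup_single_mult:
  fixes p :: "('a::cancel_comm_monoid_add) \<Rightarrow>\<^sub>0 'k::comm_ring_1"
  shows "lookup (single u 1 * p) (u + k) = lookup p k"
  by (induction p rule: poly_mapping_single_induct)
    (auto simp: distrib_left lookup_add mult_single lookup_single when_def)

text \<open>Gordan's proof: pick in each step of an ascending chain a new homogeneous element with
  minimal leading monomial; by Dickson's lemma one of these leading monomials divides a later one.\<close>
lemma wf_hideal:
  assumes V: "finite V"
  shows "wf {(J', J :: 'k::field mpoly set). hideal V J \<and> hideal V J' \<and> J \<subset> J'}"
  unfolding wf_iff_no_infinite_down_chain
proof
  assume "\<exists>J. \<forall>i. (J (Suc i), J i) \<in> {(J', J :: 'k mpoly set). hideal V J \<and> hideal V J' \<and> J \<subset> J'}"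
  then obtain J :: "nat \<Rightarrow> 'k mpoly set" where J: "\<And>i. hideal V (J i)" "\<And>i. J i \<subset> J (Suc i)" by blast
  define new where "new i d g \<longleftrightarrow> g \<in> J (Suc i) \<and> g \<notin> J i \<and> homogen d g" for i and d :: nat and g
  have nz: "g \<noteq> 0" if "new i d g" for i d g
    using that add_closedD(1)[OF hidealD(2)[OF J(1)]] by (auto simp: new_def)
  have keys: "m \<in> {m. keys m \<subseteq> V \<and> deg m = d}" if "new i d g" "m \<in> keys g" for i d g m
    using that hidealD(1)[OF J(1), of "Suc i"] by (auto simp: new_def homogen_def poly_ring_def)
  have Max_in: "Max (keys g) \<in> keys g" if "new i d g" for i d g
    using nz[OF that] by (intro Max_in) auto
  have "\<exists>d f. new i d f \<and> (\<forall>g. new i d g \<longrightarrow> Max (keys f) \<le> Max (keys g))" for i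
  proof -
    obtain p where p: "p \<in> J (Suc i)" "p \<notin> J i" using J(2)[of i] by blast
    have "\<exists>d. hcomp d p \<notin> J i"
    proof (rule ccontr)
      assume "\<not> ?thesis"
      then have "(\<Sum>d\<in>deg ` keys p. hcomp d p) \<in> J i"
        by (intro add_closed_sum[OF hidealD(2)[OF J(1)]]) auto
      then show False using p(2) by (simp add: sum_hcomp_keys)
    qed
    then obtain d where d: "hcomp d p \<notin> J i" by blast
    \<comment> \<open>In a fixed degree there are finitely many monomials over V, so a smallest
      leading monomial exists whether or not the order on all monomials is well-founded.\<close>
    let ?M = "{Max (keys g) | g. new i d g}"
    have "?M \<subseteq> {m. keys m \<subseteq> V \<and> deg m = d}" using keys Max_in by blast
    then have fin: "finite ?M" using finite_monomials[OF V] finite_subset by blast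
    have "new i d (hcomp d p)" using p(1) d hidealD(4)[OF J(1)] by (simp add: new_def)
    then have "?M \<noteq> {}" by blast
    from Min_in[OF fin this] obtain f where f: "new i d f" "Max (keys f) = Min ?M" by auto
    have "Max (keys f) \<le> Max (keys g)" if "new i d g" for g
      unfolding f(2) using that by (intro Min_le[OF fin]) blast
    then show ?thesis using f(1) by blast
  qed
  then obtain d f where f: "\<And>i. new i (d i) (f i)"
    and min: "\<And>i g. new i (d i) g \<Longrightarrow> Max (keys (f i)) \<le> Max (keys g)"
    by metis
  define m where "m i = Max (keys (f i))" for i
  have m: "m i \<in> keys (f i)" for i unfolding m_def by (rule Max_in[OF f])
  obtain \<phi> :: "nat \<Rightarrow> nat" where \<phi>: "strict_mono \<phi>"
    "\<And>v a b. v \<in> V \<Longrightarrow> a \<le> b \<Longrightarrow> lookup (m (\<phi> a)) v \<le> lookup (m (\<phi> b)) v"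
    using dickson[OF V, of "\<lambda>i. lookup (m i)"] by blast
  define i j where "i = \<phi> 0" and "j = \<phi> 1"
  have ij: "i < j" using \<phi>(1) by (simp add: i_def j_def strict_mono_less)
  define u where "u = m j - m i"
  have mV: "keys (m i) \<subseteq> V" for i using keys[OF f m] by blast
  have u: "u + m i = m j"
  proof (rule poly_mapping_eqI)
    fix v
    have "lookup (m i) v \<le> lookup (m j) v"
    proof (cases "v \<in> V")
      case True
      then show ?thesis using \<phi>(2)[of v 0 1] by (simp add: i_def j_def)
    next
      case False
      then have "v \<notin> keys (m i)" using mV by blast
      then show ?thesis by (simp add: in_keys_iff)
    qed
    then show "lookup (u + m i) v = lookup (m j) v"
      by (simp add: u_def lookup_add lookup_minus)
  qed
  have uV: "keys u \<subseteq> V"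
  proof
    fix v assume "v \<in> keys u"
    then have "v \<in> keys (m j)" by (auto simp: in_keys_iff u_def lookup_minus)
    then show "v \<in> V" using mV by blast
  qed
  \<comment> \<open>Because i < j, a multiple of \<open>f i\<close> already lies in
    \<open>J j\<close>, so subtracting it from \<open>f j\<close> leaves an element that is still
    new at stage j.\<close>
  have sub: "J (Suc i) \<subseteq> J j"
    by (rule lift_Suc_mono_le[of J]) (use J(2) ij in auto)
  define g where "g = single u (1::'k) * f i"
  have "g \<in> J (Suc i)"
    unfolding g_def using uV f[of i] by (intro hidealD(3)[OF J(1)]) (auto simp: poly_ring_def new_def)
  then have gJ: "g \<in> J j" using sub by blast
  have "homogen (deg u + d i) g"
    unfolding g_def using f[of i] by (intro homogen_mult) (auto simp: homogen_single new_def)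
  moreover have "deg u + d i = d j"
    using keys[OF f m[of i]] keys[OF f m[of j]] deg_add[of u "m i"] u by simp
  ultimately have homogen: "homogen (d j) g" by simp
  \<comment> \<open>Chosen so that the terms at \<open>m j\<close> cancel. The difference h is new
    in the same degree and has a smaller leading monomial, against the minimality of
    \<open>f j\<close>.\<close>
  define c where "c = lookup (f j) (m j) / lookup (f i) (m i)"
  define h where "h = f j - single 0 c * g"
  have cg: "single 0 c * g \<in> J j" by (intro hidealD(3)[OF J(1)] gJ) (auto simp: poly_ring_def)
  have "h \<in> J (Suc j)"
    unfolding h_def using f[of j] cg J(2)[of j] by (intro add_closedD(4)[OF hidealD(2)[OF J(1)]]) (auto simp: new_def)
  moreover have "h \<notin> J j"
  proof
    assume "h \<in> J j"
    then have "h + single 0 c * g \<in> J j" using cg by (rule add_closedD(2)[OF hidealD(2)[OF J(1)]])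
    then show False using f[of j] by (simp add: h_def new_def)
  qed
  moreover have "homogen (d j) h"
    unfolding h_def using f[of j] homogen homogen_mult[of 0 "single 0 c" "d j" g]
    by (intro homogen_diff) (auto simp: homogen_single new_def)
  ultimately have h: "new j (d j) h" by (simp add: new_def)
  have "lookup g (m j) = lookup (f i) (m i)"
    unfolding g_def u[symmetric] by (rule lookup_single_mult)
  moreover have "lookup (single 0 c * g) k = c * lookup g k" for k
    by (induction g rule: poly_mapping_single_induct)
      (auto simp: distrib_left lookup_add mult_single lookup_single when_def)
  ultimately have "lookup h (m j) = 0"
    using m[of i] by (simp add: h_def lookup_minus c_def in_keys_iff)
  then have notin: "m j \<notin> keys h" by (simp add: in_keys_iff)
  have le: "k \<le> m j" if "k \<in> keys h" for k
  proof -
    have "k \<in> keys (f j) \<or> k \<in> keys (single 0 c * g)"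
      using that keys_diff[of "f j" "single 0 c * g"] by (auto simp: h_def)
    then show ?thesis
    proof
      assume "k \<in> keys (f j)" then show ?thesis unfolding m_def by (intro Max_ge) auto
    next
      assume "k \<in> keys (single 0 c * g)"
      then have "k \<in> keys g" using keys_mult[of "single 0 c" g] by (auto split: if_splits)
      then obtain b where "b \<in> keys (f i)" "k = u + b"
        unfolding g_def using keys_mult[of "single u 1" "f i"] by auto
      moreover then have "b \<le> m i" unfolding m_def by (intro Max_ge) auto
      ultimately show ?thesis unfolding u[symmetric] by (simp add: add_left_mono)
    qed
  qed
  have "Max (keys h) \<in> keys h" by (rule Max_in[OF h])
  then have "Max (keys h) < m j" using le notin by (metis order_le_imp_less_or_eq)
  then show False using min[OF h] by (simp add: m_def)
qed

section \<open>Adjoining a variable, colon ideals and multiplication by a variable\<close>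

definition var_ideal :: "nat set \<Rightarrow> nat \<Rightarrow> 'k::comm_ring_1 mpoly set" where
  "var_ideal V v = {Var v * p | p. p \<in> poly_ring V}"

definition var_colon :: "nat set \<Rightarrow> 'k::comm_ring_1 mpoly set \<Rightarrow> nat \<Rightarrow> 'k mpoly set" where
  "var_colon V J v = {p \<in> poly_ring V. Var v * p \<in> J}"

lemma homogen_Var: "homogen 1 (Var v)"
  by (simp add: Var_def homogen_single)

lemma hideal_var_ideal:
  assumes "v \<in> V" shows "hideal V (var_ideal V v :: 'k::comm_ring_1 mpoly set)"
proof (rule hidealI)
  note ac = add_closedD[OF add_closed_poly_ring[of V]]
  show "var_ideal V v \<subseteq> (poly_ring V :: 'k mpoly set)"
    unfolding var_ideal_def using poly_ring_mult Var_poly_ring[OF assms] by blast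
  show "add_closed (var_ideal V v :: 'k mpoly set)"
    unfolding add_closed_def
  proof (intro conjI ballI)
    have "(0 :: 'k mpoly) = Var v * 0" by simp
    then show "(0 :: 'k mpoly) \<in> var_ideal V v" unfolding var_ideal_def using ac(1) by blast
    fix x :: "'k mpoly" assume "x \<in> var_ideal V v"
    then obtain p where x: "x = Var v * p" "p \<in> poly_ring V" by (auto simp: var_ideal_def)
    then have "- x = Var v * (- p)" by simp
    then show "- x \<in> var_ideal V v" unfolding var_ideal_def using ac(3)[OF x(2)] by blast
    fix y :: "'k mpoly" assume "y \<in> var_ideal V v"
    then obtain q where y: "y = Var v * q" "q \<in> poly_ring V" by (auto simp: var_ideal_def)
    have "x + y = Var v * (p + q)" using x y by (simp add: distrib_left)
    then show "x + y \<in> var_ideal V v" unfolding var_ideal_def using ac(2)[OF x(2) y(2)] by blast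
  qed
  fix w :: "'k mpoly" assume "w \<in> var_ideal V v"
  then obtain p where p: "w = Var v * p" "p \<in> poly_ring V" by (auto simp: var_ideal_def)
  show "u * w \<in> var_ideal V v" if "u \<in> poly_ring V" for u
  proof -
    have "u * w = Var v * (u * p)" by (simp add: p(1) mult.left_commute)
    then show ?thesis unfolding var_ideal_def using poly_ring_mult[OF that p(2)] by blast
  qed
  show "hcomp d w \<in> var_ideal V v" for d
  proof -
    have "hcomp d w = Var v * (if 1 \<le> d then hcomp (d - 1) p else 0)"
      using hcomp_mult_nat[OF homogen_Var, of d v p] by (simp add: p(1))
    moreover have "(if 1 \<le> d then hcomp (d - 1) p else 0) \<in> poly_ring V" by (simp add: hcomp_poly_ring[OF p(2)] ac(1))
    ultimately show ?thesis unfolding var_ideal_def by blast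
  qed
qed

lemma hideal_var_colon:
  assumes "hideal V J" "v \<in> V" shows "hideal V (var_colon V J v)"
proof (rule hidealI)
  note ac = add_closedD[OF add_closed_poly_ring[of V]] and acJ = add_closedD[OF hidealD(2)[OF assms(1)]]
  show "var_colon V J v \<subseteq> poly_ring V" by (auto simp: var_colon_def)
  show "add_closed (var_colon V J v)" by (auto simp: add_closed_def var_colon_def ac acJ distrib_left)
  fix p assume p: "p \<in> var_colon V J v"
  show "u * p \<in> var_colon V J v" if "u \<in> poly_ring V" for u
    using p that hidealD(3)[OF assms(1) that, of "Var v * p"]
    by (auto simp: var_colon_def mult.left_commute intro: poly_ring_mult)
  show "hcomp d p \<in> var_colon V J v" for d
    using p hidealD(4)[OF assms(1), of "Var v * p" "1 + d"]
    unfolding var_colon_def hcomp_mult_homogen[OF homogen_Var] by (simp add: hcomp_poly_ring)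
qed

lemma Cech_var_ideal:
  assumes "h \<in> Cech V (var_ideal V v) t k"
  shows "\<exists>c\<in>Cech V (poly_ring V) (t - 1) k. h = mulc v 1 c"
proof
  show "h = mulc v 1 (mulc v (- 1) h)" by (simp add: mulc_mulc)
  show "mulc v (- 1) h \<in> Cech V (poly_ring V) (t - 1) k"
  proof (rule ccI)
    fix F assume "F \<subseteq> V" "int (card F) = k"
    then have F: "h F \<in> loc (var_ideal V v) F t" by (rule Cech_in[OF assms])
    then obtain K p where p: "p \<in> poly_ring V" "Xpow F (int K) * h F = emb (Var v * p)"
      by (auto simp: loc_def var_ideal_def)
    have "Xpow F (int K) * (Xpow {v} (- 1) * h F) = Xpow {v} (- 1) * (Xpow F (int K) * h F)" by (rule mult.left_commute)
    also have "\<dots> = emb p" unfolding p(2) by (simp add: emb_mult emb_Var)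
    finally show "mulc v (- 1) h F \<in> loc (poly_ring V) F (t - 1)"
      unfolding mulc_def using p(1) homogen_Xpow_mult[OF loc_homogen[OF F], of "- 1" "{v}"]
      by (intro locI[where p = p and K = K]) auto
  next
    fix F assume "\<not> (F \<subseteq> V \<and> int (card F) = k)"
    then show "mulc v (- 1) h F = 0" using Cech_out[OF assms] by (simp add: mulc_def)
  qed
qed

lemma Cech_var_colon:
  assumes V: "finite V" and J: "hideal V J" and c: "c \<in> Cech V (poly_ring V) t k" and m: "mulc v 1 c \<in> Cech V J (t + 1) k"
  shows "c \<in> Cech V (var_colon V J v) t k"
proof (rule ccI)
  fix F assume F: "F \<subseteq> V" "int (card F) = k"
  obtain K p q where pq: "p \<in> poly_ring V" "q \<in> J" "Xpow F (int K) * c F = emb p" "Xpow F (int K) * mulc v 1 c F = emb q"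
    by (rule loc_obtain2[OF V V hideal_poly_ring F(1) Cech_in[OF c F] J F(1) Cech_in[OF m F]])
  have "emb (Var v * p) = Xpow F (int K) * mulc v 1 c F"
    by (simp only: emb_mult emb_Var pq(3)[symmetric] mulc_def mult_ac)
  then have "Var v * p = q" using pq(4) by (simp add: emb_inject)
  then show "c F \<in> loc (var_colon V J v) F t"
    using pq loc_homogen[OF Cech_in[OF c F]] by (intro locI[where p = p and K = K]) (auto simp: var_colon_def)
qed (rule Cech_out[OF c])

lemma mulc_var_colon: "c \<in> Cech V (var_colon V J v) t k \<Longrightarrow> mulc v 1 c \<in> Cech V J (t + 1) k"
  using mulc_Cech_mono[of "var_colon V J v" v 1 J] by (simp add: var_colon_def)

lemma psum_sub:
  assumes "hideal V P" "hideal V Q"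
  shows "P \<subseteq> psum P Q" "Q \<subseteq> psum P Q"
  using add_closedD(1)[OF hidealD(2)[OF assms(1)]] add_closedD(1)[OF hidealD(2)[OF assms(2)]]
  by (force simp: psum_mem)+

lemma Cech_psum_var:
  assumes "hideal V J" "v \<in> V" "c \<in> Cech V (psum J (var_ideal V v)) t k"
  obtains g c' where "g \<in> Cech V J t k" "c' \<in> Cech V (poly_ring V) (t - 1) k" "c = g + mulc v 1 c'"
  using Cech_psum[OF assms(1) hideal_var_ideal[OF assms(2)] assms(3)] Cech_var_ideal by blast

lemma mulc_var_ideal: "c \<in> Cech V (poly_ring V) t k \<Longrightarrow> mulc v 1 c \<in> Cech V (var_ideal V v) (t + 1) k"
  by (rule mulc_Cech_mono[of "poly_ring V" v 1 "var_ideal V v", simplified]) (auto simp: var_ideal_def)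

text \<open>Multiplication by x_v identifies S/(J : x_v), shifted by one degree, with (J, x_v)/J;
  hence the degree t - 1 in the hypothesis.\<close>

lemma exact_psum_var:
  assumes V: "finite V" and J: "hideal V J" and v: "v \<in> V"
    and ex: "exact V (poly_ring V) (var_colon V J v) k (t - 1)"
  shows "exact V (psum J (var_ideal V v)) J k t"
  unfolding exact_def exact_at_def
proof (intro ballI impI)
  fix c assume c: "c \<in> Cech V (psum J (var_ideal V v)) t k" and dc: "diff V c \<in> Cech V J t (k + 1)"
  note acJ = add_closedD[OF add_closed_Cech[OF J V]]
  obtain g c' where g: "g \<in> Cech V J t k" "c' \<in> Cech V (poly_ring V) (t - 1) k" "c = g + mulc v 1 c'"
    by (rule Cech_psum_var[OF J v c])
  have "diff V c - diff V g \<in> Cech V J t (k + 1)" by (rule acJ(4)[OF dc diff_Cech[OF J V g(1)]])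
  then have "mulc v 1 (diff V c') \<in> Cech V J (t - 1 + 1) (k + 1)"
    by (simp add: g(3) additive_fun_add[OF additive_diff] diff_mulc)
  then have "diff V c' \<in> Cech V (var_colon V J v) (t - 1) (k + 1)"
    by (rule Cech_var_colon[OF V J diff_Cech[OF hideal_poly_ring V g(2)]])
  then obtain b where b: "b \<in> Cech V (poly_ring V) (t - 1) (k - 1)" "c' - diff V b \<in> Cech V (var_colon V J v) (t - 1) k"
    using ex g(2) unfolding exact_def exact_at_def by blast
  have "mulc v 1 (c' - diff V b) \<in> Cech V J t k" using mulc_var_colon[OF b(2)] by simp
  then have "g + mulc v 1 (c' - diff V b) \<in> Cech V J t k" by (rule acJ(2)[OF g(1)])
  also have "g + mulc v 1 (c' - diff V b) = c - diff V (mulc v 1 b)"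
    by (simp add: g(3) diff_mulc additive_fun_minus[OF additive_mulc])
  finally have "c - diff V (mulc v 1 b) \<in> Cech V J t k" .
  moreover have "mulc v 1 b \<in> Cech V (psum J (var_ideal V v)) t (k - 1)"
    using mulc_var_ideal[OF b(1), of v] Cech_mono[OF psum_sub(2)[OF J hideal_var_ideal[OF v]]] by auto
  ultimately show "\<exists>b\<in>Cech V (psum J (var_ideal V v)) t (k - 1). c - diff V b \<in> Cech V J t k" by blast
qed

text \<open>Multiplication by a variable x with J : x = J is injective on cohomology in degrees where
  the cohomology of S/(J, x) vanishes.\<close>
lemma coboundary_of_mulc_coboundary:
  assumes V: "finite V" and J: "hideal V J" and v: "v \<in> V" and nzd: "var_colon V J v = J"
    and ex: "exact V (poly_ring V) (psum J (var_ideal V v)) (k - 1) (t + 1)"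
    and c: "c \<in> Cech V (poly_ring V) t k" and b: "b \<in> Cech V (poly_ring V) (t + 1) (k - 1)"
    and xc: "mulc v 1 c - diff V b \<in> Cech V J (t + 1) k"
  shows "\<exists>b\<in>Cech V (poly_ring V) t (k - 1). c - diff V b \<in> Cech V J t k"
proof -
  let ?S = "poly_ring V" and ?J1 = "psum J (var_ideal V v)"
  note acJ = add_closedD[OF add_closed_Cech[OF J V]]
  note J1 = hideal_psum[OF J hideal_var_ideal[OF v]]
  note sub = psum_sub[OF J hideal_var_ideal[OF v]]
  \<comment> \<open>Both terms lie over ?J1, so b is a cycle modulo ?J1. Exactness then writes b as
    a boundary plus g + x_v b3 with g over J, and cancelling x_v shows that c - d b3 lies over
    J.\<close>
  have "mulc v 1 c - (mulc v 1 c - diff V b) \<in> Cech V ?J1 (t + 1) k"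
    using mulc_var_ideal[OF c, of v] xc Cech_mono[OF sub(1), of V "t + 1" k] Cech_mono[OF sub(2), of V "t + 1" k]
    by (intro add_closedD(4)[OF add_closed_Cech[OF J1 V], of "mulc v 1 c" _ _ "mulc v 1 c - diff V b"]) blast+
  then have "diff V b \<in> Cech V ?J1 (t + 1) (k - 1 + 1)" by simp
  then obtain b2 where b2: "b2 \<in> Cech V ?S (t + 1) (k - 1 - 1)" "b - diff V b2 \<in> Cech V ?J1 (t + 1) (k - 1)"
    using ex b unfolding exact_def exact_at_def by blast
  obtain g b3 where g: "g \<in> Cech V J (t + 1) (k - 1)" "b3 \<in> Cech V ?S (t + 1 - 1) (k - 1)" "b - diff V b2 = g + mulc v 1 b3"
    by (rule Cech_psum_var[OF J v b2(2)])
  have b3: "b3 \<in> Cech V ?S t (k - 1)" using g(2) by simp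
  have "diff V b = diff V g + mulc v 1 (diff V b3)"
    using arg_cong[OF g(3), of "diff V"]
    by (simp add: additive_fun_minus[OF additive_diff] additive_fun_add[OF additive_diff] diff_diff[OF V] diff_mulc)
  then have "mulc v 1 (c - diff V b3) = (mulc v 1 c - diff V b) + diff V g"
    by (simp add: additive_fun_minus[OF additive_mulc])
  also have "\<dots> \<in> Cech V J (t + 1) k" using diff_Cech[OF J V g(1)] by (intro acJ(2)[OF xc]) simp
  finally have "mulc v 1 (c - diff V b3) \<in> Cech V J (t + 1) k" .
  moreover have "c - diff V b3 \<in> Cech V ?S t k"
    using diff_Cech[OF hideal_poly_ring V b3] by (intro add_closedD(4)[OF add_closed_Cech[OF hideal_poly_ring V] c]) simp
  ultimately have "c - diff V b3 \<in> Cech V J t k" using Cech_var_colon[OF V J] nzd by metis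
  then show ?thesis using b3 by blast
qed

text \<open>Only the powers of x_v are cleared and the denominators in F stay. This brings a
  fraction on the face F + v down to the face F.\<close>

lemma loc_clear_variable:
  assumes V: "finite V" and P: "hideal V P" and F: "insert v F \<subseteq> V" "v \<notin> F" and f: "f \<in> loc P (insert v F) t"
  shows "\<exists>K0. \<forall>K\<ge>K0. Xpow {v} (int K) * f \<in> loc P F (t + int K)"
proof -
  have fF: "finite F" using F(1) V finite_subset[of F V] by auto
  obtain K0 where K0: "\<And>K. K \<ge> K0 \<Longrightarrow> \<exists>p\<in>P. Xpow (insert v F) (int K) * f = emb p"
    by (rule loc_obtain[OF f P F(1) V]) blast
  have "Xpow {v} (int K) * f \<in> loc P F (t + int K)" if K: "K \<ge> K0" for K
  proof -
    obtain p where "p \<in> P" "Xpow (insert v F) (int K) * f = emb p" using K0[OF K] by blast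
    moreover have "Xpow F (int K) * (Xpow {v} (int K) * f) = Xpow (insert v F) (int K) * f"
      by (subst Xpow_insert[OF fF F(2)]) (simp only: mult_ac)
    ultimately show ?thesis
      using homogen_Xpow_mult[OF loc_homogen[OF f], of "int K" "{v}"] by (intro locI[where p = p and K = K]) auto
  qed
  then show ?thesis by blast
qed

lemma uniform_bound:
  assumes "finite S" "\<And>x. x \<in> S \<Longrightarrow> \<exists>K0::nat. \<forall>K\<ge>K0. R x K"
  shows "\<exists>K0. \<forall>K\<ge>K0. \<forall>x\<in>S. R x K"
  using assms
proof (induction S rule: finite_induct)
  case (insert x S)
  then obtain K1 K2 where "\<forall>K\<ge>K1. R x K" "\<forall>K\<ge>K2. \<forall>x\<in>S. R x K" by blast
  then show ?case by (intro exI[of _ "max K1 K2"]) auto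
qed simp

text \<open>The homotopy contracting the Cech complex after inverting x_v: it sends c to the cochain
  with F-component c(F + v) up to sign.\<close>
lemma variable_torsion:
  fixes J :: "'k::comm_ring_1 mpoly set"
  assumes V: "finite V" and J: "hideal V J" and v: "v \<in> V"
    and c: "c \<in> Cech V (poly_ring V) t k" and dc: "diff V c \<in> Cech V J t (k + 1)"
  shows "\<exists>K b. b \<in> Cech V (poly_ring V) (t + int K) (k - 1) \<and> mulc v (int K) c - diff V b \<in> Cech V J (t + int K) k"
proof -
  let ?S = "poly_ring V :: 'k mpoly set"
  let ?M = "{F. F \<subseteq> V \<and> v \<notin> F}"
  have fM: "finite ?M" using V by (auto intro: finite_subset[of _ "Pow V"])
  have sub: "\<exists>K0. \<forall>K\<ge>K0. Xpow {v} (int K) * z (insert v F) \<in> loc P F (t + int K)"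
    if P: "hideal V P" and z: "z \<in> Cech V P t l" and F: "F \<in> ?M" for P z l F
  proof -
    have F': "insert v F \<subseteq> V" "v \<notin> F" using F v by auto
    have "z (insert v F) \<in> loc P (insert v F) t"
      using Cech_in[OF z F'(1)] Cech_out[OF z, of "insert v F"] add_closedD(1)[OF add_closed_loc[OF P F'(1) V]] by metis
    then show ?thesis by (rule loc_clear_variable[OF V P F'])
  qed
  have "\<exists>K0. \<forall>K\<ge>K0. \<forall>F\<in>?M. Xpow {v} (int K) * c (insert v F) \<in> loc ?S F (t + int K)"
    by (rule uniform_bound[OF fM]) (rule sub[OF hideal_poly_ring c])
  then obtain K1 where K1: "\<forall>K\<ge>K1. \<forall>F\<in>?M. Xpow {v} (int K) * c (insert v F) \<in> loc ?S F (t + int K)" ..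
  have "\<exists>K0. \<forall>K\<ge>K0. \<forall>F\<in>?M. Xpow {v} (int K) * diff V c (insert v F) \<in> loc J F (t + int K)"
    by (rule uniform_bound[OF fM]) (rule sub[OF J dc])
  then obtain K2 where K2: "\<forall>K\<ge>K2. \<forall>F\<in>?M. Xpow {v} (int K) * diff V c (insert v F) \<in> loc J F (t + int K)" ..
  define K where "K = max K1 K2"
  have K: "Xpow {v} (int K) * c (insert v F) \<in> loc ?S F (t + int K)"
    "Xpow {v} (int K) * diff V c (insert v F) \<in> loc J F (t + int K)" if "F \<subseteq> V" "v \<notin> F" for F
    using K1 K2 that by (auto simp: K_def)
  define b where "b F = (if F \<subseteq> V \<and> v \<notin> F then pos_sign v (insert v F) * (Xpow {v} (int K) * c (insert v F)) else 0)" for F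
  have b: "b \<in> Cech V ?S (t + int K) (k - 1)"
  proof (rule ccI)
    fix F assume F: "F \<subseteq> V" "int (card F) = k - 1"
    note ac = add_closed_loc[OF hideal_poly_ring F(1) V]
    show "b F \<in> loc ?S F (t + int K)"
    proof (cases "v \<in> F")
      case True
      then show ?thesis using add_closedD(1)[OF ac] by (simp add: b_def)
    next
      case False
      then show ?thesis using add_closed_pos_sign[OF ac K(1)[OF F(1) False]] F(1) by (simp add: b_def)
    qed
  next
    fix F assume F: "\<not> (F \<subseteq> V \<and> int (card F) = k - 1)"
    show "b F = 0"
    proof (cases "F \<subseteq> V \<and> v \<notin> F")
      case True
      then have "finite F" using V finite_subset by blast
      then have "int (card (insert v F)) \<noteq> k" using True F by auto
      then have "c (insert v F) = 0" using Cech_out[OF c] by blast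
      then show ?thesis by (simp add: b_def)
    qed (auto simp: b_def)
  qed
  have "mulc v (int K) c - diff V b \<in> Cech V J (t + int K) k"
  proof (rule ccI)
    fix F assume F: "F \<subseteq> V" "int (card F) = k"
    have fF: "finite F" using F V finite_subset by blast
    note ac = add_closed_loc[OF J F(1) V]
    show "(mulc v (int K) c - diff V b) F \<in> loc J F (t + int K)"
    proof (cases "v \<in> F")
      case True
      have ins: "insert v (F - {v}) = F" using True by auto
      \<comment> \<open>b vanishes on all faces containing v, so only j = v contributes.\<close>
      have "pos_sign j F * b (F - {j}) = (if j = v then Xpow {v} (int K) * c F else 0)" if "j \<in> F" for j
        using True F(1) ins by (auto simp: b_def)
      then have "diff V b F = (\<Sum>j\<in>F. if j = v then Xpow {v} (int K) * c F else 0)"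
        using F(1) by (simp add: diff_def)
      also have "\<dots> = mulc v (int K) c F" using True fF by (simp add: mulc_def)
      finally show ?thesis using add_closedD(1)[OF ac] by simp
    next
      case False
      let ?G = "insert v F"
      have GV: "?G \<subseteq> V" using F(1) v by simp
      have "diff V b F = (\<Sum>j\<in>F. - (pos_sign v ?G * (Xpow {v} (int K) * (pos_sign j ?G * c (?G - {j})))))"
      proof -
        have "pos_sign j F * b (F - {j}) = - (pos_sign v ?G * (Xpow {v} (int K) * (pos_sign j ?G * c (?G - {j}))))" if j: "j \<in> F" for j
        proof -
          have G: "insert v (F - {j}) = ?G - {j}" using j False by auto
          have "j \<noteq> v" using j False by blast
          moreover have "(pos_sign j ?G :: 'k lpoly) = (if v < j then - pos_sign j F else pos_sign j F)"
            by (rule pos_sign_insert[OF fF False])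
          moreover have "(pos_sign v (?G - {j}) :: 'k lpoly) = (if j < v then - pos_sign v ?G else pos_sign v ?G)"
            using j fF by (intro pos_sign_remove) auto
          \<comment> \<open>Removing j and v in either order differs by a sign. Hence x_v^K c F - (d
            b) F collects all terms of \<open>diff V c ?G\<close>, up to a sign and the factor
            x_v^K, and that value lies over J.\<close>
          ultimately have s: "pos_sign j F * pos_sign v (?G - {j}) = (- (pos_sign v ?G * pos_sign j ?G) :: 'k lpoly)"
            by (cases "v < j") (simp_all add: mult.commute)
          have "b (F - {j}) = pos_sign v (?G - {j}) * (Xpow {v} (int K) * c (?G - {j}))"
          proof -
            have "F - {j} \<subseteq> V \<and> v \<notin> F - {j}" using F(1) False by blast
            then show ?thesis unfolding b_def G by (simp only: if_True simp_thms)
          qed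
          then have "pos_sign j F * b (F - {j}) = (pos_sign j F * pos_sign v (?G - {j})) * (Xpow {v} (int K) * c (?G - {j}))"
            by (simp only: mult.assoc)
          also have "\<dots> = - (pos_sign v ?G * (Xpow {v} (int K) * (pos_sign j ?G * c (?G - {j}))))"
            unfolding s mult_minus_left by (simp only: mult_ac)
          finally show ?thesis .
        qed
        then show ?thesis using F(1) by (simp add: diff_def)
      qed
      moreover have "diff V c ?G = pos_sign v ?G * c F + (\<Sum>j\<in>F. pos_sign j ?G * c (?G - {j}))"
        using GV fF False by (simp add: diff_def)
      ultimately have "mulc v (int K) c F - diff V b F = pos_sign v ?G * (Xpow {v} (int K) * diff V c ?G)"
        by (simp add: mulc_def sum_negf sum_distrib_left distrib_left mult.left_commute[of "Xpow {v} (int K)" "pos_sign v ?G"])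
      also have "\<dots> \<in> loc J F (t + int K)"
        using K(2)[OF F(1) False] by (rule add_closed_pos_sign[OF ac])
      finally show ?thesis by simp
    qed
  next
    fix F assume F: "\<not> (F \<subseteq> V \<and> int (card F) = k)"
    have "diff V b \<in> Cech V ?S (t + int K) k" using diff_Cech[OF hideal_poly_ring V b] by simp
    then show "(mulc v (int K) c - diff V b) F = 0"
      using Cech_out[OF c F] Cech_out[of "diff V b", OF _ F] by (simp add: mulc_def)
  qed
  then show ?thesis using b by blast
qed

text \<open>Every class is killed by a power of x_v (\<open>variable_torsion\<close>). From degree
  t1 on, multiplication by x_v is injective on cohomology, since S/(J, x_v) has none there; peeling
  off one factor at a time shows that the class is zero.\<close>

lemma exact_of_variable:
  assumes V: "finite V" and J: "hideal V J" and v: "v \<in> V" and nzd: "var_colon V J v = J"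
    and ex: "\<And>k t. t \<ge> t1 \<Longrightarrow> exact V (poly_ring V) (psum J (var_ideal V v)) k t"
    and t: "t \<ge> t1"
  shows "exact V (poly_ring V) J k t"
proof -
  have descend: "\<exists>b\<in>Cech V (poly_ring V) t (k - 1). c - diff V b \<in> Cech V J t k"
    if "t \<ge> t1" "c \<in> Cech V (poly_ring V) t k"
      "\<exists>b\<in>Cech V (poly_ring V) (t + int K) (k - 1). mulc v (int K) c - diff V b \<in> Cech V J (t + int K) k" for K t c
    using that
  proof (induction K arbitrary: t c)
    case (Suc K)
    have xc: "mulc v 1 c \<in> Cech V (poly_ring V) (t + 1) k"
      using mulc_Cech[OF hideal_poly_ring v Suc.prems(2), of 1] by simp
    have e: "mulc v (int (Suc K)) c = mulc v (int K) (mulc v 1 c)" "t + int (Suc K) = t + 1 + int K"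
      by (simp_all add: mulc_mulc add.commute)
    have "\<exists>b\<in>Cech V (poly_ring V) (t + 1) (k - 1). mulc v 1 c - diff V b \<in> Cech V J (t + 1) k"
      by (rule Suc.IH[OF _ xc Suc.prems(3)[unfolded e]]) (use Suc.prems(1) in simp)
    then obtain b where "b \<in> Cech V (poly_ring V) (t + 1) (k - 1)" "mulc v 1 c - diff V b \<in> Cech V J (t + 1) k" by blast
    then show ?case
      using Suc.prems(1) by (intro coboundary_of_mulc_coboundary[OF V J v nzd ex Suc.prems(2)]) auto
  qed simp
  show ?thesis
    unfolding exact_def exact_at_def
  proof (intro ballI impI)
    fix c assume c: "c \<in> Cech V (poly_ring V) t k" "diff V c \<in> Cech V J t (k + 1)"
    show "\<exists>b\<in>Cech V (poly_ring V) t (k - 1). c - diff V b \<in> Cech V J t k"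
      using variable_torsion[OF V J v c] descend[OF t c(1)] by blast
  qed
qed

text \<open>S/J vanishes in positive degrees, and inverting any variable makes it zero. So in degree
  t the cochains of S already are cochains of J.\<close>

lemma exact_of_all_variables:
  fixes J :: "'k::comm_ring_1 mpoly set"
  assumes V: "finite V" and J: "hideal V J" and vars: "\<And>v. v \<in> V \<Longrightarrow> Var v \<in> J" and t: "t \<ge> 1"
  shows "exact V (poly_ring V) J k t"
  unfolding exact_def exact_at_def
proof (intro ballI impI)
  fix c :: "'k cochain" assume c: "c \<in> Cech V (poly_ring V) t k"
  note acJ = add_closedD[OF hidealD(2)[OF J]]
  have "c \<in> Cech V J t k"
  proof (rule ccI)
    fix F assume F: "F \<subseteq> V" "int (card F) = k"
    have fF: "finite F" using F V finite_subset by blast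
    have cF: "c F \<in> loc (poly_ring V) F t" by (rule Cech_in[OF c F])
    then obtain K p where p: "p \<in> poly_ring V" "Xpow F (int K) * c F = emb p" by (auto simp: loc_def)
    show "c F \<in> loc J F t"
    proof (cases "F = {}")
      case True
      have "single m u \<in> J" if m: "m \<in> keys p" for m u
      proof -
        have "int (deg m) = t"
          using m p(2) True loc_homogen[OF cF] by (auto simp: homogen_def keys_emb deg_toint)
        then have "m \<noteq> 0" using t by auto
        then obtain w where w: "w \<in> keys m" by (metis keys_eq_empty ex_in_conv)
        let ?m = "m - single w 1"
        have "m = single w 1 + ?m"
          using w by (intro poly_mapping_eqI) (auto simp: lookup_add lookup_minus lookup_single when_def in_keys_iff)
        then have e: "single m u = single ?m u * Var w"
          by (simp add: Var_def mult_single add.commute)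
        have mV: "keys m \<subseteq> V" using m p(1) by (auto simp: poly_ring_def)
        have "keys ?m \<subseteq> keys m" by (auto simp: in_keys_iff lookup_minus)
        then have "single ?m u \<in> poly_ring V" using mV by (auto simp: poly_ring_def)
        then show ?thesis unfolding e using w mV vars by (intro hidealD(3)[OF J]) auto
      qed
      then have "p \<in> J"
        by (rule poly_mapping_single_induct[of "\<lambda>p. p \<in> J" p, rotated]) (auto simp: acJ)
      then show ?thesis using p(2) loc_homogen[OF cF] by (intro locI[where p = p and K = K])
    next
      case False
      then obtain w where w: "w \<in> F" by blast
      have "xprod F = xprod (F - {w}) * (Var w :: 'k mpoly)"
        unfolding xprod_def using prod.remove[OF fF w, of Var] by (simp add: mult.commute)
      then have "xprod F \<in> J"
        using w F vars hidealD(3)[OF J xprod_poly_ring[of "F - {w}"], of "Var w"] by auto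
      then have "p * xprod F \<in> J" by (rule hidealD(3)[OF J p(1)])
      moreover have "Xpow F (int (Suc K)) * c F = Xpow F 1 * (Xpow F (int K) * c F)"
        by (simp add: Xpow_mult flip: mult.assoc)
      then have "Xpow F (int (Suc K)) * c F = emb (p * xprod F)"
        by (simp only: p(2) emb_mult emb_xprod[OF fF] mult.commute[of "Xpow F 1"])
      ultimately show ?thesis using loc_homogen[OF cF] by (intro locI[where K = "Suc K"])
    qed
  qed (rule Cech_out[OF c])
  moreover have "0 \<in> Cech V (poly_ring V) t (k - 1)"
    by (rule add_closedD(1)[OF add_closed_Cech[OF hideal_poly_ring V]])
  ultimately show "\<exists>b\<in>Cech V (poly_ring V) t (k - 1). c - diff V b \<in> Cech V J t k"
    using additive_fun_0[OF additive_diff, of V] by (metis diff_zero)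
qed

text \<open>Noetherian induction. For a variable x_v outside J the ideal (J, x_v) is larger. Either
  J : x_v = J and \<open>exact_of_variable\<close> applies, or J : x_v is larger as well and 0
  \<rightarrow> (J, x_v)/J \<rightarrow> S/J \<rightarrow> S/(J, x_v) \<rightarrow> 0 has both ends
  under control.\<close>

theorem exact_bounded:
  fixes J :: "'k::field mpoly set"
  assumes V: "finite V"
  shows "hideal V J \<Longrightarrow> \<exists>t0. \<forall>k t. t \<ge> t0 \<longrightarrow> exact V (poly_ring V) J k t"
proof (induction J rule: wf_induct_rule[OF wf_hideal[OF V]])
  case (1 J)
  note J = \<open>hideal V J\<close>
  have IH: "\<exists>t0. \<forall>k t. t \<ge> t0 \<longrightarrow> exact V (poly_ring V) J' k t" if "hideal V J'" "J \<subset> J'" for J'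
    using 1 that by blast
  show ?case
  proof (cases "\<forall>v\<in>V. Var v \<in> J")
    case True
    then show ?thesis using exact_of_all_variables[OF V J] by blast
  next
    case False
    then obtain v where v: "v \<in> V" "Var v \<notin> J" by blast
    let ?J1 = "psum J (var_ideal V v)" and ?J2 = "var_colon V J v"
    have hv: "hideal V (var_ideal V v :: 'k mpoly set)" by (rule hideal_var_ideal[OF v(1)])
    have J1: "hideal V ?J1" by (rule hideal_psum[OF J hv])
    have "(Var v :: 'k mpoly) = Var v * 1" by simp
    then have "(Var v :: 'k mpoly) \<in> var_ideal V v" unfolding var_ideal_def using one_poly_ring[of V] by blast
    then have "J \<subset> ?J1" using psum_sub[OF J hv] v(2) by blast
    from IH[OF J1 this] obtain t1 where t1: "\<And>k t. t \<ge> t1 \<Longrightarrow> exact V (poly_ring V) ?J1 k t" by blast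
    have J2: "hideal V ?J2" by (rule hideal_var_colon[OF J v(1)])
    have "J \<subseteq> ?J2"
      using hidealD(1)[OF J] hidealD(3)[OF J Var_poly_ring[OF v(1)]] by (auto simp: var_colon_def)
    show ?thesis
    proof (cases "?J2 = J")
      case True
      then show ?thesis using exact_of_variable[OF V J v(1) True t1] by blast
    next
      case False
      then have "J \<subset> ?J2" using \<open>J \<subseteq> ?J2\<close> by blast
      from IH[OF J2 this] obtain t2 where t2: "\<And>k t. t \<ge> t2 \<Longrightarrow> exact V (poly_ring V) ?J2 k t" by blast
      \<comment> \<open>The bound t2 + 1 accounts for the shift by the degree of x_v in
        \<open>exact_psum_var\<close>.\<close>
      have "exact V (poly_ring V) J k t" if "t \<ge> max t1 (t2 + 1)" for k t
        using that hidealD(1)[OF J1] psum_sub(1)[OF J hv]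
        by (intro exact_extension[OF V J1 hideal_poly_ring _ _ exact_psum_var[OF V J v(1) t2] t1]) auto
      then show ?thesis by blast
    qed
  qed
qed

section \<open>Powers of sums of ideals\<close>

lemma ideal_in_poly_ring: "ideal_in V (poly_ring V)"
  using hideal_poly_ring by (auto simp: hideal_def)

lemma gen_ideal_least: "ideal_in V S \<Longrightarrow> G \<subseteq> S \<Longrightarrow> gen_ideal V G \<subseteq> S"
  unfolding gen_ideal_def by blast

lemma gen_ideal_superset: "G \<subseteq> gen_ideal V G"
  unfolding gen_ideal_def by blast

lemma ideal_in_gen_ideal:
  assumes "G \<subseteq> poly_ring V" shows "ideal_in V (gen_ideal V G)"
proof -
  have "gen_ideal V G \<subseteq> poly_ring V" by (rule gen_ideal_least[OF ideal_in_poly_ring assms])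
  then show ?thesis unfolding gen_ideal_def by (auto simp: ideal_in_def)
qed

lemma ideal_inD:
  assumes "ideal_in V P"
  shows "P \<subseteq> poly_ring V" "0 \<in> P" "a \<in> P \<Longrightarrow> b \<in> P \<Longrightarrow> a + b \<in> P" "q \<in> poly_ring V \<Longrightarrow> a \<in> P \<Longrightarrow> q * a \<in> P"
  using assms by (auto simp: ideal_in_def)

lemma hcomp_of_homog: "homog d g \<Longrightarrow> hcomp e g = g \<or> hcomp e g = 0"
  unfolding homog_def hcomp_def mon_deg_eq_deg
  by (cases "int e = d") (auto intro!: restr_id restr_none)

text \<open>The polynomials all of whose components lie in I form an ideal, and it contains the
  homogeneous generators.\<close>

lemma hideal_homog_ideal:
  fixes I :: "'k::comm_ring_1 mpoly set"
  assumes "homog_ideal V I" shows "hideal V I"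
proof -
  obtain G where I: "ideal_in V I" and G: "G \<subseteq> poly_ring V" "\<forall>g\<in>G. \<exists>d. homog d g" "I = gen_ideal V G"
    using assms by (auto simp: homog_ideal_def)
  note Id = ideal_inD[OF I]
  let ?I = "{p \<in> poly_ring V. \<forall>d. hcomp d p \<in> I}"
  have "ideal_in V ?I"
    unfolding ideal_in_def
  proof (intro conjI ballI)
    fix q p :: "'k mpoly" assume q: "q \<in> poly_ring V" and p: "p \<in> ?I"
    have sumI: "finite S \<Longrightarrow> (\<And>a. a \<in> S \<Longrightarrow> f a \<in> I) \<Longrightarrow> sum f S \<in> I" for f :: "nat \<Rightarrow> 'k mpoly" and S
      by (induction S rule: finite_induct) (auto simp: Id)
    have "hcomp d (hcomp a q * p) \<in> I" for d a
      using p q by (auto simp: hcomp_mult_nat[OF homogen_hcomp] Id hcomp_poly_ring)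
    then have "(\<Sum>a\<in>deg ` keys q. hcomp d (hcomp a q * p)) \<in> I" for d by (intro sumI) auto
    then have "hcomp d ((\<Sum>a\<in>deg ` keys q. hcomp a q) * p) \<in> I" for d
      by (simp add: sum_distrib_right additive_fun_sum[OF additive_hcomp])
    then show "q * p \<in> ?I" using p q by (auto simp: sum_hcomp_keys intro: poly_ring_mult)
  qed (auto simp: Id add_closedD[OF add_closed_poly_ring] hcomp_add)
  moreover have "G \<subseteq> ?I"
  proof
    fix g assume g: "g \<in> G"
    then obtain d where "homog d g" using G(2) by blast
    then have "hcomp e g \<in> I" for e
      using hcomp_of_homog[of d g e] g G(3) gen_ideal_superset[of G V] Id(2) by auto
    then show "g \<in> ?I" using g G(1) by blast
  qed
  ultimately have "I \<subseteq> ?I" unfolding G(3) by (rule gen_ideal_least)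
  then show ?thesis using I by (auto simp: hideal_def)
qed

lemma ideal_pow_0: "ideal_pow V I 0 = (poly_ring V :: 'k::comm_ring_1 mpoly set)"
proof -
  have e: "{prod_list xs | xs. length xs = 0 \<and> set xs \<subseteq> I} = {1}" by auto
  have "poly_ring V \<subseteq> gen_ideal V {1 :: 'k mpoly}"
  proof
    fix p :: "'k mpoly" assume p: "p \<in> poly_ring V"
    have "p * 1 \<in> gen_ideal V {1}"
      by (rule ideal_inD(4)[OF ideal_in_gen_ideal p]) (use gen_ideal_superset in auto)
    then show "p \<in> gen_ideal V {1}" by simp
  qed
  moreover have "gen_ideal V {1 :: 'k mpoly} \<subseteq> poly_ring V" by (rule gen_ideal_least[OF ideal_in_poly_ring]) simp
  ultimately show ?thesis unfolding ideal_pow_def e by blast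
qed

lemma ideal_pow_gens:
  assumes "I \<subseteq> poly_ring V"
  shows "{prod_list xs | xs. length xs = n \<and> set xs \<subseteq> I} \<subseteq> poly_ring V"
proof -
  have "set xs \<subseteq> I \<Longrightarrow> prod_list xs \<in> poly_ring V" for xs
    using assms by (induction xs) (auto intro: poly_ring_mult)
  then show ?thesis by blast
qed

lemma ideal_pow_Suc:
  assumes I: "hideal V I" and n: "hideal V (ideal_pow V I n)"
  shows "ideal_pow V I (Suc n) = tens I (ideal_pow V I n)"
proof
  note gens = ideal_pow_gens[OF hidealD(1)[OF I]]
  have "{prod_list xs | xs. length xs = Suc n \<and> set xs \<subseteq> I} \<subseteq> tens I (ideal_pow V I n)"
  proof safe
    fix xs assume xs: "length xs = Suc n" "set xs \<subseteq> I"
    then obtain x ys where ys: "xs = x # ys" "length ys = n" by (cases xs) auto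
    then have "prod_list ys \<in> ideal_pow V I n"
      unfolding ideal_pow_def using gen_ideal_superset xs by fastforce
    then show "prod_list xs \<in> tens I (ideal_pow V I n)" using xs ys by (auto intro: tensI)
  qed
  moreover have "ideal_in V (tens I (ideal_pow V I n))"
    using hideal_tens[OF I n, of V] by (simp add: hideal_def)
  ultimately show "ideal_pow V I (Suc n) \<subseteq> tens I (ideal_pow V I n)"
    unfolding ideal_pow_def[of V I "Suc n"] by (intro gen_ideal_least)
  have S: "ideal_in V (ideal_pow V I (Suc n))"
    unfolding ideal_pow_def by (rule ideal_in_gen_ideal[OF gens])
  note Sd = ideal_inD[OF S]
  show "tens I (ideal_pow V I n) \<subseteq> ideal_pow V I (Suc n)"
  proof
    fix w assume w: "w \<in> tens I (ideal_pow V I n)"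
    have *: "x * y \<in> ideal_pow V I (Suc n)" if x: "x \<in> I" and y: "y \<in> ideal_pow V I n" for x y
    proof -
      \<comment> \<open>For fixed x the multipliers y with x y in the larger power form an ideal, so
        only the generating products have to be tested.\<close>
      let ?Y = "{y \<in> poly_ring V. x * y \<in> ideal_pow V I (Suc n)}"
      have "ideal_in V ?Y"
        using Sd by (auto simp: ideal_in_def add_closedD[OF add_closed_poly_ring] distrib_left mult.left_commute poly_ring_mult)
      moreover have "{prod_list xs | xs. length xs = n \<and> set xs \<subseteq> I} \<subseteq> ?Y"
      proof
        fix z assume z: "z \<in> {prod_list xs | xs. length xs = n \<and> set xs \<subseteq> I}"
        then obtain xs where xs: "z = prod_list xs" "length xs = n" "set xs \<subseteq> I" by blast
        have "x * z \<in> {prod_list xs | xs. length xs = Suc n \<and> set xs \<subseteq> I}"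
          by (intro CollectI exI[of _ "x # xs"]) (use x xs in simp)
        then have "x * z \<in> ideal_pow V I (Suc n)"
          unfolding ideal_pow_def by (rule gen_ideal_superset[THEN subsetD])
        moreover have "z \<in> poly_ring V" using ideal_pow_gens[OF hidealD(1)[OF I]] z by (rule subsetD)
        ultimately show "z \<in> ?Y" by simp
      qed
      ultimately have "ideal_pow V I n \<subseteq> ?Y" unfolding ideal_pow_def[of V I n] by (rule gen_ideal_least)
      then show ?thesis using y by blast
    qed
    show "w \<in> ideal_pow V I (Suc n)"
      using w unfolding tens_def by induction (auto simp: Sd *)
  qed
qed

lemma hideal_ideal_pow:
  assumes I: "hideal V I" shows "hideal V (ideal_pow V I n)"
proof (induction n)
  case (Suc n)
  then show ?case unfolding ideal_pow_Suc[OF I Suc] using hideal_tens[OF I Suc, of V] by simp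
qed (simp add: ideal_pow_0 hideal_poly_ring)

lemmas ideal_pow_Suc_tens = ideal_pow_Suc[OF _ hideal_ideal_pow]

lemma ideal_pow_Suc_subset:
  assumes I: "hideal V I" shows "ideal_pow V I (Suc n) \<subseteq> ideal_pow V I n"
  unfolding ideal_pow_Suc_tens[OF I I]
  using hidealD[OF hideal_ideal_pow[OF I]] hidealD(1)[OF I] by (intro tens_least) auto

lemma ideal_pow_mono:
  assumes I: "hideal V I" and M: "hideal W M" and "V \<subseteq> W" "I \<subseteq> M"
  shows "ideal_pow V I n \<subseteq> ideal_pow W M n"
proof (induction n)
  case 0
  then show ?case using poly_ring_mono[OF assms(3)] by (simp add: ideal_pow_0)
next
  case (Suc n)
  have "add_closed (tens M (ideal_pow W M n))" by (rule add_closed_tens[OF hidealD(2)[OF M]])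
  then show ?case
    unfolding ideal_pow_Suc_tens[OF I I] ideal_pow_Suc_tens[OF M M]
    using Suc assms(4) by (intro tens_least) (auto intro: tensI)
qed

lemma ideal_pow_add:
  assumes M: "hideal W M" and x: "x \<in> ideal_pow W M i" and y: "y \<in> ideal_pow W M j"
  shows "x * y \<in> ideal_pow W M (i + j)"
  using x
proof (induction i arbitrary: x)
  case 0
  then show ?case using hidealD(3)[OF hideal_ideal_pow[OF M] _ y] by (simp add: ideal_pow_0)
next
  case (Suc i)
  note hi = hideal_ideal_pow[OF M]
  show ?case
  proof (rule tens_image[OF _ hidealD(2)[OF hi] _ Suc.prems[unfolded ideal_pow_Suc_tens[OF M M]]])
    show "additive_fun (\<lambda>x. x * y)" by (rule additive_funI) (simp_all add: distrib_right)
    fix p q assume "p \<in> M" "q \<in> ideal_pow W M i"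
    then have "p * (q * y) \<in> tens M (ideal_pow W M (i + j))" by (intro tensI Suc.IH)
    then show "p * q * y \<in> ideal_pow W M (Suc i + j)"
      by (simp add: ideal_pow_Suc_tens[OF M M] mult.assoc)
  qed
qed

lemma tens_poly_ring: "tens (poly_ring A) (poly_ring B) = (poly_ring (A \<union> B) :: 'k::comm_ring_1 mpoly set)"
proof
  note T = hideal_tens[OF hideal_poly_ring[of A] hideal_poly_ring[of B] refl]
  show "tens (poly_ring A) (poly_ring B) \<subseteq> (poly_ring (A \<union> B) :: 'k mpoly set)" by (rule hidealD(1)[OF T])
  have "1 * 1 \<in> tens (poly_ring A) (poly_ring B :: 'k mpoly set)" by (intro tensI) simp_all
  from hidealD(3)[OF T _ this] show "poly_ring (A \<union> B) \<subseteq> tens (poly_ring A) (poly_ring B :: 'k mpoly set)"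
    by fastforce
qed

lemma psum_least: "add_closed S \<Longrightarrow> P \<subseteq> S \<Longrightarrow> Q \<subseteq> S \<Longrightarrow> psum P Q \<subseteq> S"
  unfolding psum_def using add_closedD(2) by blast

lemma tens_mono: "add_closed P' \<Longrightarrow> P \<subseteq> P' \<Longrightarrow> T \<subseteq> T' \<Longrightarrow> tens P T \<subseteq> tens P' T'"
  by (rule tens_least[OF add_closed_tens]) (auto intro: tensI)

text \<open>A linear projection onto P, tensored with the identity, fixes P \<otimes> B and maps A \<otimes> U to P \<otimes> U.\<close>
lemma tens_Int:
  fixes P Q :: "'k::field mpoly set"
  assumes P: "hideal A P" and Q: "hideal A Q" "Q \<subseteq> P" and T: "hideal B T" "U \<subseteq> T" and AB: "A \<inter> B = {}"
  shows "tens P T \<inter> psum (tens Q T) (tens (poly_ring A) U) \<subseteq> psum (tens Q T) (tens P U)"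
proof
  interpret vector_space "smul :: 'k \<Rightarrow> 'k mpoly \<Rightarrow> _" by (rule vector_space_smul)
  have sP: "subspace P"
    unfolding subspace_def by (intro conjI ballI allI add_closedD[OF hidealD(2)[OF P]] hideal_smul[OF P])
  \<comment> \<open>With the identity for d and {0} for Q, \<open>relative_section\<close> yields a
    linear projection onto P.\<close>
  have "\<exists>g. Vector_Spaces.linear smul smul g \<and> (\<forall>y. g y \<in> P) \<and> (\<forall>q\<in>{0}. g q = 0) \<and> (\<forall>x\<in>P. id (g (id x)) - id x \<in> {0})"
    by (rule relative_section[OF linear_id sP]) (simp add: subspace_def smul_def)
  then obtain \<pi> where \<pi>: "Vector_Spaces.linear smul smul \<pi>" "\<And>y. \<pi> y \<in> P" "\<And>x. x \<in> P \<Longrightarrow> \<pi> x = x" by auto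
  have add: "additive_fun \<pi>" and scale: "\<And>u x. \<pi> (smul u x) = smul u (\<pi> x)"
    using \<pi>(1) add_closedD(1)[OF hidealD(2)[OF P]] \<pi>(3) by (auto simp: Vector_Spaces.linear_iff additive_fun_def)
  let ?\<phi> = "lmap A (\<lambda>_. \<pi>)"
  note lm = additive_lmap[of "\<lambda>_. \<pi>" A, OF add]
  have mult: "?\<phi> (x * y) = \<pi> x * y" if "x \<in> poly_ring A" "y \<in> T" for x y :: "'k mpoly"
  proof (rule lmap_mult[OF add scale _ refl _ add])
    show "vars_in A x" using that by (simp add: vars_in_def poly_ring_def)
    show "vars_in (- A) y" using that(2) hidealD(1)[OF T(1)] AB by (fastforce simp: vars_in_def poly_ring_def)
  qed
  have fix_tens: "?\<phi> x = x" if "S \<subseteq> P" "x \<in> tens S T" for x S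
    using that(2) unfolding tens_def
  proof induction
    case (aspan_step g x)
    then obtain p q where "g = p * q" "p \<in> S" "q \<in> T" by auto
    moreover then have "p \<in> P" "p \<in> poly_ring A" using that(1) hidealD(1)[OF P] by blast+
    ultimately have "?\<phi> g = g" using mult[of p q] \<pi>(3)[of p] by simp
    then show ?case using aspan_step by (simp add: additive_fun_add[OF lm])
  qed (simp add: additive_fun_0[OF lm])
  fix w assume w: "w \<in> tens P T \<inter> psum (tens Q T) (tens (poly_ring A) U)"
  then obtain x y where xy: "x \<in> tens Q T" "y \<in> tens (poly_ring A) U" "w = x + y" by (auto simp: psum_mem)
  have "?\<phi> y \<in> tens P U"
  proof (rule tens_image[OF lm add_closed_tens[OF hidealD(2)[OF P]] _ xy(2)])
    fix p q :: "'k mpoly" assume "p \<in> poly_ring A" "q \<in> U"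
    then have "?\<phi> (p * q) = \<pi> p * q" "q \<in> U" using mult[of p q] T(2) by auto
    then show "?\<phi> (p * q) \<in> tens P U" using tensI[OF \<pi>(2)] by simp
  qed
  moreover have "w = x + ?\<phi> y"
    using fix_tens[OF subset_refl, of w] fix_tens[OF Q(2) xy(1)] w xy(3) by (simp add: additive_fun_add[OF lm])
  ultimately show "w \<in> psum (tens Q T) (tens P U)" using xy(1) unfolding psum_mem by blast
qed

text \<open>Localisation commutes with intersection: over a common exponent both memberships speak
  of the same numerator.\<close>

lemma Cech_Int:
  assumes V: "finite V" and P: "hideal V P" and Q: "hideal V Q" and c: "c \<in> Cech V P t k" "c \<in> Cech V Q t k"
  shows "c \<in> Cech V (P \<inter> Q) t k"
proof (rule ccI)
  fix F assume F: "F \<subseteq> V" "int (card F) = k"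
  obtain K p q where pq: "p \<in> P" "q \<in> Q" "Xpow F (int K) * c F = emb p" "Xpow F (int K) * c F = emb q"
    by (rule loc_obtain2[OF V V P F(1) Cech_in[OF c(1) F] Q F(1) Cech_in[OF c(2) F]])
  then have "p = q" by (simp add: emb_inject)
  then show "c F \<in> loc (P \<inter> Q) F t"
    using pq loc_homogen[OF Cech_in[OF c(1) F]] by (intro locI[where p = p and K = K]) auto
qed (rule Cech_out[OF c(1)])

text \<open>The isomorphism (P + Q)/Q = P/(P \<inter> Q) on cochains: subtracting its Q-part turns a
  cycle modulo Q into a cochain of P whose differential lies over both ideals.\<close>

lemma exact_second_iso:
  assumes V: "finite V" and P: "hideal V P" and Q: "hideal V Q" and ex: "exact V P (P \<inter> Q) k t"
  shows "exact V (psum P Q) Q k t"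
  unfolding exact_def exact_at_def
proof (intro ballI impI)
  fix c assume c: "c \<in> Cech V (psum P Q) t k" and dc: "diff V c \<in> Cech V Q t (k + 1)"
  note acQ = add_closedD[OF add_closed_Cech[OF Q V]]
  obtain p q where pq: "p \<in> Cech V P t k" "q \<in> Cech V Q t k" "c = p + q" using Cech_psum[OF P Q c] by blast
  have "diff V c - diff V q \<in> Cech V Q t (k + 1)" by (rule acQ(4)[OF dc diff_Cech[OF Q V pq(2)]])
  then have "diff V p \<in> Cech V Q t (k + 1)" by (simp add: pq(3) additive_fun_add[OF additive_diff])
  then have "diff V p \<in> Cech V (P \<inter> Q) t (k + 1)" by (rule Cech_Int[OF V P Q diff_Cech[OF P V pq(1)]])
  then obtain b where b: "b \<in> Cech V P t (k - 1)" "p - diff V b \<in> Cech V (P \<inter> Q) t k"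
    using ex pq(1) unfolding exact_def exact_at_def by blast
  have "p - diff V b \<in> Cech V Q t k" using b(2) Cech_mono[of "P \<inter> Q" Q V t k] by blast
  then have "(p - diff V b) + q \<in> Cech V Q t k" using pq(2) by (rule acQ(2))
  moreover have "(p - diff V b) + q = c - diff V b" by (simp add: pq(3))
  moreover have "b \<in> Cech V (psum P Q) t (k - 1)" using b(1) Cech_mono[OF psum_sub(1)[OF P Q]] by blast
  ultimately show "\<exists>b\<in>Cech V (psum P Q) t (k - 1). c - diff V b \<in> Cech V Q t k" by metis
qed

section \<open>Powers of I + J and the filtration\<close>

context
  fixes A B R :: "nat set" and I J M :: "'k::field mpoly set"
  assumes fin: "finite A" "finite B" and less: "\<forall>a\<in>A. \<forall>b\<in>B. a < b" and R: "R = A \<union> B"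
    and I: "hideal A I" and J: "hideal B J" and M: "M = gen_ideal R (I \<union> J)"
begin

lemma sum_ideal_eq: "M = psum (tens I (poly_ring B)) (tens (poly_ring A) J)"
proof
  let ?S = "psum (tens I (poly_ring B)) (tens (poly_ring A) J)"
  have h: "hideal R (tens I (poly_ring B))" "hideal R (tens (poly_ring A) J)"
    by (rule hideal_tens[OF I hideal_poly_ring R] hideal_tens[OF hideal_poly_ring J R])+
  have S: "ideal_in R ?S" using hideal_psum[OF h] by (simp add: hideal_def)
  have "I \<subseteq> tens I (poly_ring B)" "J \<subseteq> tens (poly_ring A) J"
    using tensI[of _ I 1 "poly_ring B"] tensI[of 1 "poly_ring A" _ J] by auto
  then have sub: "I \<union> J \<subseteq> ?S" using psum_sub[OF h] by blast
  then show "M \<subseteq> ?S" unfolding M by (intro gen_ideal_least S)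
  have AR: "poly_ring A \<subseteq> poly_ring R" and BR: "poly_ring B \<subseteq> poly_ring R" unfolding R by (rule poly_ring_mono, blast)+
  have "ideal_in R M" unfolding M
    using hidealD(1)[OF I] hidealD(1)[OF J] AR BR by (intro ideal_in_gen_ideal) auto
  note Md = ideal_inD[OF this]
  have IJ: "I \<union> J \<subseteq> M" unfolding M by (rule gen_ideal_superset)
  have "x \<in> M" if "x \<in> tens I (poly_ring B)" for x
    using that unfolding tens_def
  proof induction
    case (aspan_step g x)
    then obtain p q where g: "g = p * q" "p \<in> I" "q \<in> poly_ring B" by auto
    have "q \<in> poly_ring R" "p \<in> M" using g IJ BR by auto
    then have "g \<in> M" unfolding g(1) mult.commute[of p] by (rule Md(4))
    then show ?case by (rule Md(3)[OF _ aspan_step.IH])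
  qed (rule Md)
  moreover have "x \<in> M" if "x \<in> tens (poly_ring A) J" for x
    using that unfolding tens_def
  proof induction
    case (aspan_step g x)
    then obtain p q where g: "g = p * q" "p \<in> poly_ring A" "q \<in> J" by auto
    have "p \<in> poly_ring R" "q \<in> M" using g IJ AR by auto
    then have "g \<in> M" unfolding g(1) by (rule Md(4))
    then show ?case by (rule Md(3)[OF _ aspan_step.IH])
  qed (rule Md)
  ultimately show "?S \<subseteq> M" using Md(3) by (auto simp: psum_mem)
qed

lemma hideal_sum_ideal: "hideal R M"
  unfolding sum_ideal_eq
  by (rule hideal_psum[OF hideal_tens[OF I hideal_poly_ring R] hideal_tens[OF hideal_poly_ring J R]])

lemma sum_ideal_superset: "I \<subseteq> M" "J \<subseteq> M"
  unfolding M using gen_ideal_superset[of "I \<union> J" R] by auto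

lemma tens_pow_subset: "tens (ideal_pow A I i) (ideal_pow B J j) \<subseteq> ideal_pow R M (i + j)"
proof (rule tens_least[OF hidealD(2)[OF hideal_ideal_pow[OF hideal_sum_ideal]]])
  fix p q assume "p \<in> ideal_pow A I i" "q \<in> ideal_pow B J j"
  then have "p \<in> ideal_pow R M i" "q \<in> ideal_pow R M j"
    using ideal_pow_mono[OF I hideal_sum_ideal _ sum_ideal_superset(1)] ideal_pow_mono[OF J hideal_sum_ideal _ sum_ideal_superset(2)] R by blast+
  then show "p * q \<in> ideal_pow R M (i + j)" by (rule ideal_pow_add[OF hideal_sum_ideal])
qed

text \<open>Pigeonhole: of n = p + q - 1 factors from I + J, at least p come from I or at least q
  from J.\<close>

lemma pow_sum_subset:
  "p + q = Suc n \<Longrightarrow> ideal_pow R M n \<subseteq> psum (tens (ideal_pow A I p) (poly_ring B)) (tens (poly_ring A) (ideal_pow B J q))"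
proof (induction n arbitrary: p q)
  have h: "hideal R (tens (ideal_pow A I p) (poly_ring B))" "hideal R (tens (poly_ring A) (ideal_pow B J q))" for p q
    by (rule hideal_tens[OF hideal_ideal_pow[OF I] hideal_poly_ring R] hideal_tens[OF hideal_poly_ring hideal_ideal_pow[OF J] R])+
  have trivial: "ideal_pow R M n \<subseteq> psum (tens (ideal_pow A I p) (poly_ring B)) (tens (poly_ring A) (ideal_pow B J q))"
    if "p = 0 \<or> q = 0" for n p q
  proof -
    have "tens (ideal_pow A I p) (poly_ring B) = poly_ring R \<or> tens (poly_ring A) (ideal_pow B J q) = poly_ring R"
      using that by (auto simp: ideal_pow_0 tens_poly_ring R)
    then have "poly_ring R \<subseteq> psum (tens (ideal_pow A I p) (poly_ring B)) (tens (poly_ring A) (ideal_pow B J q))"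
      using psum_sub[OF h(1)[of p] h(2)[of q]] by auto
    with hidealD(1)[OF hideal_ideal_pow[OF hideal_sum_ideal]] show ?thesis by (rule order_trans)
  qed
  {
    case 0
    then show ?case by (intro trivial) auto
  next
    case (Suc n)
    show ?case
    proof (cases "p = 0 \<or> q = 0")
      case False
      then obtain p' q' where pq: "p = Suc p'" "q = Suc q'" by (metis not0_implies_Suc)
      let ?Ip = "\<lambda>p. tens (ideal_pow A I p) (poly_ring B)" and ?Jq = "\<lambda>q. tens (poly_ring A) (ideal_pow B J q)"
      note hZ = hideal_psum[OF h, of p q]
      note acZ = add_closedD[OF hidealD(2)[OF hZ]]
      have sub: "?Ip p \<subseteq> psum (?Ip p) (?Jq q)" "?Jq q \<subseteq> psum (?Ip p) (?Jq q)" by (rule psum_sub[OF h])+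
      have mulR: "u * y \<in> S" if "hideal R S" "u \<in> poly_ring R" "y \<in> S" for u y S by (rule hidealD(3)[OF that])
      have PR: "tens I (poly_ring B) \<subseteq> poly_ring R" "tens (poly_ring A) J \<subseteq> poly_ring R"
        by (rule hidealD(1)[OF hideal_tens[OF I hideal_poly_ring R]] hidealD(1)[OF hideal_tens[OF hideal_poly_ring J R]])+
      have I_step: "u * y \<in> ?Ip p" if "u \<in> tens I (poly_ring B)" "y \<in> ?Ip p'" for u y :: "'k mpoly"
      proof (rule tens_image[OF _ hidealD(2)[OF h(1)] _ that(1)])
        show "additive_fun (\<lambda>u. u * y)" by (rule additive_funI) (simp_all add: distrib_right)
        fix a b :: "'k mpoly" assume ab: "a \<in> I" "b \<in> poly_ring B"
        show "a * b * y \<in> ?Ip p"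
        proof (rule tens_image[OF _ hidealD(2)[OF h(1)] _ that(2)])
          show "additive_fun ((*) (a * b))" by (rule additive_funI) (simp_all add: distrib_left)
          fix c e :: "'k mpoly" assume "c \<in> ideal_pow A I p'" "e \<in> poly_ring B"
          then have "(a * c) * (b * e) \<in> ?Ip p"
            using ab by (intro tensI) (auto simp: pq ideal_pow_Suc_tens[OF I I] intro: tensI poly_ring_mult)
          then show "a * b * (c * e) \<in> ?Ip p" by (simp add: mult_ac)
        qed
      qed
      have J_step: "u * y \<in> ?Jq q" if "u \<in> tens (poly_ring A) J" "y \<in> ?Jq q'" for u y :: "'k mpoly"
      proof (rule tens_image[OF _ hidealD(2)[OF h(2)] _ that(1)])
        show "additive_fun (\<lambda>u. u * y)" by (rule additive_funI) (simp_all add: distrib_right)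
        fix a b :: "'k mpoly" assume ab: "a \<in> poly_ring A" "b \<in> J"
        show "a * b * y \<in> ?Jq q"
        proof (rule tens_image[OF _ hidealD(2)[OF h(2)] _ that(2)])
          show "additive_fun ((*) (a * b))" by (rule additive_funI) (simp_all add: distrib_left)
          fix c e :: "'k mpoly" assume "c \<in> poly_ring A" "e \<in> ideal_pow B J q'"
          then have "(a * c) * (b * e) \<in> ?Jq q"
            using ab by (intro tensI) (auto simp: pq ideal_pow_Suc_tens[OF J J] intro: tensI poly_ring_mult)
          then show "a * b * (c * e) \<in> ?Jq q" by (simp add: mult_ac)
        qed
      qed
      have "x * y \<in> psum (?Ip p) (?Jq q)" if x: "x \<in> M" and y: "y \<in> ideal_pow R M n" for x y
      proof -
        obtain u v where uv: "u \<in> tens I (poly_ring B)" "v \<in> tens (poly_ring A) J" "x = u + v"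
          using x unfolding sum_ideal_eq psum_mem by blast
        \<comment> \<open>Two decompositions of the same y: the one for (p - 1, q) is multiplied by
          the part u in I, the one for (p, q - 1) by the part v in J.\<close>
        have "y \<in> psum (?Ip p') (?Jq q)" "y \<in> psum (?Ip p) (?Jq q')"
          using Suc.IH[of p' q] Suc.IH[of p q'] Suc.prems y by (auto simp: pq)
        then obtain y1 y2 z1 z2 where y12: "y1 \<in> ?Ip p'" "y2 \<in> ?Jq q" "y = y1 + y2"
          and z12: "z1 \<in> ?Ip p" "z2 \<in> ?Jq q'" "y = z1 + z2"
          unfolding psum_mem by blast
        have "u * y1 \<in> psum (?Ip p) (?Jq q)" "v * z2 \<in> psum (?Ip p) (?Jq q)"
          using I_step[OF uv(1) y12(1)] J_step[OF uv(2) z12(2)] sub by auto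
        moreover have "u * y2 \<in> psum (?Ip p) (?Jq q)" "v * z1 \<in> psum (?Ip p) (?Jq q)"
          using mulR[OF h(2) _ y12(2)] mulR[OF h(1) _ z12(1)] uv(1,2) PR sub by blast+
        ultimately have "(u * y1 + u * y2) + (v * z1 + v * z2) \<in> psum (?Ip p) (?Jq q)" by (intro acZ(2))
        moreover have "x * y = (u * y1 + u * y2) + (v * z1 + v * z2)"
          using uv(3) y12(3) z12(3) by (metis distrib_left distrib_right)
        ultimately show ?thesis by simp
      qed
      then show ?thesis
        unfolding ideal_pow_Suc_tens[OF hideal_sum_ideal hideal_sum_ideal]
        by (intro tens_least[OF hidealD(2)[OF hZ]])
    qed (rule trivial)
  }
qed

text \<open>The quotient of consecutive members of the filtration I^i R + (I + J)^n is
  I^i/I^(i+1) \<otimes> B/J^(n-i).\<close>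
definition filtration :: "nat \<Rightarrow> nat \<Rightarrow> 'k mpoly set" where
  "filtration n i = psum (tens (ideal_pow A I i) (poly_ring B)) (ideal_pow R M n)"

lemma hideal_filtration: "hideal R (filtration n i)"
  unfolding filtration_def
  by (rule hideal_psum[OF hideal_tens[OF hideal_ideal_pow[OF I] hideal_poly_ring R] hideal_ideal_pow[OF hideal_sum_ideal]])

text \<open>The i-th quotient is I^i R modulo its intersection with the next member. That
  intersection is I^(i+1) \<otimes> B + I^i \<otimes> J^(n-i), the denominator for which
  \<open>exact_tens\<close> is stated.\<close>

lemma exact_filtration:
  assumes i: "i < n"
    and ex: "\<And>k1 a. exact A (ideal_pow A I i) (ideal_pow A I (Suc i)) k1 a
       \<or> exact B (poly_ring B) (ideal_pow B J (n - i)) (k - k1) (t - a)"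
  shows "exact R (filtration n i) (filtration n (Suc i)) k t"
proof -
  let ?Ip = "\<lambda>p. tens (ideal_pow A I p) (poly_ring B)" and ?W = "psum (tens (ideal_pow A I (Suc i)) (poly_ring B)) (tens (ideal_pow A I i) (ideal_pow B J (n - i)))"
  note hI = hideal_ideal_pow[OF I] and hJ = hideal_ideal_pow[OF J] and hM = hideal_ideal_pow[OF hideal_sum_ideal]
  have hIp: "hideal R (?Ip p)" for p by (rule hideal_tens[OF hI hideal_poly_ring R])
  have mono: "?Ip (Suc i) \<subseteq> ?Ip i"
    by (rule tens_mono[OF hidealD(2)[OF hI] ideal_pow_Suc_subset[OF I] subset_refl])
  have acfil: "add_closed (filtration n i)" for i by (rule hidealD(2)[OF hideal_filtration])
  have sub: "?Ip j \<subseteq> filtration n j" "ideal_pow R M n \<subseteq> filtration n j" for j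
    unfolding filtration_def by (rule psum_sub[OF hIp hM])+
  have e1: "psum (?Ip i) (filtration n (Suc i)) = filtration n i"
  proof
    have "filtration n (Suc i) \<subseteq> filtration n i"
      unfolding filtration_def[of n "Suc i"] by (rule psum_least[OF acfil order_trans[OF mono sub(1)] sub(2)])
    then show "psum (?Ip i) (filtration n (Suc i)) \<subseteq> filtration n i"
      by (intro psum_least[OF acfil sub(1)])
    have "?Ip i \<subseteq> psum (?Ip i) (filtration n (Suc i))" "filtration n (Suc i) \<subseteq> psum (?Ip i) (filtration n (Suc i))"
      by (rule psum_sub[OF hIp hideal_filtration])+
    then show "filtration n i \<subseteq> psum (?Ip i) (filtration n (Suc i))"
      unfolding filtration_def[of n i] using sub(2)[of "Suc i"]
      by (intro psum_least[OF hidealD(2)[OF hideal_psum[OF hIp hideal_filtration]]]) auto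
  qed
  have AB: "A \<inter> B = {}" using less by force
  have e2: "?Ip i \<inter> filtration n (Suc i) = ?W"
  proof
    have JB: "ideal_pow B J (n - i) \<subseteq> poly_ring B" by (rule hidealD(1)[OF hJ])
    have hAJ: "hideal R (tens (poly_ring A) (ideal_pow B J (n - i)))" by (rule hideal_tens[OF hideal_poly_ring hJ R])
    \<comment> \<open>The power (I + J)^n is bounded by \<open>pow_sum_subset\<close> with p = i + 1
      and q = n - i, whose sum is n + 1. \<open>tens_Int\<close> then sharpens A \<otimes> J^(n-i)
      to I^i \<otimes> J^(n-i).\<close>
    have "filtration n (Suc i) \<subseteq> psum (?Ip (Suc i)) (tens (poly_ring A) (ideal_pow B J (n - i)))"
      unfolding filtration_def using i psum_sub(1)[OF hIp hAJ]
      by (intro psum_least[OF hidealD(2)[OF hideal_psum[OF hIp hAJ]]] pow_sum_subset) auto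
    then show "?Ip i \<inter> filtration n (Suc i) \<subseteq> ?W"
      using tens_Int[OF hI hI ideal_pow_Suc_subset[OF I] hideal_poly_ring JB AB] by blast
    have "tens (ideal_pow A I i) (ideal_pow B J (n - i)) \<subseteq> ?Ip i"
      by (rule tens_mono[OF hidealD(2)[OF hI] subset_refl JB])
    moreover have "tens (ideal_pow A I i) (ideal_pow B J (n - i)) \<subseteq> filtration n (Suc i)"
      using tens_pow_subset[of i "n - i"] i sub(2) by auto
    ultimately show "?W \<subseteq> ?Ip i \<inter> filtration n (Suc i)"
      using mono sub(1)[of "Suc i"] psum_least[OF hidealD(2)[OF hIp[of i]]] psum_least[OF acfil] by (meson Int_greatest)
  qed
  have "exact (A \<union> B) (?Ip i) ?W k t"
    by (rule exact_tens[OF fin less[rule_format] hI hI ideal_pow_Suc_subset[OF I] hideal_poly_ring hJ hidealD(1)[OF hJ] ex])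
  then have "exact R (?Ip i) (?Ip i \<inter> filtration n (Suc i)) k t" unfolding e2 R[symmetric] .
  then have "exact R (psum (?Ip i) (filtration n (Suc i))) (filtration n (Suc i)) k t"
    using fin R by (intro exact_second_iso hIp hideal_filtration) auto
  then show ?thesis by (simp only: e1)
qed

lemma not_exact_pow_sum:
  assumes "\<not> exact R (poly_ring R) (ideal_pow R M n) k t"
  obtains i k1 a where "i < n" "\<not> exact B (poly_ring B) (ideal_pow B J (n - i)) (k - k1) (t - a)"
    "\<not> exact A (poly_ring A) (ideal_pow A I (Suc i)) k1 a \<or>
      0 < i \<and> \<not> exact A (poly_ring A) (ideal_pow A I i) (k1 - 1) a"
proof -
  have fR: "finite R" using fin R by simp
  have f0: "filtration n 0 = poly_ring R"
  proof
    show "filtration n 0 \<subseteq> poly_ring R" by (rule hidealD(1)[OF hideal_filtration])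
    have "tens (ideal_pow A I 0) (poly_ring B) = poly_ring R"
      by (simp add: ideal_pow_0 tens_poly_ring R)
    then show "poly_ring R \<subseteq> filtration n 0"
      unfolding filtration_def using psum_sub(1)[OF hideal_poly_ring hideal_ideal_pow[OF hideal_sum_ideal]] by metis
  qed
  have fn: "filtration n n = ideal_pow R M n"
  proof
    have "tens (ideal_pow A I n) (poly_ring B) \<subseteq> ideal_pow R M n"
      using tens_pow_subset[of n 0] by (simp add: ideal_pow_0)
    then show "filtration n n \<subseteq> ideal_pow R M n"
      unfolding filtration_def by (intro psum_least hidealD(2)[OF hideal_ideal_pow[OF hideal_sum_ideal]]) auto
    show "ideal_pow R M n \<subseteq> filtration n n"
      unfolding filtration_def by (rule psum_sub(2)[OF hideal_tens[OF hideal_ideal_pow[OF I] hideal_poly_ring R] hideal_ideal_pow[OF hideal_sum_ideal]])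
  qed
  have fmono: "filtration n (Suc i) \<subseteq> filtration n i" for i
  proof -
    have "tens (ideal_pow A I (Suc i)) (poly_ring B) \<subseteq> tens (ideal_pow A I i) (poly_ring B)"
      by (rule tens_mono[OF hidealD(2)[OF hideal_ideal_pow[OF I]] ideal_pow_Suc_subset[OF I] subset_refl])
    then show ?thesis unfolding filtration_def psum_def by blast
  qed
  have "\<exists>i<n. \<not> exact R (filtration n i) (filtration n (Suc i)) k t"
  proof (rule ccontr)
    assume no: "\<not> ?thesis"
    have "i \<le> n \<Longrightarrow> exact R (poly_ring R) (filtration n i) k t" for i
    proof (induction i)
      case 0
      then show ?case by (simp add: f0 exact_refl[OF fR hideal_poly_ring])
    next
      case (Suc i)
      then show ?case
        using no by (intro exact_extension[OF fR hideal_filtration hideal_poly_ring fmono hidealD(1)[OF hideal_filtration]]) auto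
    qed
    then show False using assms fn by fastforce
  qed
  then obtain i where i: "i < n" "\<not> exact R (filtration n i) (filtration n (Suc i)) k t" by blast
  then obtain k1 a where ex: "\<not> exact A (ideal_pow A I i) (ideal_pow A I (Suc i)) k1 a"
    "\<not> exact B (poly_ring B) (ideal_pow B J (n - i)) (k - k1) (t - a)"
    using exact_filtration[OF i(1)] by blast
  have or: "\<not> exact A (poly_ring A) (ideal_pow A I (Suc i)) k1 a \<or> \<not> exact A (poly_ring A) (ideal_pow A I i) (k1 - 1) a"
    using exact_sub[OF fin(1) hideal_ideal_pow[OF I] hideal_poly_ring ideal_pow_Suc_subset[OF I] hidealD(1)[OF hideal_ideal_pow[OF I]]] ex(1)
    by blast
  \<comment> \<open>For i = 0 the quotient A/I^0 is zero and the connecting map contributes nothing;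
    this keeps the first family of terms within the range 1 to n - 1.\<close>
  have "exact A (poly_ring A) (ideal_pow A I 0) l a" for l
    by (simp add: ideal_pow_0 exact_refl[OF fin(1) hideal_poly_ring])
  then have "\<not> exact A (poly_ring A) (ideal_pow A I (Suc i)) k1 a \<or>
      0 < i \<and> \<not> exact A (poly_ring A) (ideal_pow A I i) (k1 - 1) a"
    using or by (cases "i = 0") auto
  then show ?thesis using that i(1) ex(2) by blast
qed

end

section \<open>From nonvanishing classes to depth and regularity\<close>

lemma exact_trivial:
  assumes V: "finite V" and P: "hideal V P" and k: "k < 0 \<or> k > int (card V)" and Q: "hideal V Q"
  shows "exact V P Q k t"
  unfolding exact_def exact_at_def
proof (intro ballI impI)
  fix c assume c: "c \<in> Cech V P t k"
  have "c F = 0" for F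
    by (rule Cech_out[OF c]) (use k card_mono[OF V, of F] in auto)
  then have "c = 0" by (simp add: fun_eq_iff)
  then have "c - diff V 0 \<in> Cech V Q t k"
    using add_closedD(1)[OF add_closed_Cech[OF Q V]] by (simp add: additive_fun_0[OF additive_diff])
  then show "\<exists>b\<in>Cech V P t (k - 1). c - diff V b \<in> Cech V Q t k"
    using add_closedD(1)[OF add_closed_Cech[OF P V]] by blast
qed

lemma not_exact_loc_coh:
  assumes "finite V" "hideal V J" "\<not> exact V (poly_ring V) J k t"
  obtains i where "k = int i" "i \<le> card V" "loc_coh_nonzero V J i t"
proof -
  have "\<not> (k < 0 \<or> k > int (card V))" using exact_trivial[OF assms(1) hideal_poly_ring _ assms(2)] assms(3) by blast
  then have "k = int (nat k)" "nat k \<le> card V" by auto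
  then show ?thesis using that loc_coh_nonzero_iff[OF assms(1,2)] assms(3) by metis
qed

lemma depth_quot_le: "loc_coh_nonzero V J i t \<Longrightarrow> depth_quot V J \<le> i"
  unfolding depth_quot_def by (rule Least_le) blast

text \<open>A supremum of integers is an upper bound only for a set bounded above. Here t is bounded
  by \<open>exact_bounded\<close> and i by the number of variables.\<close>

lemma reg_quot_ge:
  fixes J :: "'k::field mpoly set"
  assumes V: "finite V" and J: "hideal V J" and "loc_coh_nonzero V J i t"
  shows "t + int i \<le> reg_quot V J"
  unfolding reg_quot_def
proof (rule cSup_upper)
  show "t + int i \<in> {t + int i | i t. loc_coh_nonzero V J i t}" using assms(3) by blast
  obtain t0 where t0: "\<And>k t. t \<ge> t0 \<Longrightarrow> exact V (poly_ring V) J k t" using exact_bounded[OF V J] by blast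
  show "bdd_above {t + int i | i t. loc_coh_nonzero V J i t}"
  proof (rule bdd_aboveI[of _ "t0 + int (card V)"], safe)
    fix i t assume nz: "loc_coh_nonzero V J i t"
    then have ne: "\<not> exact V (poly_ring V) J (int i) t" using loc_coh_nonzero_iff[OF V J] by blast
    then have "i \<le> card V" by (rule not_exact_loc_coh[OF V J]) simp
    moreover have "t < t0" using t0 ne by (metis not_less)
    ultimately show "t + int i \<le> t0 + int (card V)" by simp
  qed
qed

text \<open>The constant term is the component of degree 0, hence in I; a nonzero one would be a
  unit of the field.\<close>

lemma proper_hideal_const:
  fixes I :: "'k::field mpoly set"
  assumes "hideal V I" "1 \<notin> I" "p \<in> I"
  shows "0 \<notin> keys p"
proof
  assume 0: "0 \<in> keys p"
  have "hcomp 0 p = single 0 (lookup p 0)"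
  proof (rule poly_mapping_eqI)
    fix m :: "nat \<Rightarrow>\<^sub>0 nat"
    have "deg m = 0 \<longleftrightarrow> m = 0"
      using lookup_le_deg[of m] by (auto intro!: poly_mapping_eqI)
    then show "lookup (hcomp 0 p) m = lookup (single 0 (lookup p 0)) m"
      by (auto simp: hcomp_def lookup_restr lookup_single when_def)
  qed
  then have "smul (inverse (lookup p 0)) (single 0 (lookup p 0)) \<in> I"
    using hideal_smul[OF assms(1) hidealD(4)[OF assms(1,3)], of _ 0] by metis
  then show False using 0 assms(2) by (simp add: smul_single in_keys_iff)
qed

lemma keys_mult_0:
  assumes "(0 :: nat \<Rightarrow>\<^sub>0 nat) \<in> keys (p * q)"
  shows "0 \<in> keys p \<and> 0 \<in> keys q"
proof -
  obtain a b where ab: "a \<in> keys p" "b \<in> keys q" "0 = a + b"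
    using assms keys_mult by blast
  have "lookup a v + lookup b v = 0" for v
    using ab(3) by (metis lookup_add lookup_zero)
  then have "a = 0" "b = 0" by (auto intro!: poly_mapping_eqI)
  then show ?thesis using ab by simp
qed

lemma add_closed_const_0: "add_closed {p :: 'k::comm_ring_1 mpoly. 0 \<notin> keys p}"
  by (auto simp: add_closed_def in_keys_iff lookup_add)

theorem theorem2p4:
  fixes I J :: "'k::field mpoly set" and r s n :: nat
  defines "AV \<equiv> {0..<r}" and "BV \<equiv> {r..<r+s}" and "RV \<equiv> {0..<r+s}"
  assumes I: "homog_ideal AV I" "I \<noteq> {0}" "1 \<notin> I"
      and J: "homog_ideal BV J" "J \<noteq> {0}" "1 \<notin> J"
      and n: "1 \<le> n"
  shows
    "(depth_quot RV (ideal_pow RV (gen_ideal RV (I \<union> J)) n) \<ge>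
       Min ({depth_quot AV (ideal_pow AV I (n - i)) + depth_quot BV (ideal_pow BV J i) + 1 | i. i \<in> {1..n-1}}
          \<union> {depth_quot AV (ideal_pow AV I (n - j + 1)) + depth_quot BV (ideal_pow BV J j) | j. j \<in> {1..n}})) \<and>
     (reg_quot RV (ideal_pow RV (gen_ideal RV (I \<union> J)) n) \<le>
       Max ({reg_quot AV (ideal_pow AV I (n - i)) + reg_quot BV (ideal_pow BV J i) + 1 | i. i \<in> {1..n-1}}
          \<union> {reg_quot AV (ideal_pow AV I (n - j + 1)) + reg_quot BV (ideal_pow BV J j) | j. j \<in> {1..n}}))"
proof -
  note hI = hideal_homog_ideal[OF I(1)] and hJ = hideal_homog_ideal[OF J(1)]
  define M where "M = gen_ideal RV (I \<union> J)"
  have fin: "finite AV" "finite BV" "finite RV" unfolding AV_def BV_def RV_def by auto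
  have R: "RV = AV \<union> BV" unfolding AV_def BV_def RV_def by auto
  have less: "\<forall>a\<in>AV. \<forall>b\<in>BV. a < b" unfolding AV_def BV_def by auto
  note ctxt = fin(1,2) less R hI hJ M_def
  have hM: "hideal RV M" by (rule hideal_sum_ideal[OF ctxt])
  note hMn = hideal_ideal_pow[OF hM, of n] and hIp = hideal_ideal_pow[OF hI] and hJp = hideal_ideal_pow[OF hJ]
  \<comment> \<open>Elements of I and J have no constant term, and this passes to sums and
    multiples, hence to M and to its powers with exponent at least 1.\<close>
  have "1 \<notin> ideal_pow RV M n"
  proof
    assume 1: "1 \<in> ideal_pow RV M n"
    obtain m where "n = Suc m" using n by (cases n) auto
    then have "1 \<in> tens M (ideal_pow RV M m)" using 1 ideal_pow_Suc_tens[OF hM hM] by simp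
    moreover have "psum (tens I (poly_ring BV)) (tens (poly_ring AV) J) \<subseteq> {p. 0 \<notin> keys p}"
      by (intro psum_least[OF add_closed_const_0] tens_least[OF add_closed_const_0])
        (use keys_mult_0 proper_hideal_const[OF hI I(3)] proper_hideal_const[OF hJ J(3)] in blast)+
    then have "M \<subseteq> {p. 0 \<notin> keys p}" by (subst sum_ideal_eq[OF ctxt])
    then have "tens M (ideal_pow RV M m) \<subseteq> {p. 0 \<notin> keys p}"
      by (intro tens_least[OF add_closed_const_0]) (use keys_mult_0 in blast)
    ultimately show False by auto
  qed
  \<comment> \<open>This class makes both the set under \<open>LEAST\<close> and the set under
    \<open>Sup\<close> nonempty.\<close>
  then obtain k0 where k0: "loc_coh_nonzero RV (ideal_pow RV M n) k0 (- int k0)"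
    using exists_not_exact[OF fin(3) hMn] loc_coh_nonzero_iff[OF fin(3) hMn] by blast
  let ?dA = "\<lambda>p. depth_quot AV (ideal_pow AV I p)" and ?dB = "\<lambda>p. depth_quot BV (ideal_pow BV J p)"
  let ?rA = "\<lambda>p. reg_quot AV (ideal_pow AV I p)" and ?rB = "\<lambda>p. reg_quot BV (ideal_pow BV J p)"
  let ?D = "{?dA (n - i) + ?dB i + 1 | i. i \<in> {1..n-1}} \<union> {?dA (n - j + 1) + ?dB j | j. j \<in> {1..n}}"
  let ?G = "{?rA (n - i) + ?rB i + 1 | i. i \<in> {1..n-1}} \<union> {?rA (n - j + 1) + ?rB j | j. j \<in> {1..n}}"
  have key: "(\<exists>d\<in>?D. d \<le> k) \<and> (\<exists>g\<in>?G. t + int k \<le> g)" if nz: "loc_coh_nonzero RV (ideal_pow RV M n) k t" for k t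
  proof -
    have "\<not> exact RV (poly_ring RV) (ideal_pow RV M n) (int k) t"
      using nz loc_coh_nonzero_iff[OF fin(3) hMn] by blast
    then obtain i k1 a where i: "i < n"
      and B: "\<not> exact BV (poly_ring BV) (ideal_pow BV J (n - i)) (int k - k1) (t - a)"
      and A: "\<not> exact AV (poly_ring AV) (ideal_pow AV I (Suc i)) k1 a \<or>
        0 < i \<and> \<not> exact AV (poly_ring AV) (ideal_pow AV I i) (k1 - 1) a"
      by (rule not_exact_pow_sum[OF ctxt])
    obtain l where l: "int k - k1 = int l" "loc_coh_nonzero BV (ideal_pow BV J (n - i)) l (t - a)"
      by (rule not_exact_loc_coh[OF fin(2) hJp B])
    have lB: "?dB (n - i) \<le> l" "t - a + int l \<le> ?rB (n - i)"
      by (rule depth_quot_le[OF l(2)] reg_quot_ge[OF fin(2) hJp l(2)])+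
    from A show ?thesis
    proof
      assume "\<not> exact AV (poly_ring AV) (ideal_pow AV I (Suc i)) k1 a"
      then obtain m where m: "k1 = int m" "loc_coh_nonzero AV (ideal_pow AV I (Suc i)) m a"
        by (rule not_exact_loc_coh[OF fin(1) hIp])
      have mA: "?dA (Suc i) \<le> m" "a + int m \<le> ?rA (Suc i)"
        by (rule depth_quot_le[OF m(2)] reg_quot_ge[OF fin(1) hIp m(2)])+
      \<comment> \<open>As i runs from 0 to n - 1, the index j = n - i of the statement runs from n
        down to 1, and n - j + 1 = i + 1.\<close>
      let ?j = "n - i"
      have j: "?j \<in> {1..n}" "n - ?j + 1 = Suc i" using i by auto
      have "?dA (n - ?j + 1) + ?dB ?j \<in> ?D" "?rA (n - ?j + 1) + ?rB ?j \<in> ?G" using j(1) by blast+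
      then have "?dA (Suc i) + ?dB ?j \<in> ?D" "?rA (Suc i) + ?rB ?j \<in> ?G" unfolding j(2) .
      moreover have "?dA (Suc i) + ?dB ?j \<le> k" "t + int k \<le> ?rA (Suc i) + ?rB ?j"
        using lB mA l(1) m(1) by linarith+
      ultimately show ?thesis by blast
    next
      assume i': "0 < i \<and> \<not> exact AV (poly_ring AV) (ideal_pow AV I i) (k1 - 1) a"
      from i'[THEN conjunct2] obtain m where m: "k1 - 1 = int m" "loc_coh_nonzero AV (ideal_pow AV I i) m a"
        by (rule not_exact_loc_coh[OF fin(1) hIp])
      have mA: "?dA i \<le> m" "a + int m \<le> ?rA i"
        by (rule depth_quot_le[OF m(2)] reg_quot_ge[OF fin(1) hIp m(2)])+
      \<comment> \<open>The class of A/I^i sits one degree lower, so k = m + l + 1, which is the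
        summand 1 in the bounds. The index n - i is at most n - 1 because 0 < i.\<close>
      let ?j = "n - i"
      have j: "?j \<in> {1..n-1}" "n - ?j = i" using i i' by auto
      have "?dA (n - ?j) + ?dB ?j + 1 \<in> ?D" "?rA (n - ?j) + ?rB ?j + 1 \<in> ?G" using j(1) by blast+
      then have "?dA i + ?dB ?j + 1 \<in> ?D" "?rA i + ?rB ?j + 1 \<in> ?G" unfolding j(2) .
      moreover have "?dA i + ?dB ?j + 1 \<le> k" "t + int k \<le> ?rA i + ?rB ?j + 1"
        using lB mA l(1) m(1) by linarith+
      ultimately show ?thesis by blast
    qed
  qed
  have finD: "finite ?D" "finite ?G" by simp_all
  have "\<exists>t. loc_coh_nonzero RV (ideal_pow RV M n) (depth_quot RV (ideal_pow RV M n)) t"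
    unfolding depth_quot_def by (rule LeastI_ex) (use k0 in blast)
  then obtain t where "loc_coh_nonzero RV (ideal_pow RV M n) (depth_quot RV (ideal_pow RV M n)) t" ..
  from key[OF this, THEN conjunct1] obtain d where d: "d \<in> ?D" "d \<le> depth_quot RV (ideal_pow RV M n)" ..
  have "Min ?D \<le> depth_quot RV (ideal_pow RV M n)" by (rule order_trans[OF Min_le[OF finD(1) d(1)] d(2)])
  moreover have "reg_quot RV (ideal_pow RV M n) \<le> Max ?G"
    unfolding reg_quot_def[of RV]
  proof (rule cSup_least)
    show "{t + int i | i t. loc_coh_nonzero RV (ideal_pow RV M n) i t} \<noteq> {}" using k0 by blast
    fix x assume "x \<in> {t + int i | i t. loc_coh_nonzero RV (ideal_pow RV M n) i t}"
    then obtain i t where x: "x = t + int i" and nz: "loc_coh_nonzero RV (ideal_pow RV M n) i t" by blast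
    from key[OF nz, THEN conjunct2] obtain g where g: "g \<in> ?G" "t + int i \<le> g" ..
    show "x \<le> Max ?G" unfolding x by (rule order_trans[OF g(2) Max_ge[OF finD(2) g(1)]])
  qed
  ultimately show ?thesis unfolding M_def by (rule conjI)
qed

end
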